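(* Consider the Gaussian random many-access channel with $\ell_n$ users at blocklength $n$, each active independently with probability $\alpha_n$, where $\alpha_n\to\alpha\in[0,1]$ as $n\to\infty$, with average number of active users $k_n=\alpha_n\ell_n$ and noise variance $N_0/2$ per channel use. Assume that $k_n=\Omega(1)$. Then the capacity per unit-energy $\dot{C}$ has the following behavior: 1) If $k_n\log \ell_n=o(n)$, then $\dot{C}=\frac{\log e}{N_0}$. 2) If $k_n\log \ell_n=\omega(n)$, then $\dot{C}=0$.
   Context: Model. Let $N_0>0$. For each blocklength $n$ there are $\ell_n$ users with mutually independent messages $W_1,\dots,W_{\ell_n}$. User $i$'s message takes values in $\{0,1,\dots,M_n\}$ with $\Pr\{W_i=0\}=1-\alpha_n$ (user inactive) and $\Pr\{W_i=w\}=\alpha_n/M_n$ for $w\in\{1,\dots,M_n\}$. The received vector is $\mathbf{Y}=\sum_{i=1}^{\ell_n}\mathbf{X}_i(W_i)+\mathbf{Z}\in\mathbb{R}^n$, where $\mathbf{X}_i(W_i)\in\mathbb{R}^n$ is user $i$'s codeword and $\mathbf{Z}$ has i.i.d. $\mathcal{N}(0,N_0/2)$ components, independent of the messages. Codes. A (symmetric) $(n,M_n,E_n,\epsilon)$ code, $0\le\epsilon<1$, consists of encoding functions $f_i:\{0,1,\dots,M_n\}\to\mathbb{R}^n$, $i=1,\dots,\ell_n$, mapping $W_i$ to $\mathbf{X}_i(W_i)$, with $f_i(0)=\mathbf{0}$ and $\|f_i(w)\|^2\le E_n$ for all $w$, and a decoding function $g:\mathbb{R}^n\to\{0,1,\dots,M_n\}^{\ell_n}$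 such that $P_e^{(n)}=\Pr\{g(\mathbf{Y})\ne(W_1,\dots,W_{\ell_n})\}\le\epsilon$. Only symmetric codes (same $M_n$ and $E_n$ for all users) are considered. Capacity per unit-energy. A rate per unit-energy $\dot{R}$ is $\epsilon$-achievable if for every $\delta>0$ there is $n_0$ such that for every $n\ge n_0$ there is an $(n,M_n,E_n,\epsilon)$ code with $\frac{\log M_n}{E_n}>\dot{R}-\delta$. It is achievable if it is $\epsilon$-achievable for all $0<\epsilon<1$. The capacity per unit-energy $\dot{C}$ is the supremum of all achievable rates per unit-energy. All logarithms $\log$ are to the same fixed base. Order notation for nonnegative sequences: $a_n=o(b_n)$ means $a_n/b_n\to0$; $a_n=\omega(b_n)$ means $a_n/b_n\to\infty$; $a_n=\Omega(b_n)$ means $\liminf_{n\to\infty} a_n/b_n>0$. *)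

theory Defs
  imports "HOL-Probability.Probability" "HOL-Library.Landau_Symbols"
begin

text \<open>
  Vectors in n-dimensional space and tuples of messages are functions on the index sets
  \<open>{..<n}\<close> and \<open>{..<l}\<close>.  The parameter \<open>b > 1\<close> is the base of all logarithms.
\<close>

definition message_pmf :: "real \<Rightarrow> nat \<Rightarrow> nat pmf" where
  "message_pmf \<alpha> M =
     bind_pmf (bernoulli_pmf \<alpha>) (\<lambda>active. if active then pmf_of_set {1..M} else return_pmf 0)"

lemma pmf_message_pmf:
  assumes "0 \<le> \<alpha>" "\<alpha> \<le> 1" "M \<ge> 1"
  shows "pmf (message_pmf \<alpha> M) w =
           (if w = 0 then 1 - \<alpha> else if w \<le> M then \<alpha> / real M else 0)"
  using assms by (auto simp: message_pmf_def pmf_bind pmf_of_set indicator_def)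

definition noise_measure :: "real \<Rightarrow> nat \<Rightarrow> (nat \<Rightarrow> real) measure" where
  "noise_measure N0 n = (\<Pi>\<^sub>M j\<in>{..<n}. density lborel (normal_density 0 (sqrt (N0 / 2))))"

definition channel_measure ::
    "real \<Rightarrow> real \<Rightarrow> nat \<Rightarrow> nat \<Rightarrow> nat \<Rightarrow> ((nat \<Rightarrow> nat) \<times> (nat \<Rightarrow> real)) measure" where
  "channel_measure N0 \<alpha> l n M =
     (\<Pi>\<^sub>M i\<in>{..<l}. measure_pmf (message_pmf \<alpha> M)) \<Otimes>\<^sub>M noise_measure N0 n"

definition received ::
    "nat \<Rightarrow> nat \<Rightarrow> (nat \<Rightarrow> nat \<Rightarrow> nat \<Rightarrow> real) \<Rightarrow> (nat \<Rightarrow> nat) \<Rightarrow> (nat \<Rightarrow> real) \<Rightarrow> nat \<Rightarrow> real" where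
  "received l n f W Z = (\<lambda>j\<in>{..<n}. (\<Sum>i<l. f i (W i) j) + Z j)"

definition error_prob ::
    "real \<Rightarrow> real \<Rightarrow> nat \<Rightarrow> nat \<Rightarrow> nat \<Rightarrow> (nat \<Rightarrow> nat \<Rightarrow> nat \<Rightarrow> real) \<Rightarrow>
     ((nat \<Rightarrow> real) \<Rightarrow> nat \<Rightarrow> nat) \<Rightarrow> real" where
  "error_prob N0 \<alpha> l n M f g =
     measure (channel_measure N0 \<alpha> l n M)
       {(W, Z) \<in> space (channel_measure N0 \<alpha> l n M). g (received l n f W Z) \<noteq> W}"

text \<open>
  Here \<open>f i w j\<close> is the \<open>j\<close>-th coordinate of user \<open>i\<close>'s codeword for message \<open>w\<close>.
  The decoder is required to be (Borel) measurable, so that its error probability is meaningful;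
  \<open>M \<ge> 1\<close> is needed for the message distribution to exist.
\<close>

definition is_code ::
    "real \<Rightarrow> real \<Rightarrow> nat \<Rightarrow> nat \<Rightarrow> nat \<Rightarrow> real \<Rightarrow> real \<Rightarrow>
     (nat \<Rightarrow> nat \<Rightarrow> nat \<Rightarrow> real) \<Rightarrow> ((nat \<Rightarrow> real) \<Rightarrow> nat \<Rightarrow> nat) \<Rightarrow> bool" where
  "is_code N0 \<alpha> l n M E \<epsilon> f g \<longleftrightarrow>
     M \<ge> 1 \<and> 0 \<le> \<epsilon> \<and> \<epsilon> < 1 \<and>
     (\<forall>i<l. \<forall>j<n. f i 0 j = 0) \<and>
     (\<forall>i<l. \<forall>w\<in>{0..M}. (\<Sum>j<n. (f i w j)\<^sup>2) \<le> E) \<and>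
     g \<in> (\<Pi>\<^sub>M j\<in>{..<n}. borel) \<rightarrow>\<^sub>M count_space ({..<l} \<rightarrow>\<^sub>E {0..M}) \<and>
     error_prob N0 \<alpha> l n M f g \<le> \<epsilon>"

lemma error_event_measurable:
  assumes g: "g \<in> (\<Pi>\<^sub>M j\<in>{..<n}. borel) \<rightarrow>\<^sub>M count_space ({..<l} \<rightarrow>\<^sub>E {0..M})"
  shows "{(W, Z) \<in> space (channel_measure N0 \<alpha> l n M). g (received l n f W Z) \<noteq> W}
           \<in> sets (channel_measure N0 \<alpha> l n M)"
proof -
  let ?C = "channel_measure N0 \<alpha> l n M"
  let ?P = "\<Pi>\<^sub>M i\<in>{..<l}. measure_pmf (message_pmf \<alpha> M)"
  let ?T = "{..<l} \<rightarrow>\<^sub>E {0..M}"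
  have W: "(\<lambda>\<omega>. fst \<omega> i) \<in> ?C \<rightarrow>\<^sub>M count_space UNIV" if "i < l" for i
    using that unfolding channel_measure_def
    by (intro measurable_compose[OF measurable_fst])
       (auto intro: measurable_compose[OF measurable_component_singleton])
  have Z: "(\<lambda>\<omega>. snd \<omega> j) \<in> borel_measurable ?C" if "j < n" for j
    using that unfolding channel_measure_def noise_measure_def
    by (intro measurable_compose[OF measurable_snd])
       (auto intro: measurable_compose[OF measurable_component_singleton])
  have "(\<lambda>\<omega>. received l n f (fst \<omega>) (snd \<omega>)) \<in> ?C \<rightarrow>\<^sub>M (\<Pi>\<^sub>M j\<in>{..<n}. borel)"
    unfolding received_def
    by (intro measurable_restrict borel_measurable_add borel_measurable_sum Z
          measurable_compose[OF W]) auto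
  from measurable_compose[OF this g]
  have gY: "(\<lambda>\<omega>. g (received l n f (fst \<omega>) (snd \<omega>))) \<in> ?C \<rightarrow>\<^sub>M count_space ?T" .
  have eqW: "{\<omega> \<in> space ?C. fst \<omega> = w} \<in> sets ?C" if "w \<in> ?T" for w
  proof -
    have "{\<omega> \<in> space ?C. fst \<omega> = w} = {\<omega> \<in> space ?C. \<forall>i\<in>{..<l}. fst \<omega> i = w i}"
    proof -
      have "v = w" if "v \<in> {..<l} \<rightarrow>\<^sub>E UNIV" "\<forall>i\<in>{..<l}. v i = w i" for v
        using that \<open>w \<in> ?T\<close> by (metis PiE_arb ext)
      then show ?thesis
        by (auto simp: channel_measure_def space_pair_measure space_PiM)
    qed
    also have "\<dots> \<in> sets ?C"
    proof (intro sets.sets_Collect_finite_All)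
      fix i assume "i \<in> {..<l}"
      then show "{\<omega> \<in> space ?C. fst \<omega> i = w i} \<in> sets ?C"
        using measurable_sets[OF W, of i "{w i}"] by (simp add: vimage_def Int_def conj_commute)
    qed simp
    finally show ?thesis .
  qed
  have eqg: "{\<omega> \<in> space ?C. g (received l n f (fst \<omega>) (snd \<omega>)) = w} \<in> sets ?C"
    if "w \<in> ?T" for w
    using measurable_sets[OF gY, of "{w}"] that
    by (auto simp: vimage_def Int_def conj_commute)
  have "{(W, Z) \<in> space ?C. g (received l n f W Z) \<noteq> W} =
      space ?C - (\<Union>w\<in>?T. {\<omega> \<in> space ?C. fst \<omega> = w} \<inter>
        {\<omega> \<in> space ?C. g (received l n f (fst \<omega>) (snd \<omega>)) = w})"
    using measurable_space[OF gY] by fastforce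
  also have "\<dots> \<in> sets ?C"
    by (intro sets.Diff sets.top sets.finite_UN sets.Int eqW eqg)
       (auto intro: finite_PiE)
  finally show ?thesis .
qed

definition eps_achievable ::
    "real \<Rightarrow> real \<Rightarrow> (nat \<Rightarrow> real) \<Rightarrow> (nat \<Rightarrow> nat) \<Rightarrow> real \<Rightarrow> real \<Rightarrow> bool" where
  "eps_achievable b N0 \<alpha> l \<epsilon> R \<longleftrightarrow>
     (\<forall>\<delta>>0. \<exists>n0. \<forall>n\<ge>n0. \<exists>M E f g.
        is_code N0 (\<alpha> n) (l n) n M E \<epsilon> f g \<and> E > 0 \<and> log b (real M) / E > R - \<delta>)"

definition achievable ::
    "real \<Rightarrow> real \<Rightarrow> (nat \<Rightarrow> real) \<Rightarrow> (nat \<Rightarrow> nat) \<Rightarrow> real \<Rightarrow> bool" where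
  "achievable b N0 \<alpha> l R \<longleftrightarrow> (\<forall>\<epsilon>. 0 < \<epsilon> \<and> \<epsilon> < 1 \<longrightarrow> eps_achievable b N0 \<alpha> l \<epsilon> R)"

text \<open>
  The supremum is taken in the extended reals, so that a finite value of the capacity
  includes the boundedness of the set of achievable rates.
\<close>

definition capacity_per_unit_energy ::
    "real \<Rightarrow> real \<Rightarrow> (nat \<Rightarrow> real) \<Rightarrow> (nat \<Rightarrow> nat) \<Rightarrow> ereal" where
  "capacity_per_unit_energy b N0 \<alpha> l = Sup (ereal ` {R. achievable b N0 \<alpha> l R})"

end

theory Submission
  imports Defs "HOL-Library.Nat_Bijection"
begin

text \<open>
  Converse.  Integrating \<open>u \<le> exp u - 1\<close> for a shifted log-likelihood ratio of two Gaussian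
  measures \<open>P\<close>, \<open>Q\<close> gives \<open>c P(D) \<le> exp c Q(D) + KL(P, Q)\<close> for every event \<open>D\<close>.  Applied to
  decoding regions, with three choices of \<open>Q\<close>, this yields for a code with \<open>M \<ge> 2\<close>:
  \<^item> \<open>Q\<close> the output law of a tuple that differs from the sent one by moving or altering the message
    of one active user.  There are at least \<open>l\<close> such equally likely tuples, so
    \<open>ln (l / \<epsilon>) = O(1 + E)\<close>.
  \<^item> \<open>Q\<close> the output law when the first active user is silenced: \<open>ln M\<close> is at most about
    \<open>1 + E / N0\<close>.  Since \<open>E\<close> is large when \<open>\<epsilon>\<close> is small, no rate exceeds \<open>1 / N0\<close> nats.
  \<^item> \<open>Q\<close> the Gaussian measure with the mean and the average variance of the output: \<open>k ln M\<close> is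
    \<open>O(1 + n ln (1 + 2 k E / (n N0)))\<close>.  At a positive rate this bounds \<open>k E / n\<close>, and hence, by
    the first item, \<open>k ln l / n\<close>.

  Achievability.  Take \<open>E = K max 1 (ln l)\<close> with a large constant \<open>K\<close>, codewords with random
  coordinates \<open>\<plusminus> sqrt (E / n)\<close>, and decide for each pair of a user and a message by comparing the
  correlation of the output with the codeword to a threshold slightly below \<open>E\<close>.  As \<open>k E / n\<close> tends
  to 0, the interference of the other users is negligible against the noise, and Chernoff bounds show
  that \<open>ln M = \<rho> E\<close> is possible for every \<open>\<rho> < 1 / N0\<close>.
\<close>

section \<open>Gaussian measures\<close>

text \<open>\<open>k\<close> is only bounded below, so the probability that nobody is active need
  not vanish, and a decoder guessing silence may then be right without any energy being spent. The
  converse therefore uses that achievability quantifies over all error levels: \<epsilon> is taken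
  small against the lower bound \<open>c / (c + 4)\<close> on the probability of activity. The same
  choice forces large energy when \<open>l\<close> is bounded and \<open>ln l\<close> gives nothing,
  which makes the additive 1 of the single-user bound negligible.

  The divergence inequality takes the place of Fano's: being linear in P(D) and Q(D), it restricts
  to tuples with enough active users and sums over disjoint decoding regions, and no message entropy
  appears.

  In the construction, a threshold \<open>(1 - \<eta>) * E\<close> against a correlation variance of
  about \<open>E * N0 / 2\<close> gives a false-alarm exponent close to \<open>E / N0\<close>. It
  has to pay for \<open>l * M\<close> tests, and since \<open>ln l\<close> is a small fraction of
  \<open>E\<close>, nearly all of it is left for \<open>ln M\<close>. Misses only compete with
  \<open>l\<close>, so the threshold may be close to \<open>E\<close>. The maximum with 1 in the
  energy pays for the fixed error level when \<open>l\<close> is small.\<close>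

definition gauss :: "nat \<Rightarrow> real \<Rightarrow> (nat \<Rightarrow> real) \<Rightarrow> (nat \<Rightarrow> real) measure" where
  "gauss n \<sigma> x = (\<Pi>\<^sub>M j\<in>{..<n}. density lborel (normal_density (x j) \<sigma>))"

lemma noise_measure_eq_gauss: "noise_measure N0 n = gauss n (sqrt (N0 / 2)) (\<lambda>_. 0)"
  by (simp add: noise_measure_def gauss_def)

lemma sets_gauss [simp, measurable_cong]: "sets (gauss n \<sigma> x) = sets (\<Pi>\<^sub>M j\<in>{..<n}. borel)"
  unfolding gauss_def by (intro sets_PiM_cong) auto

lemma space_gauss [simp]: "space (gauss n \<sigma> x) = {..<n} \<rightarrow>\<^sub>E UNIV"
  by (simp add: gauss_def space_PiM)

lemma product_prob_space_normal:
  assumes "\<sigma> > 0"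
  shows "product_prob_space (\<lambda>j. density lborel (normal_density (x j) \<sigma>))"
  using assms by (intro product_prob_spaceI prob_space_normal_density)

lemma prob_space_gauss: "\<sigma> > 0 \<Longrightarrow> prob_space (gauss n \<sigma> x)"
  unfolding gauss_def by (intro prob_space_PiM prob_space_normal_density)

lemma gauss_eqI:
  assumes "\<sigma> > 0" and "sets P = sets (\<Pi>\<^sub>M j\<in>{..<n}. borel)"
    and "\<And>A. (\<And>j. j < n \<Longrightarrow> A j \<in> sets borel) \<Longrightarrow>
      emeasure P (Pi\<^sub>E {..<n} A) = (\<Prod>j<n. emeasure (density lborel (normal_density (x j) \<sigma>)) (A j))"
  shows "P = gauss n \<sigma> x"
proof -
  interpret product_prob_space "\<lambda>j. density lborel (normal_density (x j) \<sigma>)"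
    using assms(1) by (rule product_prob_space_normal)
  show ?thesis
    unfolding gauss_def
  proof (rule PiM_eqI)
    show "sets P = sets (Pi\<^sub>M {..<n} (\<lambda>j. density lborel (\<lambda>y. ennreal (normal_density (x j) \<sigma> y))))"
      unfolding assms(2) by (intro sets_PiM_cong) auto
  qed (use assms(3) in auto)
qed

lemma emeasure_gauss_PiE:
  assumes "\<sigma> > 0" and "\<And>j. j < n \<Longrightarrow> A j \<in> sets borel"
  shows "emeasure (gauss n \<sigma> x) (Pi\<^sub>E {..<n} A) =
    (\<Prod>j<n. emeasure (density lborel (normal_density (x j) \<sigma>)) (A j))"
proof -
  interpret product_prob_space "\<lambda>j. density lborel (normal_density (x j) \<sigma>)"
    using assms(1) by (rule product_prob_space_normal)
  show ?thesis
    unfolding gauss_def by (rule emeasure_PiM) (use assms in auto)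
qed

lemma nn_integral_gauss_prod:
  assumes "\<sigma> > 0" and "\<And>j. j < n \<Longrightarrow> h j \<in> borel_measurable borel"
  shows "(\<integral>\<^sup>+y. (\<Prod>j<n. h j (y j)) \<partial>gauss n \<sigma> x) =
    (\<Prod>j<n. \<integral>\<^sup>+t. h j t \<partial>density lborel (normal_density (x j) \<sigma>))"
proof -
  interpret product_prob_space "\<lambda>j. density lborel (normal_density (x j) \<sigma>)"
    using assms(1) by (rule product_prob_space_normal)
  show ?thesis
    unfolding gauss_def by (rule product_nn_integral_prod) (use assms in auto)
qed

section \<open>Translates and likelihood ratios of Gaussian product measures\<close>

lemma distr_normal_density_shift:
  "distr (density lborel (normal_density 0 \<sigma>)) borel (\<lambda>t. a + t) = density lborel (normal_density a \<sigma>)"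
proof -
  have "density lborel (normal_density a \<sigma>) = density (distr lborel borel ((+) a)) (normal_density a \<sigma>)"
    using lborel_distr_plus[of a] by simp
  also have "\<dots> = distr (density lborel (\<lambda>t. normal_density a \<sigma> (a + t))) borel ((+) a)"
    by (subst density_distr) auto
  finally show ?thesis
    by (simp add: normal_density_def)
qed

lemma distr_gauss_translate:
  assumes "\<sigma> > 0"
  shows "distr (gauss n \<sigma> (\<lambda>_. 0)) (\<Pi>\<^sub>M j\<in>{..<n}. borel) (\<lambda>Z. \<lambda>j\<in>{..<n}. x j + Z j) = gauss n \<sigma> x"
proof (rule gauss_eqI[OF assms])
  have meas [measurable]: "(\<lambda>Z. \<lambda>j\<in>{..<n}. x j + Z j) \<in> gauss n \<sigma> (\<lambda>_. 0) \<rightarrow>\<^sub>M (\<Pi>\<^sub>M j\<in>{..<n}. borel)"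
    by measurable
  fix A :: "nat \<Rightarrow> real set" assume A [measurable]: "\<And>j. j < n \<Longrightarrow> A j \<in> sets borel"
  have "emeasure (distr (gauss n \<sigma> (\<lambda>_. 0)) (\<Pi>\<^sub>M j\<in>{..<n}. borel) (\<lambda>Z. \<lambda>j\<in>{..<n}. x j + Z j)) (Pi\<^sub>E {..<n} A) =
    emeasure (gauss n \<sigma> (\<lambda>_. 0)) (Pi\<^sub>E {..<n} (\<lambda>j. (\<lambda>t. x j + t) -` A j))"
    using A by (subst emeasure_distr) (auto intro!: arg_cong2[where f=emeasure] simp: PiE_iff)
  also have "\<dots> = (\<Prod>j<n. emeasure (density lborel (normal_density 0 \<sigma>)) ((\<lambda>t. x j + t) -` A j))"
    using A measurable_sets[of "\<lambda>t. x _ + t" borel borel]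
    by (intro emeasure_gauss_PiE assms) auto
  also have "\<dots> = (\<Prod>j<n. emeasure (density lborel (normal_density (x j) \<sigma>)) (A j))"
    by (intro prod.cong refl, subst distr_normal_density_shift[symmetric], subst emeasure_distr) (use A in auto)
  finally show "emeasure (distr (gauss n \<sigma> (\<lambda>_. 0)) (\<Pi>\<^sub>M j\<in>{..<n}. borel) (\<lambda>Z. \<lambda>j\<in>{..<n}. x j + Z j)) (Pi\<^sub>E {..<n} A) =
    (\<Prod>j<n. emeasure (density lborel (normal_density (x j) \<sigma>)) (A j))" .
qed simp

text \<open>Logarithm of the density of the first normal law (\<mu>, \<sigma>) over the second
  (\<nu>, \<tau>). The variances may differ because the sum-rate bound compares with a wider output
  law.\<close>

definition normal_llr :: "real \<Rightarrow> real \<Rightarrow> real \<Rightarrow> real \<Rightarrow> real \<Rightarrow> real" where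
  "normal_llr \<mu> \<sigma> \<nu> \<tau> t = ln (\<tau> / \<sigma>) + (t - \<nu>)\<^sup>2 / (2 * \<tau>\<^sup>2) - (t - \<mu>)\<^sup>2 / (2 * \<sigma>\<^sup>2)"

lemma borel_measurable_normal_llr [measurable]: "normal_llr \<mu> \<sigma> \<nu> \<tau> \<in> borel_measurable borel"
  unfolding normal_llr_def by measurable

lemma normal_density_times_exp_llr:
  assumes "\<sigma> > 0" "\<tau> > 0"
  shows "normal_density \<mu> \<sigma> t * exp (- normal_llr \<mu> \<sigma> \<nu> \<tau> t) = normal_density \<nu> \<tau> t"
proof -
  let ?a = "(t - \<nu>)\<^sup>2 / (2 * \<tau>\<^sup>2)" and ?b = "(t - \<mu>)\<^sup>2 / (2 * \<sigma>\<^sup>2)"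
  have "exp (- normal_llr \<mu> \<sigma> \<nu> \<tau> t) = exp (- ?a) * exp ?b / exp (ln (\<tau> / \<sigma>))"
    by (simp add: normal_llr_def flip: exp_add exp_diff)
  also have "exp (ln (\<tau> / \<sigma>)) = \<tau> / \<sigma>"
    using assms by simp
  finally have l: "exp (- normal_llr \<mu> \<sigma> \<nu> \<tau> t) = exp (- ?a) * exp ?b / (\<tau> / \<sigma>)" .
  have s: "sqrt (2 * pi * \<sigma>\<^sup>2) = sqrt (2 * pi) * \<sigma>" "sqrt (2 * pi * \<tau>\<^sup>2) = sqrt (2 * pi) * \<tau>"
    using assms by (simp_all add: real_sqrt_mult)
  have "exp (- ?b) * exp ?b = 1"
    by (simp flip: exp_add)
  then have "1 / (S * \<sigma>) * exp (- ?b) * (exp (- ?a) * exp ?b / (\<tau> / \<sigma>)) = 1 / (S * \<tau>) * exp (- ?a)" for S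
    using assms by (simp add: divide_simps mult_ac)
  then show ?thesis
    unfolding normal_density_def l s minus_divide_left by blast
qed

definition gauss_llr :: "nat \<Rightarrow> real \<Rightarrow> (nat \<Rightarrow> real) \<Rightarrow> real \<Rightarrow> (nat \<Rightarrow> real) \<Rightarrow> (nat \<Rightarrow> real) \<Rightarrow> real" where
  "gauss_llr n \<sigma> x \<tau> m y = (\<Sum>j<n. normal_llr (x j) \<sigma> (m j) \<tau> (y j))"

lemma borel_measurable_gauss_llr [measurable]:
  "gauss_llr n \<sigma> x \<tau> m \<in> borel_measurable (\<Pi>\<^sub>M j\<in>{..<n}. borel)"
  unfolding gauss_llr_def by measurable

text \<open>Densities factor over coordinates, so rectangles suffice. The identity serves twice: for
  the divergence bound of the converse, and as exponential tilting in
  \<open>gauss_chernoff\<close>.\<close>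

lemma gauss_change_of_measure:
  assumes "\<sigma> > 0" "\<tau> > 0"
  shows "density (gauss n \<sigma> x) (\<lambda>y. ennreal (exp (- gauss_llr n \<sigma> x \<tau> m y))) = gauss n \<tau> m"
proof (rule gauss_eqI[OF assms(2)])
  fix A :: "nat \<Rightarrow> real set" assume A [measurable]: "\<And>j. j < n \<Longrightarrow> A j \<in> sets borel"
  have [measurable]: "Pi\<^sub>E {..<n} A \<in> sets (\<Pi>\<^sub>M j\<in>{..<n}. borel)"
    using A by (intro sets_PiM_I_finite) auto
  have ind: "indicator (Pi\<^sub>E {..<n} A) y = (\<Prod>j<n. indicator (A j) (y j) :: ennreal)"
    if y: "y \<in> {..<n} \<rightarrow>\<^sub>E UNIV" for y
  proof (cases "y \<in> Pi\<^sub>E {..<n} A")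
    case True
    then show ?thesis by (simp add: PiE_iff)
  next
    case False
    then obtain j where "j < n" "y j \<notin> A j" using y by (auto simp: PiE_iff)
    then have "(\<Prod>j<n. indicator (A j) (y j) :: ennreal) = 0"
      by (intro prod_zero) (auto intro!: bexI[of _ j])
    then show ?thesis using False by simp
  qed
  have "emeasure (density (gauss n \<sigma> x) (\<lambda>y. ennreal (exp (- gauss_llr n \<sigma> x \<tau> m y)))) (Pi\<^sub>E {..<n} A) =
    (\<integral>\<^sup>+y. ennreal (exp (- gauss_llr n \<sigma> x \<tau> m y)) * indicator (Pi\<^sub>E {..<n} A) y \<partial>gauss n \<sigma> x)"
    by (rule emeasure_density) measurable
  also have "\<dots> = (\<integral>\<^sup>+y. (\<Prod>j<n. ennreal (exp (- normal_llr (x j) \<sigma> (m j) \<tau> (y j))) * indicator (A j) (y j)) \<partial>gauss n \<sigma> x)"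
    by (intro nn_integral_cong)
       (auto simp: ind gauss_llr_def exp_sum prod.distrib prod_ennreal sum_negf[symmetric])
  also have "\<dots> = (\<Prod>j<n. \<integral>\<^sup>+t. ennreal (exp (- normal_llr (x j) \<sigma> (m j) \<tau> t)) * indicator (A j) t \<partial>density lborel (normal_density (x j) \<sigma>))"
    by (intro nn_integral_gauss_prod[where h = "\<lambda>j t. ennreal (exp (- normal_llr (x j) \<sigma> (m j) \<tau> t)) * indicator (A j) t"] assms borel_measurable_times_ennreal borel_measurable_indicator A) auto
  also have "\<dots> = (\<Prod>j<n. emeasure (density lborel (normal_density (m j) \<tau>)) (A j))"
  proof (intro prod.cong refl)
    fix j assume "j \<in> {..<n}"
    then have [measurable]: "A j \<in> sets borel" by (simp add: A)
    show "(\<integral>\<^sup>+t. ennreal (exp (- normal_llr (x j) \<sigma> (m j) \<tau> t)) * indicator (A j) t \<partial>density lborel (normal_density (x j) \<sigma>))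
      = emeasure (density lborel (normal_density (m j) \<tau>)) (A j)"
      by (subst nn_integral_density, simp, measurable, subst emeasure_density, simp, simp)
         (auto intro!: nn_integral_cong simp: mult.assoc[symmetric] ennreal_mult'[symmetric]
            normal_density_times_exp_llr assms)
  qed
  finally show "emeasure (density (gauss n \<sigma> x) (\<lambda>y. ennreal (exp (- gauss_llr n \<sigma> x \<tau> m y)))) (Pi\<^sub>E {..<n} A) =
    (\<Prod>j<n. emeasure (density lborel (normal_density (m j) \<tau>)) (A j))" .
qed simp

text \<open>Expanding both squares around \<mu> leaves only the central moments of order 0, 1 and 2.
  The value is the Kullback-Leibler divergence of the two normal laws.\<close>

lemma has_bochner_integral_normal_llr:
  assumes "\<sigma> > 0" "\<tau> > 0"
  shows "has_bochner_integral (density lborel (normal_density \<mu> \<sigma>)) (normal_llr \<mu> \<sigma> \<nu> \<tau>)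
    (ln (\<tau> / \<sigma>) + (\<sigma>\<^sup>2 + (\<mu> - \<nu>)\<^sup>2) / (2 * \<tau>\<^sup>2) - 1 / 2)"
proof -
  have m0: "has_bochner_integral lborel (normal_density \<mu> \<sigma>) 1"
    using normal_moment_even[OF assms(1), of \<mu> 0] by simp
  have m1: "has_bochner_integral lborel (\<lambda>t. normal_density \<mu> \<sigma> t * (t - \<mu>)) 0"
    using normal_moment_odd[OF assms(1), of \<mu> 0] by simp
  have m2: "has_bochner_integral lborel (\<lambda>t. normal_density \<mu> \<sigma> t * (t - \<mu>)\<^sup>2) (\<sigma>\<^sup>2)"
    using normal_moment_even[OF assms(1), of \<mu> 1] by (simp add: fact_2)
  let ?c0 = "ln (\<tau> / \<sigma>) + (\<mu> - \<nu>)\<^sup>2 / (2 * \<tau>\<^sup>2)" and ?c1 = "(\<mu> - \<nu>) / \<tau>\<^sup>2" and ?c2 = "1 / (2 * \<tau>\<^sup>2) - 1 / (2 * \<sigma>\<^sup>2)"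
  have "has_bochner_integral lborel
     (\<lambda>t. ?c0 * normal_density \<mu> \<sigma> t + ?c1 * (normal_density \<mu> \<sigma> t * (t - \<mu>)) + ?c2 * (normal_density \<mu> \<sigma> t * (t - \<mu>)\<^sup>2))
     (?c0 * 1 + ?c1 * 0 + ?c2 * \<sigma>\<^sup>2)"
    by (intro has_bochner_integral_add has_bochner_integral_mult_right m0 m1 m2)
  also have "(\<lambda>t. ?c0 * normal_density \<mu> \<sigma> t + ?c1 * (normal_density \<mu> \<sigma> t * (t - \<mu>)) + ?c2 * (normal_density \<mu> \<sigma> t * (t - \<mu>)\<^sup>2))
     = (\<lambda>t. normal_density \<mu> \<sigma> t *\<^sub>R normal_llr \<mu> \<sigma> \<nu> \<tau> t)"
  proof
    fix t
    have e: "(t - \<nu>)\<^sup>2 / (2 * \<tau>\<^sup>2) = (t - \<mu>)\<^sup>2 * (1 / (2 * \<tau>\<^sup>2)) + ?c1 * (t - \<mu>) + (\<mu> - \<nu>)\<^sup>2 / (2 * \<tau>\<^sup>2)"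
      using assms by (simp add: power2_eq_square field_simps)
    have e': "(t - \<mu>)\<^sup>2 / (2 * \<sigma>\<^sup>2) = (t - \<mu>)\<^sup>2 * (1 / (2 * \<sigma>\<^sup>2))"
      by simp
    show "?c0 * normal_density \<mu> \<sigma> t + ?c1 * (normal_density \<mu> \<sigma> t * (t - \<mu>)) + ?c2 * (normal_density \<mu> \<sigma> t * (t - \<mu>)\<^sup>2)
     = normal_density \<mu> \<sigma> t *\<^sub>R normal_llr \<mu> \<sigma> \<nu> \<tau> t"
      unfolding normal_llr_def e e' by (simp only: real_scaleR_def distrib_left distrib_right left_diff_distrib right_diff_distrib mult_ac add_ac)
  qed
  also have "?c0 * 1 + ?c1 * 0 + ?c2 * \<sigma>\<^sup>2 = ln (\<tau> / \<sigma>) + (\<sigma>\<^sup>2 + (\<mu> - \<nu>)\<^sup>2) / (2 * \<tau>\<^sup>2) - 1 / 2"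
    using assms by (simp add: field_simps)
  finally show ?thesis
    by (intro has_bochner_integral_density) auto
qed

lemma has_bochner_integral_gauss_llr:
  assumes "\<sigma> > 0" "\<tau> > 0"
  shows "has_bochner_integral (gauss n \<sigma> x) (gauss_llr n \<sigma> x \<tau> m)
    (\<Sum>j<n. ln (\<tau> / \<sigma>) + (\<sigma>\<^sup>2 + (x j - m j)\<^sup>2) / (2 * \<tau>\<^sup>2) - 1 / 2)"
  unfolding gauss_llr_def
proof (rule has_bochner_integral_sum)
  fix j assume j: "j \<in> {..<n}"
  have "distr (gauss n \<sigma> x) (density lborel (normal_density (x j) \<sigma>)) (\<lambda>y. y j) = density lborel (normal_density (x j) \<sigma>)"
    unfolding gauss_def using j assms by (intro distr_PiM_component prob_space_normal_density) auto
  moreover have "has_bochner_integral (density lborel (normal_density (x j) \<sigma>)) (normal_llr (x j) \<sigma> (m j) \<tau>)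
     (ln (\<tau> / \<sigma>) + (\<sigma>\<^sup>2 + (x j - m j)\<^sup>2) / (2 * \<tau>\<^sup>2) - 1 / 2)"
    by (rule has_bochner_integral_normal_llr[OF assms])
  ultimately have "has_bochner_integral (distr (gauss n \<sigma> x) (density lborel (normal_density (x j) \<sigma>)) (\<lambda>y. y j)) (normal_llr (x j) \<sigma> (m j) \<tau>)
     (ln (\<tau> / \<sigma>) + (\<sigma>\<^sup>2 + (x j - m j)\<^sup>2) / (2 * \<tau>\<^sup>2) - 1 / 2)"
    by simp
  then show "has_bochner_integral (gauss n \<sigma> x) (\<lambda>y. normal_llr (x j) \<sigma> (m j) \<tau> (y j))
     (ln (\<tau> / \<sigma>) + (\<sigma>\<^sup>2 + (x j - m j)\<^sup>2) / (2 * \<tau>\<^sup>2) - 1 / 2)"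
    using j by (auto simp: has_bochner_integral_iff integrable_distr_eq integral_distr)
qed

text \<open>The constant \<open>c\<close> stays free: each converse bound chooses it so that
  \<open>exp c\<close> balances how unlikely D is under the reference measure.\<close>

lemma gauss_divergence_bound:
  assumes pos: "\<sigma> > 0" "\<tau> > 0" and D [measurable]: "D \<in> sets (\<Pi>\<^sub>M j\<in>{..<n}. borel)"
  shows "c * measure (gauss n \<sigma> x) D \<le> exp c * measure (gauss n \<tau> m) D
    + (\<Sum>j<n. ln (\<tau> / \<sigma>) + (\<sigma>\<^sup>2 + (x j - m j)\<^sup>2) / (2 * \<tau>\<^sup>2) - 1 / 2)"
proof -
  let ?P = "gauss n \<sigma> x" and ?Q = "gauss n \<tau> m" and ?L = "gauss_llr n \<sigma> x \<tau> m"
  interpret P: prob_space ?P by (rule prob_space_gauss[OF pos(1)])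
  interpret Q: prob_space ?Q by (rule prob_space_gauss[OF pos(2)])
  have Q: "?Q = density ?P (\<lambda>y. ennreal (exp (- ?L y)))"
    by (rule gauss_change_of_measure[OF pos, symmetric])
  \<comment> \<open>\<open>?h\<close> is \<open>exp (c * indicator D y)\<close> written affinely in
    the indicator, so its integral needs only the measure of D.\<close>
  let ?h = "\<lambda>y. (exp c - 1) * indicator D y + 1 :: real"
  have hint: "has_bochner_integral ?Q ?h ((exp c - 1) * measure ?Q D + 1)"
  proof -
    have "integrable ?Q (\<lambda>y. (exp c - 1) * indicator D y :: real)"
      using D by (simp add: Q.emeasure_eq_measure)
    then show ?thesis
      using D Q.prob_space sets.sets_into_space[OF D]
      by (simp add: has_bochner_integral_iff Int_absorb2 space_PiM)
  qed
  have hP: "has_bochner_integral ?P (\<lambda>y. exp (- ?L y) * ?h y) ((exp c - 1) * measure ?Q D + 1)"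
    using hint unfolding Q
    by (subst (asm) has_bochner_integral_iff)
       (auto simp: has_bochner_integral_iff integrable_density integral_density)
  have iL: "integrable ?P ?L"
    using has_bochner_integral_gauss_llr[OF pos] by (auto simp: has_bochner_integral_iff)
  have iD: "integrable ?P (indicator D :: _ \<Rightarrow> real)"
    using D by (simp add: P.emeasure_eq_measure)
  have "(\<integral>y. c * indicator D y - ?L y \<partial>?P) \<le> (\<integral>y. exp (- ?L y) * ?h y - 1 \<partial>?P)"
  proof (rule integral_mono)
    show "integrable ?P (\<lambda>y. c * indicator D y - ?L y)"
      using iL iD by (auto intro!: Bochner_Integration.integrable_diff)
    show "integrable ?P (\<lambda>y. exp (- ?L y) * ?h y - 1)"
      using hP by (auto simp: has_bochner_integral_iff intro!: Bochner_Integration.integrable_diff)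
    fix y
    have "c * indicator D y - ?L y \<le> exp (c * indicator D y - ?L y) - 1"
      using exp_ge_add_one_self[of "c * indicator D y - ?L y"] by linarith
    also have "exp (c * indicator D y - ?L y) = exp (- ?L y) * ?h y"
      by (auto simp: indicator_def mult_exp_exp split: if_splits)
    finally show "c * indicator D y - ?L y \<le> exp (- ?L y) * ?h y - 1" .
  qed
  also have "(\<integral>y. exp (- ?L y) * ?h y - 1 \<partial>?P) = (exp c - 1) * measure ?Q D"
    using hP by (subst Bochner_Integration.integral_diff)
       (auto simp: has_bochner_integral_iff P.prob_space[simplified])
  also have "(\<integral>y. c * indicator D y - ?L y \<partial>?P) = c * measure ?P D - (\<integral>y. ?L y \<partial>?P)"
    using iL iD D sets.sets_into_space[OF D]
    by (subst Bochner_Integration.integral_diff) (auto simp: Int_absorb2 space_PiM)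
  also have "(\<integral>y. ?L y \<partial>?P) = (\<Sum>j<n. ln (\<tau> / \<sigma>) + (\<sigma>\<^sup>2 + (x j - m j)\<^sup>2) / (2 * \<tau>\<^sup>2) - 1 / 2)"
    using has_bochner_integral_gauss_llr[OF pos] by (auto simp: has_bochner_integral_iff)
  finally have "c * measure ?P D \<le> exp c * measure ?Q D - measure ?Q D
      + (\<Sum>j<n. ln (\<tau> / \<sigma>) + (\<sigma>\<^sup>2 + (x j - m j)\<^sup>2) / (2 * \<tau>\<^sup>2) - 1 / 2)"
    by (simp add: left_diff_distrib)
  moreover have "0 \<le> measure ?Q D" by simp
  ultimately show ?thesis by linarith
qed

section \<open>Message tuples and error probability\<close>

definition tuple_prob :: "(nat \<Rightarrow> real) \<Rightarrow> nat \<Rightarrow> (nat \<Rightarrow> nat) \<Rightarrow> real" where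
  "tuple_prob q l W = (\<Prod>i<l. q (W i))"

lemma tuple_prob_nonneg [simp]: "0 \<le> tuple_prob (pmf (message_pmf \<alpha> M)) l W"
  by (simp add: tuple_prob_def prod_nonneg)

abbreviation tuples :: "nat \<Rightarrow> nat \<Rightarrow> (nat \<Rightarrow> nat) set" where
  "tuples l M \<equiv> {..<l} \<rightarrow>\<^sub>E {0..M}"

definition active :: "nat \<Rightarrow> (nat \<Rightarrow> nat) \<Rightarrow> nat set" where
  "active l W = {i. i < l \<and> W i \<noteq> 0}"

definition signal :: "nat \<Rightarrow> (nat \<Rightarrow> nat \<Rightarrow> nat \<Rightarrow> real) \<Rightarrow> (nat \<Rightarrow> nat) \<Rightarrow> nat \<Rightarrow> real" where
  "signal l f W j = (\<Sum>i<l. f i (W i) j)"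

lemma finite_active [simp]: "finite (active l W)"
  by (simp add: active_def)

lemma finite_tuples: "finite (tuples l M)"
  by (simp add: finite_PiE)

section \<open>Moments of independent messages and the number of active users\<close>

lemma sum_pmf_message:
  assumes "0 \<le> \<alpha>" "\<alpha> \<le> 1" "M \<ge> 1"
  shows "(\<Sum>w\<in>{0..M}. pmf (message_pmf \<alpha> M) w) = 1"
proof -
  have "(\<Sum>w\<in>{0..M}. pmf (message_pmf \<alpha> M) w) = (1 - \<alpha>) + (\<Sum>w\<in>{0<..M}. \<alpha> / real M)"
    using assms by (subst sum.head) (auto simp: pmf_message_pmf intro!: sum.cong)
  also have "\<dots> = 1"
    using assms by simp
  finally show ?thesis .
qed

text \<open>This interchange is independence of the users. Taking \<open>h\<close> equal to 1 except
  at one or two users yields the moment identities that follow.\<close>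

lemma sum_tuple_prob_prod:
  "(\<Sum>W\<in>tuples l M. tuple_prob q l W * (\<Prod>i<l. h i (W i))) = (\<Prod>i<l. \<Sum>w\<in>{0..M}. q w * h i w)"
  by (subst prod_sum_PiE) (auto simp: tuple_prob_def prod.distrib)

context
  fixes q :: "nat \<Rightarrow> real" and M :: nat
  assumes q_sum: "(\<Sum>w\<in>{0..M}. q w) = 1"
begin

lemma sum_tuple_prob: "(\<Sum>W\<in>tuples l M. tuple_prob q l W) = 1"
  using sum_tuple_prob_prod[where q=q and l=l and M=M and h="\<lambda>_ _. 1"] q_sum by simp

lemma sum_tuple_prob_pair:
  assumes "i < l" "j < l" "i \<noteq> j"
  shows "(\<Sum>W\<in>tuples l M. tuple_prob q l W * (g (W i) * h (W j))) =
    (\<Sum>w\<in>{0..M}. q w * g w) * (\<Sum>w\<in>{0..M}. q w * h w)"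
proof -
  let ?k = "\<lambda>a w. if a = i then g w else if a = j then h w else 1"
  have 1: "(\<Prod>a<l. ?k a (W a)) = g (W i) * h (W j)" for W
  proof -
    have "(\<Prod>a<l. ?k a (W a)) = (\<Prod>a\<in>{i, j}. ?k a (W a))"
      using assms by (intro prod.mono_neutral_right) auto
    then show ?thesis using assms by simp
  qed
  have "(\<Prod>a<l. \<Sum>w\<in>{0..M}. q w * ?k a w) = (\<Prod>a\<in>{i, j}. \<Sum>w\<in>{0..M}. q w * ?k a w)"
    using assms q_sum by (intro prod.mono_neutral_right) auto
  also have "\<dots> = (\<Sum>w\<in>{0..M}. q w * g w) * (\<Sum>w\<in>{0..M}. q w * h w)"
    using assms by simp
  finally show ?thesis
    using sum_tuple_prob_prod[where q=q and l=l and M=M and h="?k"] by (simp only: 1)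
qed

lemma sum_tuple_prob_single:
  assumes "i < l"
  shows "(\<Sum>W\<in>tuples l M. tuple_prob q l W * h (W i)) = (\<Sum>w\<in>{0..M}. q w * h w)"
proof -
  let ?k = "\<lambda>a w. if a = i then h w else 1"
  have 1: "(\<Prod>a<l. ?k a (W a)) = h (W i)" for W
    using assms by (subst prod.delta) auto
  have "(\<Prod>a<l. \<Sum>w\<in>{0..M}. q w * ?k a w) = (\<Prod>a\<in>{i}. \<Sum>w\<in>{0..M}. q w * ?k a w)"
    using assms q_sum by (intro prod.mono_neutral_right) auto
  then show ?thesis
    using sum_tuple_prob_prod[where q=q and l=l and M=M and h="?k"] by (simp add: 1)
qed

lemma sum_tuple_prob_square_centered:
  assumes "\<And>i. i < l \<Longrightarrow> (\<Sum>w\<in>{0..M}. q w * G i w) = 0"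
  shows "(\<Sum>W\<in>tuples l M. tuple_prob q l W * (\<Sum>i<l. G i (W i))\<^sup>2) =
    (\<Sum>i<l. \<Sum>w\<in>{0..M}. q w * (G i w)\<^sup>2)"
proof -
  have "(\<Sum>W\<in>tuples l M. tuple_prob q l W * (\<Sum>i<l. G i (W i))\<^sup>2) =
     (\<Sum>W\<in>tuples l M. \<Sum>i<l. \<Sum>j<l. tuple_prob q l W * (G i (W i) * G j (W j)))"
    by (simp only: power2_eq_square sum_product) (simp add: sum_distrib_left)
  also have "\<dots> = (\<Sum>i<l. \<Sum>j<l. \<Sum>W\<in>tuples l M. tuple_prob q l W * (G i (W i) * G j (W j)))"
    by (subst sum.swap, intro sum.cong refl, rule sum.swap)
  also have "\<dots> = (\<Sum>i<l. \<Sum>j<l. if i = j then \<Sum>w\<in>{0..M}. q w * (G i w)\<^sup>2 else 0)"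
  proof (intro sum.cong refl)
    fix i j assume ij: "i \<in> {..<l}" "j \<in> {..<l}"
    show "(\<Sum>W\<in>tuples l M. tuple_prob q l W * (G i (W i) * G j (W j))) =
      (if i = j then \<Sum>w\<in>{0..M}. q w * (G i w)\<^sup>2 else 0)"
    proof (cases "i = j")
      case True
      then show ?thesis
        using ij sum_tuple_prob_single[of i l "\<lambda>w. (G i w)\<^sup>2"] by (simp add: power2_eq_square)
    next
      case False
      then show ?thesis
        using ij sum_tuple_prob_pair[of i l j "G i" "G j"] assms by simp
    qed
  qed
  also have "\<dots> = (\<Sum>i<l. \<Sum>w\<in>{0..M}. q w * (G i w)\<^sup>2)"
    by simp
  finally show ?thesis .
qed

text \<open>Applied to the number of active users and to each coordinate of the transmitted
  signal.\<close>

lemma sum_tuple_prob_variance: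
  "(\<Sum>W\<in>tuples l M. tuple_prob q l W * ((\<Sum>i<l. F i (W i)) - (\<Sum>i<l. \<Sum>w\<in>{0..M}. q w * F i w))\<^sup>2) =
    (\<Sum>i<l. (\<Sum>w\<in>{0..M}. q w * (F i w)\<^sup>2) - (\<Sum>w\<in>{0..M}. q w * F i w)\<^sup>2)"
proof -
  define \<mu> where "\<mu> i = (\<Sum>w\<in>{0..M}. q w * F i w)" for i
  have c: "(\<Sum>w\<in>{0..M}. q w * (F i w - \<mu> i)) = 0" for i
    using q_sum by (simp add: right_diff_distrib sum_subtractf \<mu>_def flip: sum_distrib_right)
  have v: "(\<Sum>w\<in>{0..M}. q w * (F i w - \<mu> i)\<^sup>2) = (\<Sum>w\<in>{0..M}. q w * (F i w)\<^sup>2) - (\<mu> i)\<^sup>2" for i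
  proof -
    have "(\<Sum>w\<in>{0..M}. q w * (F i w - \<mu> i)\<^sup>2) =
       (\<Sum>w\<in>{0..M}. q w * (F i w)\<^sup>2 - 2 * \<mu> i * (q w * F i w) + (\<mu> i)\<^sup>2 * q w)"
      by (intro sum.cong refl) (simp add: power2_eq_square algebra_simps)
    also have "\<dots> = (\<Sum>w\<in>{0..M}. q w * (F i w)\<^sup>2) - 2 * \<mu> i * \<mu> i + (\<mu> i)\<^sup>2 * 1"
      by (simp only: sum.distrib sum_subtractf flip: sum_distrib_left q_sum \<mu>_def)
    finally show ?thesis by (simp add: power2_eq_square)
  qed
  show ?thesis
    using sum_tuple_prob_square_centered[of l "\<lambda>i w. F i w - \<mu> i"]
    by (simp add: c v flip: \<mu>_def) (simp add: sum_subtractf)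
qed

end

lemma card_active_eq_sum: "real (card (active l W)) = (\<Sum>i<l. of_bool (W i \<noteq> 0))"
proof -
  have "active l W = {i\<in>{..<l}. W i \<noteq> 0}" by (auto simp: active_def)
  then show ?thesis by (simp add: of_bool_def sum.If_cases Int_def)
qed

context
  fixes \<alpha> :: real and M :: nat and q :: "nat \<Rightarrow> real"
  assumes \<alpha>: "0 \<le> \<alpha>" "\<alpha> \<le> 1" and M: "M \<ge> 1"
  defines "q \<equiv> pmf (message_pmf \<alpha> M)"
begin

text \<open>Only the number of active users matters, so moving or altering a message of an active
  user leaves the probability unchanged.\<close>

lemma tuple_prob_eq:
  assumes "W \<in> tuples l M"
  shows "tuple_prob q l W = (1 - \<alpha>) ^ (l - card (active l W)) * (\<alpha> / real M) ^ card (active l W)"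
proof -
  have "tuple_prob q l W = (\<Prod>i<l. if W i = 0 then 1 - \<alpha> else \<alpha> / real M)"
    using assms \<alpha> M by (auto simp: tuple_prob_def q_def pmf_message_pmf PiE_iff intro!: prod.cong)
  also have "\<dots> = (\<Prod>i\<in>{..<l} \<inter> {i. W i = 0}. 1 - \<alpha>) * (\<Prod>i\<in>{..<l} \<inter> - {i. W i = 0}. \<alpha> / real M)"
    by (rule prod.If_cases) simp
  also have "{..<l} \<inter> - {i. W i = 0} = active l W"
    by (auto simp: active_def)
  also have "{..<l} \<inter> {i. W i = 0} = {..<l} - active l W"
    by (auto simp: active_def)
  finally show ?thesis
    by (simp add: card_Diff_subset active_def subset_iff)
qed

text \<open>Each active user contributes at most a factor \<open>1 / M\<close>; the activity
  probabilities are bounded by 1. The bound is to cancel the factor \<open>exp c\<close> in the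
  sum-rate bound.\<close>

lemma tuple_prob_le:
  assumes "W \<in> tuples l M" "real (card (active l W)) \<ge> a"
  shows "tuple_prob q l W \<le> exp (- (a * ln (real M)))"
proof -
  have "tuple_prob q l W \<le> 1 * (1 / real M) ^ card (active l W)"
    unfolding tuple_prob_eq[OF assms(1)]
    using \<alpha> M by (intro mult_mono power_le_one power_mono divide_right_mono) auto
  also have "\<dots> = exp (- (real (card (active l W)) * ln (real M)))"
    using M by (simp add: exp_minus power_one_over exp_of_nat_mult inverse_eq_divide)
  also have "\<dots> \<le> exp (- (a * ln (real M)))"
    using assms(2) M by (simp add: mult_right_mono)
  finally show ?thesis .
qed

lemma sum_q: "(\<Sum>w\<in>{0..M}. q w) = 1"
  unfolding q_def by (rule sum_pmf_message[OF \<alpha> M])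

lemma sum_q_nonzero: "(\<Sum>w\<in>{0..M}. q w * of_bool (w \<noteq> 0)) = \<alpha>"
proof -
  have "(\<Sum>w\<in>{0..M}. q w * of_bool (w \<noteq> 0)) = (\<Sum>w\<in>{0<..M}. \<alpha> / real M)"
    using \<alpha> M by (subst sum.head) (auto simp: pmf_message_pmf q_def intro!: sum.cong)
  also have "\<dots> = \<alpha>"
    using M by simp
  finally show ?thesis .
qed

lemma expected_active:
  "(\<Sum>W\<in>tuples l M. tuple_prob q l W * real (card (active l W))) = \<alpha> * real l"
proof -
  have "(\<Sum>W\<in>tuples l M. tuple_prob q l W * real (card (active l W))) =
     (\<Sum>i<l. \<Sum>W\<in>tuples l M. tuple_prob q l W * of_bool (W i \<noteq> 0))"
    by (simp only: card_active_eq_sum sum_distrib_left) (rule sum.swap)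
  also have "\<dots> = (\<Sum>i<l. \<alpha>)"
    using sum_tuple_prob_single[OF sum_q, of _ l "\<lambda>w. of_bool (w \<noteq> 0)"] sum_q_nonzero
    by (intro sum.cong refl) simp
  finally show ?thesis by simp
qed

text \<open>Cantelli's inequality rather than Chebyshev's, so that the bound stays
  nontrivial when the mean number of active users is small.\<close>

lemma prob_many_active:
  fixes l :: nat
  defines "k \<equiv> \<alpha> * real l"
  shows "(\<Sum>W | W \<in> tuples l M \<and> real (card (active l W)) \<ge> k / 2. tuple_prob q l W) \<ge> k / (k + 4)"
proof -
  let ?T = "tuples l M" and ?p = "tuple_prob q l" and ?A = "\<lambda>W. real (card (active l W))"
  define G where "G = {W. W \<in> ?T \<and> ?A W \<ge> k / 2}"
  have GT: "G \<subseteq> ?T" by (auto simp: G_def)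
  have k: "k \<ge> 0" using \<alpha> by (simp add: k_def)
  have mean: "(\<Sum>i<l. \<Sum>w\<in>{0..M}. q w * of_bool (w \<noteq> 0)) = k"
    unfolding sum_q_nonzero by (simp add: k_def)
  have sq: "(of_bool b :: real)\<^sup>2 = of_bool b" for b by simp
  have "(\<Sum>W\<in>?T. ?p W * (?A W - k)\<^sup>2) = (\<Sum>i<l. (\<Sum>w\<in>{0..M}. q w * (of_bool (w \<noteq> 0))\<^sup>2) - \<alpha>\<^sup>2)"
    using sum_tuple_prob_variance[OF sum_q, of l "\<lambda>_ w. of_bool (w \<noteq> 0)"]
    unfolding mean card_active_eq_sum by (simp only: sum_q_nonzero)
  also have "\<dots> = (\<Sum>i<l. \<alpha> - \<alpha>\<^sup>2)"
    by (simp only: sq sum_q_nonzero)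
  also have "\<dots> \<le> k"
    by (simp add: k_def algebra_simps)
  finally have var: "(\<Sum>W\<in>?T. ?p W * (?A W - k)\<^sup>2) \<le> k" .
  \<comment> \<open>Cantelli's optimal shift is the variance bound over the deviation, here
    \<open>k / (k / 2) = 2\<close>.\<close>
  have "(\<Sum>W\<in>?T. ?p W * (?A W - k - 2)\<^sup>2) =
      (\<Sum>W\<in>?T. ?p W * (?A W - k)\<^sup>2 - 4 * (?p W * ?A W) + (4 * k + 4) * ?p W)"
    by (intro sum.cong refl) (simp add: power2_eq_square algebra_simps)
  also have "\<dots> = (\<Sum>W\<in>?T. ?p W * (?A W - k)\<^sup>2) - 4 * k + (4 * k + 4) * 1"
    by (simp only: sum.distrib sum_subtractf expected_active k_def sum_tuple_prob[OF sum_q] flip: sum_distrib_left)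
  also have "\<dots> \<le> k + 4" using var by simp
  finally have m2: "(\<Sum>W\<in>?T. ?p W * (?A W - k - 2)\<^sup>2) \<le> k + 4" .
  have pw: "((k + 4) / 2)\<^sup>2 * ?p W \<le> ?p W * (?A W - k - 2)\<^sup>2" if "W \<in> ?T - G" for W
  proof -
    have "?A W < k / 2" using that by (simp add: G_def not_le)
    then have "((k + 4) / 2)\<^sup>2 \<le> (k + 2 - ?A W)\<^sup>2"
      using k by (intro power_mono) simp_all
    also have "\<dots> = (?A W - k - 2)\<^sup>2" by (simp add: power2_eq_square algebra_simps)
    finally have "((k + 4) / 2)\<^sup>2 \<le> (?A W - k - 2)\<^sup>2" .
    then have "((k + 4) / 2)\<^sup>2 * ?p W \<le> (?A W - k - 2)\<^sup>2 * ?p W"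
      by (rule mult_right_mono) (simp add: q_def)
    then show ?thesis by (simp only: mult.commute[of "?p W"])
  qed
  have "((k + 4) / 2)\<^sup>2 * (\<Sum>W\<in>?T - G. ?p W) = (\<Sum>W\<in>?T - G. ((k + 4) / 2)\<^sup>2 * ?p W)"
    by (rule sum_distrib_left)
  also have "\<dots> \<le> (\<Sum>W\<in>?T - G. ?p W * (?A W - k - 2)\<^sup>2)"
    by (rule sum_mono) (rule pw)
  also have "\<dots> \<le> (\<Sum>W\<in>?T. ?p W * (?A W - k - 2)\<^sup>2)"
    by (intro sum_mono2 finite_tuples) (auto simp: q_def)
  also note m2
  finally have "((k + 4) / 2)\<^sup>2 * (\<Sum>W\<in>?T - G. ?p W) \<le> k + 4" .
  then have "(k + 4) * ((k + 4) * (\<Sum>W\<in>?T - G. ?p W)) \<le> (k + 4) * 4"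
    by (simp add: power2_eq_square)
  then have "(k + 4) * (\<Sum>W\<in>?T - G. ?p W) \<le> 4"
    using k by (subst (asm) mult_le_cancel_left_pos) simp_all
  then have "(\<Sum>W\<in>?T - G. ?p W) \<le> 4 / (k + 4)"
    using k by (simp add: pos_le_divide_eq mult.commute)
  moreover have "(\<Sum>W\<in>?T - G. ?p W) = 1 - (\<Sum>W\<in>G. ?p W)"
    using sum.subset_diff[OF GT, of ?p] sum_tuple_prob[OF sum_q, of l] finite_tuples[of l M] by simp
  ultimately have "(\<Sum>W\<in>G. ?p W) \<ge> 1 - 4 / (k + 4)" by linarith
  also have "1 - 4 / (k + 4) = k / (k + 4)"
    using k by (simp add: field_simps)
  finally show ?thesis unfolding G_def .
qed

end


section \<open>Decoding regions and the error probability as a finite sum\<close>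

lemma received_eq: "received l n f W Z = (\<lambda>j\<in>{..<n}. signal l f W j + Z j)"
  by (simp add: received_def signal_def)

definition decoding_region :: "nat \<Rightarrow> ((nat \<Rightarrow> real) \<Rightarrow> 'a) \<Rightarrow> 'a \<Rightarrow> (nat \<Rightarrow> real) set" where
  "decoding_region n g W = {y \<in> {..<n} \<rightarrow>\<^sub>E (UNIV :: real set). g y = W}"

lemma decoding_region_sets:
  assumes "g \<in> (\<Pi>\<^sub>M j\<in>{..<n}. borel) \<rightarrow>\<^sub>M count_space T" "W \<in> T"
  shows "decoding_region n g W \<in> sets (\<Pi>\<^sub>M j\<in>{..<n}. borel)"
proof -
  have "decoding_region n g W = g -` {W} \<inter> space (\<Pi>\<^sub>M j\<in>{..<n}. borel)"
    by (auto simp: decoding_region_def space_PiM)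
  then show ?thesis using measurable_sets[OF assms(1), of "{W}"] assms(2) by simp
qed

lemma measure_noise_received:
  assumes "N0 > 0" and [measurable]: "D \<in> sets (\<Pi>\<^sub>M j\<in>{..<n}. borel)"
  shows "measure (noise_measure N0 n) {Z \<in> {..<n} \<rightarrow>\<^sub>E UNIV. received l n f W Z \<in> D} =
    measure (gauss n (sqrt (N0 / 2)) (signal l f W)) D"
proof -
  have [measurable]: "(\<lambda>Z. \<lambda>j\<in>{..<n}. signal l f W j + Z j) \<in> gauss n (sqrt (N0 / 2)) (\<lambda>_. 0) \<rightarrow>\<^sub>M (\<Pi>\<^sub>M j\<in>{..<n}. borel)"
    by measurable
  have "measure (gauss n (sqrt (N0 / 2)) (signal l f W)) D =
    measure (gauss n (sqrt (N0 / 2)) (\<lambda>_. 0)) ((\<lambda>Z. \<lambda>j\<in>{..<n}. signal l f W j + Z j) -` D \<inter> space (gauss n (sqrt (N0 / 2)) (\<lambda>_. 0)))"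
    using assms by (subst distr_gauss_translate[symmetric], simp, intro measure_distr) auto
  also have "(\<lambda>Z. \<lambda>j\<in>{..<n}. signal l f W j + Z j) -` D \<inter> space (gauss n (sqrt (N0 / 2)) (\<lambda>_. 0)) =
     {Z \<in> {..<n} \<rightarrow>\<^sub>E UNIV. received l n f W Z \<in> D}"
    by (auto simp: received_eq)
  finally show ?thesis by (simp add: noise_measure_eq_gauss)
qed

text \<open>Only finitely many tuples carry mass, and given the tuple the output is a translated
  Gaussian. From here on the joint channel measure is replaced by Gaussian measures of decoding
  regions.\<close>

lemma error_prob_eq:
  assumes N0: "N0 > 0" and \<alpha>: "0 \<le> \<alpha>" "\<alpha> \<le> 1" and M: "M \<ge> 1"
    and g: "g \<in> (\<Pi>\<^sub>M j\<in>{..<n}. borel) \<rightarrow>\<^sub>M count_space (tuples l M)"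
  shows "error_prob N0 \<alpha> l n M f g = 1 - (\<Sum>W\<in>tuples l M. tuple_prob (pmf (message_pmf \<alpha> M)) l W *
    measure (gauss n (sqrt (N0 / 2)) (signal l f W)) (decoding_region n g W))"
proof -
  let ?PW = "\<Pi>\<^sub>M i\<in>{..<l}. measure_pmf (message_pmf \<alpha> M)" and ?PZ = "noise_measure N0 n"
  let ?C = "channel_measure N0 \<alpha> l n M"
  have \<sigma>: "sqrt (N0 / 2) > 0" using N0 by simp
  interpret PW: product_prob_space "\<lambda>_. measure_pmf (message_pmf \<alpha> M)" "{..<l}"
    by (intro product_prob_spaceI measure_pmf.prob_space_axioms)
  interpret PZ: prob_space ?PZ
    unfolding noise_measure_eq_gauss by (rule prob_space_gauss[OF \<sigma>])
  interpret C: pair_prob_space ?PW ?PZ ..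
  have Cp: "?C = ?PW \<Otimes>\<^sub>M ?PZ" by (simp add: channel_measure_def)
  have spZ: "space ?PZ = {..<n} \<rightarrow>\<^sub>E UNIV" by (simp add: noise_measure_eq_gauss)
  define B where "B W = {Z \<in> {..<n} \<rightarrow>\<^sub>E (UNIV :: real set). received l n f W Z \<in> decoding_region n g W}" for W
  have sB: "B W \<in> sets ?PZ" if "W \<in> tuples l M" for W
  proof -
    have [measurable]: "decoding_region n g W \<in> sets (\<Pi>\<^sub>M j\<in>{..<n}. borel)"
      by (rule decoding_region_sets[OF g that])
    have "(\<lambda>Z. received l n f W Z) \<in> ?PZ \<rightarrow>\<^sub>M (\<Pi>\<^sub>M j\<in>{..<n}. borel)"
      unfolding received_eq noise_measure_eq_gauss by measurable
    from measurable_sets[OF this, of "decoding_region n g W"] show ?thesis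
      by (simp add: B_def spZ vimage_def Int_def conj_commute)
  qed
  have sW: "{W} \<in> sets ?PW" and mW: "measure ?PW {W} = tuple_prob (pmf (message_pmf \<alpha> M)) l W"
    if "W \<in> tuples l M" for W
  proof -
    have eq: "{W} = Pi\<^sub>E {..<l} (\<lambda>i. {W i})"
      using that by (auto simp: PiE_singleton PiE_iff)
    show "{W} \<in> sets ?PW" unfolding eq by (intro sets_PiM_I_finite) auto
    show "measure ?PW {W} = tuple_prob (pmf (message_pmf \<alpha> M)) l W"
      unfolding eq measure_def
      by (subst PW.emeasure_PiM) (auto simp: tuple_prob_def emeasure_pmf_single prod_ennreal prod_nonneg)
  qed
  define S where "S = (\<Union>W\<in>tuples l M. {W} \<times> B W)"
  have sS: "S \<in> sets ?C"
    unfolding S_def Cp using finite_tuples[of l M] sB sW by (intro sets.finite_UN) auto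
  have gT: "g y \<in> tuples l M" if "y \<in> {..<n} \<rightarrow>\<^sub>E UNIV" for y
    using measurable_space[OF g, of y] that by (simp add: space_PiM)
  have rec: "received l n f W Z \<in> {..<n} \<rightarrow>\<^sub>E UNIV" for W Z
    by (simp add: received_eq)
  have "(W, Z) \<in> S \<longleftrightarrow> g (received l n f W Z) = W" if "(W, Z) \<in> space ?C" for W Z
    using that gT[OF rec, of W Z] rec[of W Z] unfolding S_def B_def decoding_region_def Cp space_pair_measure spZ
    by auto
  then have "{(W, Z) \<in> space ?C. g (received l n f W Z) \<noteq> W} = space ?C - S"
    by blast
  then have "error_prob N0 \<alpha> l n M f g = 1 - measure ?C S"
    unfolding error_prob_def using C.prob_compl[of S] sS by (simp only: Cp)
  also have "measure ?C S = (\<Sum>W\<in>tuples l M. measure ?C ({W} \<times> B W))"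
    unfolding S_def Cp using sB sW
    by (intro C.finite_measure_finite_Union finite_tuples) (auto simp: disjoint_family_on_def)
  also have "\<dots> = (\<Sum>W\<in>tuples l M. tuple_prob (pmf (message_pmf \<alpha> M)) l W *
    measure (gauss n (sqrt (N0 / 2)) (signal l f W)) (decoding_region n g W))"
  proof (intro sum.cong refl)
    fix W assume W: "W \<in> tuples l M"
    have "measure ?C ({W} \<times> B W) = measure ?PW {W} * measure ?PZ (B W)"
      unfolding Cp measure_def using sB[OF W] sW[OF W]
      by (simp add: PZ.emeasure_pair_measure_Times enn2real_mult)
    also have "measure ?PZ (B W) = measure (gauss n (sqrt (N0 / 2)) (signal l f W)) (decoding_region n g W)"
      unfolding B_def by (rule measure_noise_received[OF N0 decoding_region_sets[OF g W]])
    finally show "measure ?C ({W} \<times> B W) = tuple_prob (pmf (message_pmf \<alpha> M)) l W *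
      measure (gauss n (sqrt (N0 / 2)) (signal l f W)) (decoding_region n g W)"
      by (simp add: mW[OF W])
  qed
  finally show ?thesis .
qed

section \<open>Converse bounds for a fixed code\<close>

lemma signal_upd:
  assumes "i < l"
  shows "signal l f (W(i := a)) j = signal l f W j - f i (W i) j + f i a j"
proof -
  have "signal l f (W(i := a)) j = f i a j + (\<Sum>k\<in>{..<l} - {i}. f k (W k) j)"
    unfolding signal_def using assms by (subst sum.remove[of _ i]) auto
  moreover have "signal l f W j = f i (W i) j + (\<Sum>k\<in>{..<l} - {i}. f k (W k) j)"
    unfolding signal_def using assms by (subst sum.remove[of _ i]) auto
  ultimately show ?thesis by simp
qed

lemma active_upd_nonzero:
  assumes "i < l" "a \<noteq> 0"
  shows "active l (W(i := a)) = insert i (active l W)"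
  using assms by (auto simp: active_def)

lemma active_upd_zero: "active l (W(i := 0)) = active l W - {i}"
  by (auto simp: active_def)

lemma disjoint_decoding_region: "V \<noteq> W \<Longrightarrow> decoding_region n g V \<inter> decoding_region n g W = {}"
  by (auto simp: decoding_region_def)

locale gaussian_code =
  fixes N0 \<alpha> :: real and l n M :: nat and E \<epsilon> :: real
    and f :: "nat \<Rightarrow> nat \<Rightarrow> nat \<Rightarrow> real" and g :: "(nat \<Rightarrow> real) \<Rightarrow> nat \<Rightarrow> nat"
  assumes N0: "N0 > 0" and \<alpha>: "0 \<le> \<alpha>" "\<alpha> \<le> 1" and code: "is_code N0 \<alpha> l n M E \<epsilon> f g"
begin

abbreviation "\<sigma> \<equiv> sqrt (N0 / 2)"
abbreviation "q \<equiv> pmf (message_pmf \<alpha> M)"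
abbreviation "p \<equiv> tuple_prob q l"
abbreviation "T \<equiv> tuples l M"

text \<open>Transition matrix of channel and decoder: the first argument is sent, the second is
  decoded.\<close>

definition C :: "(nat \<Rightarrow> nat) \<Rightarrow> (nat \<Rightarrow> nat) \<Rightarrow> real" where
  "C V W = measure (gauss n \<sigma> (signal l f V)) (decoding_region n g W)"

lemma M: "M \<ge> 1" and g: "g \<in> (\<Pi>\<^sub>M j\<in>{..<n}. borel) \<rightarrow>\<^sub>M count_space T"
  and eps: "0 \<le> \<epsilon>"
  and codeword_0: "i < l \<Longrightarrow> j < n \<Longrightarrow> f i 0 j = 0"
  and energy: "i < l \<Longrightarrow> w \<le> M \<Longrightarrow> (\<Sum>j<n. (f i w j)\<^sup>2) \<le> E"
  using code by (auto simp: is_code_def)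

lemma sigma_pos: "\<sigma> > 0" using N0 by simp

lemma C_nonneg [simp]: "0 \<le> C V W"
  by (simp add: C_def)

lemma sum_C_le:
  assumes "S \<subseteq> T"
  shows "(\<Sum>W\<in>S. C V W) \<le> 1"
proof -
  interpret prob_space "gauss n \<sigma> (signal l f V)" by (rule prob_space_gauss[OF sigma_pos])
  have "finite S" using assms finite_tuples finite_subset by blast
  then have "(\<Sum>W\<in>S. C V W) = measure (gauss n \<sigma> (signal l f V)) (\<Union>W\<in>S. decoding_region n g W)"
    unfolding C_def using assms decoding_region_sets[OF g]
    by (intro finite_measure_finite_Union[symmetric])
       (auto simp: disjoint_family_on_def dest: disjoint_decoding_region[of _ _ n g])
  then show ?thesis by simp
qed

lemma C_le_1: "W \<in> T \<Longrightarrow> C V W \<le> 1"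
  using sum_C_le[of "{W}" V] by simp

text \<open>The error mass inside S cannot exceed the total error \<epsilon>, so the bound survives
  restriction to any set of tuples.\<close>

lemma sum_p_C_ge:
  assumes "S \<subseteq> T"
  shows "(\<Sum>W\<in>S. p W * C W W) \<ge> (\<Sum>W\<in>S. p W) - \<epsilon>"
proof -
  have "1 - (\<Sum>W\<in>T. p W * C W W) \<le> \<epsilon>"
    using code error_prob_eq[OF N0 \<alpha> M g, of f] by (simp add: is_code_def C_def)
  moreover have "(\<Sum>W\<in>T. p W) = 1"
    by (rule sum_tuple_prob[OF sum_pmf_message[OF \<alpha> M]])
  ultimately have "(\<Sum>W\<in>T. p W * (1 - C W W)) \<le> \<epsilon>"
    by (simp add: right_diff_distrib sum_subtractf)
  moreover have "(\<Sum>W\<in>S. p W * (1 - C W W)) \<le> (\<Sum>W\<in>T. p W * (1 - C W W))"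
    using assms C_le_1 by (intro sum_mono2 finite_tuples mult_nonneg_nonneg) (auto simp: tuple_prob_nonneg)
  ultimately show ?thesis
    by (simp add: right_diff_distrib sum_subtractf)
qed

text \<open>For equal variances the divergence is the squared distance of the means over
  \<open>2 * \<sigma>\<^sup>2 = N0\<close>.\<close>

lemma C_shift:
  assumes "W \<in> T"
  shows "c * C W W \<le> exp c * C V W + (\<Sum>j<n. (signal l f W j - signal l f V j)\<^sup>2) / N0"
proof -
  have "(\<Sum>j<n. ln (\<sigma> / \<sigma>) + (\<sigma>\<^sup>2 + (signal l f W j - signal l f V j)\<^sup>2) / (2 * \<sigma>\<^sup>2) - 1 / 2) =
    (\<Sum>j<n. (signal l f W j - signal l f V j)\<^sup>2) / N0"
    using N0 by (simp add: sum_divide_distrib add_divide_distrib)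
  then show ?thesis
    using gauss_divergence_bound[OF sigma_pos sigma_pos decoding_region_sets[OF g assms], of c "signal l f W" "signal l f V"]
    by (simp add: C_def)
qed

section \<open>Equally likely alternatives and a lower bound on the energy\<close>

lemma p_eq_if_card_active_eq:
  "V \<in> T \<Longrightarrow> W \<in> T \<Longrightarrow> card (active l V) = card (active l W) \<Longrightarrow> p V = p W"
  using tuple_prob_eq[OF \<alpha> M] by simp

lemma energy_diff:
  assumes "i < l" "w \<le> M" "i' < l" "w' \<le> M"
  shows "(\<Sum>j<n. (f i w j - f i' w' j)\<^sup>2) \<le> 4 * E"
proof -
  have "(\<Sum>j<n. (f i w j - f i' w' j)\<^sup>2) \<le> (\<Sum>j<n. 2 * (f i w j)\<^sup>2 + 2 * (f i' w' j)\<^sup>2)"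
  proof (rule sum_mono)
    fix j
    show "(f i w j - f i' w' j)\<^sup>2 \<le> 2 * (f i w j)\<^sup>2 + 2 * (f i' w' j)\<^sup>2"
      using zero_le_power2[of "f i w j + f i' w' j"] by (simp add: power2_eq_square algebra_simps)
  qed
  also have "\<dots> = 2 * (\<Sum>j<n. (f i w j)\<^sup>2) + 2 * (\<Sum>j<n. (f i' w' j)\<^sup>2)"
    by (simp add: sum.distrib sum_distrib_left)
  also have "\<dots> \<le> 4 * E"
    using energy[of i w] energy[of i' w'] assms by simp
  finally show ?thesis .
qed

lemma signal_deactivate:
  assumes "i < l" "j < n"
  shows "signal l f (W(i := 0)) j = signal l f W j - f i (W i) j"
  using assms codeword_0 by (simp add: signal_upd)

text \<open>One alternative for each user \<open>j\<close>, exactly as likely as \<open>W\<close> itself.\<close>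

definition neighbour :: "(nat \<Rightarrow> nat) \<Rightarrow> nat \<Rightarrow> nat \<Rightarrow> nat" where
  "neighbour W j = (if W j \<noteq> 0 then W(j := if W j = 1 then 2 else 1) else W(Min (active l W) := 0, j := 1))"

context
  fixes W
  assumes W: "W \<in> T" and nonempty: "active l W \<noteq> {}" and M2: "M \<ge> 2"
begin

lemma Min_active: "Min (active l W) < l" "W (Min (active l W)) \<noteq> 0" "W (Min (active l W)) \<le> M"
  using Min_in[OF finite_active nonempty] W by (auto simp: active_def PiE_iff)

lemma neighbour_in: "j < l \<Longrightarrow> neighbour W j \<in> T"
  using W M2 Min_active by (auto simp: neighbour_def PiE_iff extensional_def)

lemma neighbour_neq: "neighbour W j \<noteq> W"
proof -
  have "neighbour W j j \<noteq> W j" by (simp add: neighbour_def)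
  then show ?thesis by metis
qed

lemma p_neighbour: 
  assumes "j < l"
  shows "p (neighbour W j) = p W"
proof (rule p_eq_if_card_active_eq[OF neighbour_in[OF assms] W])
  let ?i = "Min (active l W)"
  have i: "?i \<in> active l W" by (rule Min_in[OF finite_active nonempty])
  show "card (active l (neighbour W j)) = card (active l W)"
  proof (cases "W j = 0")
    case False
    then have "j \<in> active l W" using assms by (simp add: active_def)
    then show ?thesis using False assms by (auto simp: neighbour_def active_upd_nonzero insert_absorb)
  next
    case True
    then have "j \<notin> active l W" "?i \<noteq> j" using i by (auto simp: active_def)
    then show ?thesis
      using True assms i card_Suc_Diff1[OF finite_active i] by (simp add: neighbour_def active_upd_nonzero active_upd_zero)
  qed
qed

text \<open>The neighbour for j differs from \<open>W\<close> at j, and elsewhere only at the first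
  active user. If two distinct indices gave the same tuple, each of them would have to be the first
  active user.\<close>

lemma inj_neighbour: "inj_on (neighbour W) {..<l}"
proof (rule inj_onI)
  fix i j assume "i \<in> {..<l}" "j \<in> {..<l}" and eq: "neighbour W i = neighbour W j"
  have "neighbour W i i \<noteq> W i" for i by (simp add: neighbour_def)
  moreover have "neighbour W i k \<noteq> W k \<Longrightarrow> k = i \<or> (W i = 0 \<and> k = Min (active l W))" for i k
    by (auto simp: neighbour_def split: if_splits)
  moreover note Min_active(2) eq
  ultimately show "i = j" by metis
qed

lemma distance_neighbour:
  assumes "j < l"
  shows "(\<Sum>k<n. (signal l f W k - signal l f (neighbour W j) k)\<^sup>2) \<le> 4 * E"
proof (cases "W j = 0")
  case False
  let ?w = "if W j = 1 then 2 else 1 :: nat"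
  have "(\<Sum>k<n. (signal l f W k - signal l f (neighbour W j) k)\<^sup>2) = (\<Sum>k<n. (f j (W j) k - f j ?w k)\<^sup>2)"
    using assms False by (simp add: neighbour_def signal_upd)
  also have "\<dots> \<le> 4 * E"
    using assms W M2 by (intro energy_diff) (auto simp: PiE_iff)
  finally show ?thesis .
next
  case True
  let ?i = "Min (active l W)"
  have "j \<noteq> ?i" using True Min_active(2) by metis
  then have "(\<Sum>k<n. (signal l f W k - signal l f (neighbour W j) k)\<^sup>2) = (\<Sum>k<n. (f ?i (W ?i) k - f j 1 k)\<^sup>2)"
    using assms True Min_active(1) codeword_0 by (intro sum.cong refl) (simp add: neighbour_def signal_upd)
  also have "\<dots> \<le> 4 * E"
    using assms Min_active M2 by (intro energy_diff) auto
  finally show ?thesis .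
qed

end

definition busy :: "real \<Rightarrow> (nat \<Rightarrow> nat) set" where
  "busy a = {W. W \<in> T \<and> real (card (active l W)) \<ge> a}"

lemma busy_subset: "busy a \<subseteq> T"
  by (auto simp: busy_def)

lemma finite_busy: "finite (busy a)"
  using busy_subset finite_tuples finite_subset by blast

lemma busy_active: "a > 0 \<Longrightarrow> W \<in> busy a \<Longrightarrow> active l W \<noteq> {}"
  by (auto simp: busy_def)

lemma prob_busy_le_1: "(\<Sum>W\<in>busy a. p W) \<le> 1"
  using sum_mono2[OF finite_tuples busy_subset, of a p] sum_tuple_prob[OF sum_pmf_message[OF \<alpha> M], of l] 
    tuple_prob_nonneg by simp

lemma prob_busy_ge: "(\<Sum>W\<in>busy (\<alpha> * real l / 2). p W) \<ge> \<alpha> * real l / (\<alpha> * real l + 4)"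
  unfolding busy_def by (rule prob_many_active[OF \<alpha> M])

lemma energy_nonneg: "l > 0 \<Longrightarrow> 0 \<le> E"
  using energy[of 0 0] sum_nonneg[of "{..<n}" "\<lambda>j. (f 0 0 j)\<^sup>2"] by simp

text \<open>Decoding \<open>W\<close> when a neighbour was sent is an error. Every \<open>W\<close>
  with enough active users has \<open>l\<close> neighbours as likely as itself, each confused with
  it at least as often as \<open>C_shift\<close> says. All these confusions together have mass at
  most \<epsilon>, so the lower bound is multiplied by \<open>l\<close> on the left.\<close>

lemma neighbour_bound:
  assumes "M \<ge> 2" "a > 0" and c: "c \<ge> 0" and P: "(\<Sum>W\<in>busy a. p W) \<ge> P"
  shows "real l * (c * (P - \<epsilon>) - 4 * E / N0) \<le> exp c * \<epsilon>"
proof (cases "l = 0")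
  case True
  then show ?thesis using eps by simp
next
  case False
  then have E: "E \<ge> 0" using energy_nonneg by simp
  have "real l * (c * (P - \<epsilon>) - 4 * E / N0) \<le> real l * (\<Sum>W\<in>busy a. p W * (c * C W W - 4 * E / N0))"
  proof (intro mult_left_mono)
    have "c * (P - \<epsilon>) \<le> c * (\<Sum>W\<in>busy a. p W * C W W)"
      using sum_p_C_ge[OF busy_subset, of a] P by (intro mult_left_mono c) simp
    moreover have "(\<Sum>W\<in>busy a. p W) * (4 * E / N0) \<le> 1 * (4 * E / N0)"
      using prob_busy_le_1 E N0 by (intro mult_right_mono) auto
    moreover have "(\<Sum>W\<in>busy a. p W * (c * C W W - K)) = c * (\<Sum>W\<in>busy a. p W * C W W) - (\<Sum>W\<in>busy a. p W) * K" for K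
      by (simp add: right_diff_distrib sum_subtractf sum_distrib_left sum_distrib_right mult.left_commute)
    ultimately show "c * (P - \<epsilon>) - 4 * E / N0 \<le> (\<Sum>W\<in>busy a. p W * (c * C W W - 4 * E / N0))"
      by simp
  qed simp
  also have "\<dots> = (\<Sum>W\<in>busy a. \<Sum>j<l. p W * (c * C W W - 4 * E / N0))"
    by (simp add: sum_distrib_left)
  also have "\<dots> \<le> (\<Sum>W\<in>busy a. \<Sum>j<l. exp c * (p (neighbour W j) * C (neighbour W j) W))"
  proof (intro sum_mono)
    fix W j assume Wj: "W \<in> busy a" "j \<in> {..<l}"
    note W = subsetD[OF busy_subset Wj(1)] busy_active[OF \<open>a > 0\<close> Wj(1)] \<open>M \<ge> 2\<close>
    have "(\<Sum>k<n. (signal l f W k - signal l f (neighbour W j) k)\<^sup>2) / N0 \<le> 4 * E / N0"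
      using distance_neighbour[OF W] Wj(2) N0 by (intro divide_right_mono) auto
    then have "c * C W W - 4 * E / N0 \<le> exp c * C (neighbour W j) W"
      using C_shift[OF W(1), of c "neighbour W j"] by linarith
    then have "p W * (c * C W W - 4 * E / N0) \<le> p W * (exp c * C (neighbour W j) W)"
      by (intro mult_left_mono tuple_prob_nonneg)
    then show "p W * (c * C W W - 4 * E / N0) \<le> exp c * (p (neighbour W j) * C (neighbour W j) W)"
      using p_neighbour[OF W] Wj(2) by (simp add: mult.left_commute)
  qed
  \<comment> \<open>Injectivity turns the sum over users into one over distinct tuples, so no
    confusion is counted twice.\<close>
  also have "\<dots> = exp c * (\<Sum>W\<in>busy a. \<Sum>V\<in>neighbour W ` {..<l}. p V * C V W)"
    using inj_neighbour[OF _ busy_active[OF \<open>a > 0\<close>] \<open>M \<ge> 2\<close>] busy_subset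
    by (simp add: sum_distrib_left sum.reindex subset_iff)
  also have "\<dots> \<le> exp c * (\<Sum>W\<in>busy a. \<Sum>V\<in>T. of_bool (V \<noteq> W) * (p V * C V W))"
  proof (intro mult_left_mono sum_mono)
    fix W assume W: "W \<in> busy a"
    note W' = subsetD[OF busy_subset W] busy_active[OF \<open>a > 0\<close> W] \<open>M \<ge> 2\<close>
    have "(\<Sum>V\<in>neighbour W ` {..<l}. p V * C V W) = (\<Sum>V\<in>neighbour W ` {..<l}. of_bool (V \<noteq> W) * (p V * C V W))"
      using neighbour_neq[OF W'] by (intro sum.cong) auto
    also have "\<dots> \<le> (\<Sum>V\<in>T. of_bool (V \<noteq> W) * (p V * C V W))"
      using neighbour_in[OF W'] tuple_prob_nonneg by (intro sum_mono2 finite_tuples) auto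
    finally show "(\<Sum>V\<in>neighbour W ` {..<l}. p V * C V W) \<le> (\<Sum>V\<in>T. of_bool (V \<noteq> W) * (p V * C V W))" .
  qed simp
  also have "\<dots> \<le> exp c * (\<Sum>W\<in>T. \<Sum>V\<in>T. of_bool (V \<noteq> W) * (p V * C V W))"
    using tuple_prob_nonneg
    by (intro mult_left_mono sum_mono2 finite_tuples busy_subset sum_nonneg) auto
  \<comment> \<open>With the sent tuple outside, the wrong decisions for each V have total
    probability at most \<open>1 - C V V\<close>.\<close>
  also have "(\<Sum>W\<in>T. \<Sum>V\<in>T. of_bool (V \<noteq> W) * (p V * C V W)) = (\<Sum>V\<in>T. \<Sum>W\<in>T. of_bool (V \<noteq> W) * (p V * C V W))"
    by (rule sum.swap)
  also have "\<dots> \<le> (\<Sum>V\<in>T. p V - p V * C V V)"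
  proof (rule sum_mono)
    fix V assume V: "V \<in> T"
    have "(\<Sum>W\<in>T. of_bool (V \<noteq> W) * (p V * C V W)) = p V * (\<Sum>W\<in>T - {V}. C V W)"
      using finite_tuples V by (subst sum.remove[OF _ V]) (auto simp: sum_distrib_left intro!: sum.cong)
    also have "(\<Sum>W\<in>T - {V}. C V W) \<le> 1 - C V V"
      using sum_C_le[of T V] finite_tuples[of l M] V by (simp add: sum_diff1)
    finally show "(\<Sum>W\<in>T. of_bool (V \<noteq> W) * (p V * C V W)) \<le> p V - p V * C V V"
      using tuple_prob_nonneg by (simp add: right_diff_distrib mult_left_mono)
  qed
  also have "\<dots> \<le> \<epsilon>"
    using sum_p_C_ge[of T] by (simp add: sum_subtractf)
  finally show ?thesis by simp
qed

text \<open>Keeping \<epsilon> inside the logarithm makes the bound useful in both converses: for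
  large \<open>l\<close>, and for bounded \<open>l\<close> with small \<epsilon>.\<close>

lemma energy_lower_bound:
  assumes "M \<ge> 2" "\<alpha> * real l > 0" and P: "P \<le> \<alpha> * real l / (\<alpha> * real l + 4)" "P > 0" and \<epsilon>: "0 < \<epsilon>" "\<epsilon> \<le> P / 2"
  shows "ln (real l / \<epsilon>) \<le> (2 / P) * (1 + 4 * E / N0)"
proof -
  \<comment> \<open>Chosen so that \<open>?c * (P / 2) = 1 + 4 * E / N0\<close>; as
    \<open>\<epsilon> \<le> P / 2\<close>, the bracket in \<open>neighbour_bound\<close> is then at
    least 1.\<close>
  let ?c = "(2 / P) * (1 + 4 * E / N0)"
  have l: "l > 0" using assms(2) by (cases "l = 0") auto
  have c: "?c \<ge> 0" using energy_nonneg[OF l] N0 P by simp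
  have "1 + 4 * E / N0 = ?c * (P / 2)" using P by simp
  also have "\<dots> \<le> ?c * (P - \<epsilon>)"
    using c \<epsilon> by (intro mult_left_mono) auto
  finally have "real l * 1 \<le> real l * (?c * (P - \<epsilon>) - 4 * E / N0)"
    by (intro mult_left_mono) auto
  also have "\<dots> \<le> exp ?c * \<epsilon>"
    using prob_busy_ge P assms by (intro neighbour_bound[of "\<alpha> * real l / 2"] c) auto
  finally have "real l / \<epsilon> \<le> exp ?c" using \<epsilon> by (simp add: field_simps)
  then have "ln (real l / \<epsilon>) \<le> ln (exp ?c)" using l \<epsilon> by (subst ln_le_cancel_iff) auto
  then show ?thesis by simp
qed

end

section \<open>Sum-rate and single-user bounds\<close>

context gaussian_code
begin

text \<open>Centring matters: the second moment of the uncentred signal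
  can be of order \<open>(\<alpha> l)\<^sup>2 E\<close>.\<close>

lemma signal_variance:
  defines "m \<equiv> \<lambda>j. \<Sum>i<l. \<Sum>w\<in>{0..M}. q w * f i w j"
  shows "(\<Sum>W\<in>T. p W * (\<Sum>j<n. (signal l f W j - m j)\<^sup>2)) \<le> \<alpha> * real l * E"
proof -
  note qs = sum_pmf_message[OF \<alpha> M]
  have "(\<Sum>W\<in>T. p W * (\<Sum>j<n. (signal l f W j - m j)\<^sup>2)) = (\<Sum>j<n. \<Sum>W\<in>T. p W * (signal l f W j - m j)\<^sup>2)"
    unfolding sum_distrib_left by (rule sum.swap)
  also have "\<dots> = (\<Sum>j<n. \<Sum>i<l. (\<Sum>w\<in>{0..M}. q w * (f i w j)\<^sup>2) - (\<Sum>w\<in>{0..M}. q w * f i w j)\<^sup>2)"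
    unfolding signal_def m_def by (intro sum.cong refl sum_tuple_prob_variance[OF qs])
  also have "\<dots> \<le> (\<Sum>j<n. \<Sum>i<l. \<Sum>w\<in>{0..M}. q w * (f i w j)\<^sup>2)"
    by (intro sum_mono) simp
  also have "\<dots> = (\<Sum>i<l. \<Sum>w\<in>{0..M}. q w * (\<Sum>j<n. (f i w j)\<^sup>2))"
  proof -
    have "(\<Sum>j<n. \<Sum>i<l. \<Sum>w\<in>{0..M}. q w * (f i w j)\<^sup>2) = (\<Sum>i<l. \<Sum>j<n. \<Sum>w\<in>{0..M}. q w * (f i w j)\<^sup>2)"
      by (rule sum.swap)
    also have "\<dots> = (\<Sum>i<l. \<Sum>w\<in>{0..M}. q w * (\<Sum>j<n. (f i w j)\<^sup>2))"
      unfolding sum_distrib_left by (intro sum.cong[OF refl] sum.swap)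
    finally show ?thesis .
  qed
  \<comment> \<open>A silent user sends the zero codeword; this produces the factor
    \<alpha>.\<close>
  also have "\<dots> \<le> (\<Sum>i<l. \<Sum>w\<in>{0..M}. q w * of_bool (w \<noteq> 0) * E)"
  proof (intro sum_mono)
    fix i w assume "i \<in> {..<l}" "w \<in> {0..M}"
    then show "q w * (\<Sum>j<n. (f i w j)\<^sup>2) \<le> q w * of_bool (w \<noteq> 0) * E"
      using energy[of i w] codeword_0[of i] by (cases "w = 0") (auto intro!: mult_left_mono)
  qed
  also have "\<dots> = (\<Sum>i<l. \<alpha> * E)"
    unfolding sum_distrib_right[symmetric] sum_q_nonzero[OF \<alpha> M] ..
  also have "\<dots> = \<alpha> * real l * E" by simp
  finally show ?thesis .
qed

text \<open>With \<open>c = a * ln M\<close>, every tuple with at least \<open>a\<close> active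
  users satisfies \<open>p W * exp c \<le> 1\<close>. The reference terms thus add up to the measure
  of a disjoint union, which explains the 1 on the right; the rest is the average
  divergence.\<close>

lemma sum_rate_bound:
  assumes "n \<ge> 1" and P: "(\<Sum>W\<in>busy a. p W) \<ge> P" and "a \<ge> 0" "l > 0"
  shows "a * ln (real M) * (P - \<epsilon>) \<le> 1 + real n / 2 * ln (1 + 2 * (\<alpha> * real l * E) / (real n * N0))"
proof -
  define K where "K = \<alpha> * real l * E"
  define c where "c = a * ln (real M)"
  \<comment> \<open>Noise variance plus the bound on the signal variance per coordinate. With this
    choice the quadratic terms of the average divergence add up to at most \<open>n / 2\<close>,
    which cancels the constant part and leaves \<open>n * ln (\<tau> / \<sigma>)\<close>.\<close>
  define \<tau> where "\<tau> = sqrt (N0 / 2 + K / real n)"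
  define m where "m j = (\<Sum>i<l. \<Sum>w\<in>{0..M}. q w * f i w j)" for j
  have K: "K \<ge> 0" using \<alpha> energy_nonneg \<open>l > 0\<close> by (simp add: K_def)
  have c: "c \<ge> 0" using M \<open>a \<ge> 0\<close> by (simp add: c_def)
  have \<tau>2: "\<tau>\<^sup>2 = N0 / 2 + K / real n" using N0 K by (simp add: \<tau>_def)
  have \<tau>: "\<tau> > 0" using N0 K by (simp add: \<tau>_def add_pos_nonneg)
  define KL where "KL W = (\<Sum>j<n. ln (\<tau> / \<sigma>) + (\<sigma>\<^sup>2 + (signal l f W j - m j)\<^sup>2) / (2 * \<tau>\<^sup>2) - 1 / 2)" for W
  let ?Q = "\<lambda>W. measure (gauss n \<tau> m) (decoding_region n g W)"
  \<comment> \<open>Nonnegativity of the divergence is the case of the empty event and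
    \<open>c = 0\<close>. It allows extending the sum from the busy tuples to all tuples.\<close>
  have KL0: "KL W \<ge> 0" for W
    using gauss_divergence_bound[OF sigma_pos \<tau>, of "{}" n 0 "signal l f W" m] by (simp add: KL_def)
  have KLe: "KL W = real n * (ln (\<tau> / \<sigma>) + \<sigma>\<^sup>2 / (2 * \<tau>\<^sup>2) - 1 / 2) + (\<Sum>j<n. (signal l f W j - m j)\<^sup>2) / (2 * \<tau>\<^sup>2)" for W
    by (simp add: KL_def sum.distrib sum_subtractf add_divide_distrib sum_divide_distrib algebra_simps)
  have "(\<Sum>W\<in>T. p W * KL W) = (\<Sum>W\<in>T. p W) * (real n * (ln (\<tau> / \<sigma>) + \<sigma>\<^sup>2 / (2 * \<tau>\<^sup>2) - 1 / 2)) +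
     (\<Sum>W\<in>T. p W * (\<Sum>j<n. (signal l f W j - m j)\<^sup>2)) / (2 * \<tau>\<^sup>2)"
    unfolding KLe distrib_left sum.distrib
    by (simp only: sum_distrib_right sum_divide_distrib[of "\<lambda>W. p W * _ W"] times_divide_eq_right)
  also have "\<dots> \<le> 1 * (real n * (ln (\<tau> / \<sigma>) + \<sigma>\<^sup>2 / (2 * \<tau>\<^sup>2) - 1 / 2)) + K / (2 * \<tau>\<^sup>2)"
    using signal_variance sum_tuple_prob[OF sum_pmf_message[OF \<alpha> M], of l]
    by (intro add_mono divide_right_mono) (auto simp: m_def K_def)
  also have "\<dots> = real n * ln (\<tau> / \<sigma>)"
  proof -
    have "real n * \<sigma>\<^sup>2 + K = real n * \<tau>\<^sup>2"
      using \<open>n \<ge> 1\<close> N0 by (simp add: \<tau>2 distrib_left)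
    then have "(real n * \<sigma>\<^sup>2 + K) / (2 * \<tau>\<^sup>2) = real n / 2" using \<tau> by simp
    then show ?thesis by (simp add: algebra_simps add_divide_distrib)
  qed
  also have "ln (\<tau> / \<sigma>) = 1 / 2 * ln (1 + 2 * K / (real n * N0))"
  proof -
    have "\<tau> / \<sigma> = sqrt (1 + 2 * K / (real n * N0))"
      unfolding \<tau>_def real_sqrt_divide[symmetric] using N0 \<open>n \<ge> 1\<close> by (simp add: field_simps)
    moreover have "1 + 2 * K / (real n * N0) > 0"
      using K N0 by (intro add_pos_nonneg) auto
    ultimately show ?thesis by (simp add: ln_sqrt)
  qed
  finally have avgKL: "(\<Sum>W\<in>T. p W * KL W) \<le> real n / 2 * ln (1 + 2 * K / (real n * N0))" by simp
  have "c * (P - \<epsilon>) \<le> c * (\<Sum>W\<in>busy a. p W * C W W)"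
    using sum_p_C_ge[OF busy_subset, of a] P by (intro mult_left_mono c) simp
  also have "\<dots> = (\<Sum>W\<in>busy a. p W * (c * C W W))"
    by (simp add: sum_distrib_left mult.left_commute)
  also have "\<dots> \<le> (\<Sum>W\<in>busy a. ?Q W + p W * KL W)"
  proof (rule sum_mono)
    fix W assume W: "W \<in> busy a"
    then have WT: "W \<in> T" and act: "real (card (active l W)) \<ge> a" by (auto simp: busy_def)
    have "c * C W W \<le> exp c * ?Q W + KL W"
      unfolding C_def KL_def by (rule gauss_divergence_bound[OF sigma_pos \<tau> decoding_region_sets[OF g WT]])
    then have "p W * (c * C W W) \<le> p W * (exp c * ?Q W + KL W)"
      by (intro mult_left_mono tuple_prob_nonneg)
    also have "\<dots> = (p W * exp c) * ?Q W + p W * KL W"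
      by (simp add: algebra_simps)
    \<comment> \<open>The smallness of each tuple probability pays for the change of
      measure.\<close>
    also have "p W * exp c \<le> exp (- c) * exp c"
      using tuple_prob_le[OF \<alpha> M WT act] by (intro mult_right_mono) (auto simp: c_def)
    also have "exp (- c) * exp c = 1" by (simp flip: exp_add)
    finally show "p W * (c * C W W) \<le> ?Q W + p W * KL W"
      by (simp add: mult_right_mono)
  qed
  also have "\<dots> \<le> 1 + (\<Sum>W\<in>T. p W * KL W)"
    unfolding sum.distrib
  proof (intro add_mono)
    interpret prob_space "gauss n \<tau> m" by (rule prob_space_gauss[OF \<tau>])
    have "(\<Sum>W\<in>busy a. ?Q W) = measure (gauss n \<tau> m) (\<Union>W\<in>busy a. decoding_region n g W)"
      using decoding_region_sets[OF g subsetD[OF busy_subset]]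
      by (intro finite_measure_finite_Union[symmetric] finite_busy)
         (auto simp: disjoint_family_on_def dest: disjoint_decoding_region[of _ _ n g])
    then show "(\<Sum>W\<in>busy a. ?Q W) \<le> 1" by simp
    show "(\<Sum>W\<in>busy a. p W * KL W) \<le> (\<Sum>W\<in>T. p W * KL W)"
      using KL0 tuple_prob_nonneg by (intro sum_mono2 finite_tuples busy_subset) auto
  qed
  also note avgKL
  finally show ?thesis by (simp add: c_def K_def)
qed

text \<open>Erasing the first active user gives a reference measure that does not depend on that
  user's message; exchanging the message with an independent uniform one preserves the
  distribution of the tuple.\<close>

lemma single_user_bound:
  assumes P: "P \<le> (\<Sum>W\<in>busy 1. p W)" "P > 0"
  shows "ln (real M) * (1 - \<epsilon> / P) \<le> 1 + E / N0"
proof -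
  define B where "B = busy 1"
  define i where "i W = Min (active l W)" for W
  define P1 where "P1 = (\<Sum>W\<in>B. p W)"
  have BT: "B \<subseteq> T" unfolding B_def by (rule busy_subset)
  have Bne: "active l W \<noteq> {}" if "W \<in> B" for W using busy_active[of 1 W] that by (simp add: B_def)
  have i: "i W < l" "i W \<in> active l W" "W (i W) \<in> {1..M}" if "W \<in> B" for W
    using Min_in[OF finite_active Bne[OF that]] BT that
    by (auto simp: i_def active_def PiE_iff Suc_le_eq subset_iff)
  have P1: "P1 \<ge> P" using P by (simp add: P1_def B_def)
  have l: "l > 0"
  proof (rule ccontr)
    assume "\<not> l > 0"
    then have "B = {}" using i(1) by blast
    then show False using P1 P by (simp add: P1_def)
  qed
  have upd_active: "active l (W(i W := w)) = active l W" if "W \<in> B" "w \<in> {1..M}" for W w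
    using active_upd_nonzero[OF i(1)[OF that(1)], of w W] i(2)[OF that(1)] that(2) by (simp add: insert_absorb)
  have upd_B: "W(i W := w) \<in> B" if "W \<in> B" "w \<in> {1..M}" for W w
    using that upd_active[OF that] i(1)[OF that(1)] BT by (auto simp: B_def busy_def PiE_iff extensional_def)
  have upd_i: "i (W(i W := w)) = i W" if "W \<in> B" "w \<in> {1..M}" for W w
    using upd_active[OF that] by (simp add: i_def)
  have upd_p: "p (W(i W := w)) = p W" if "W \<in> B" "w \<in> {1..M}" for W w
    using upd_active[OF that] upd_B[OF that] that BT by (intro p_eq_if_card_active_eq) auto
  \<comment> \<open>Mass of still decoding correctly when the first active user is silenced. The
    output then carries no information on the erased message, so S is at most
    \<open>P1 / M\<close>.\<close>
  define S where "S = (\<Sum>W\<in>B. p W * C (W(i W := 0)) W)"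
  have "real M * S = (\<Sum>x\<in>B \<times> {1..M}. p (fst x) * C ((fst x)(i (fst x) := 0)) (fst x))"
    by (simp add: S_def sum.cartesian_product' sum_distrib_left)
  \<comment> \<open>Swapping the message of the first active user with the auxiliary
    \<open>w\<close> is an involution. It keeps the first active user, the probability and the
    silenced tuple.\<close>
  also have "\<dots> = (\<Sum>x\<in>B \<times> {1..M}. p (fst x) * C ((fst x)(i (fst x) := 0)) ((fst x)(i (fst x) := snd x)))"
    by (rule sum.reindex_bij_witness[where i = "\<lambda>(W, w). (W(i W := w), W (i W))" and j = "\<lambda>(W, w). (W(i W := w), W (i W))"])
       (auto simp: upd_i upd_B upd_p i(3)[simplified])
  also have "\<dots> = (\<Sum>W\<in>B. p W * (\<Sum>w\<in>{1..M}. C (W(i W := 0)) (W(i W := w))))"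
    by (simp add: sum.cartesian_product' sum_distrib_left)
  also have "\<dots> \<le> (\<Sum>W\<in>B. p W * 1)"
  proof (intro sum_mono mult_left_mono)
    fix W assume W: "W \<in> B"
    have "(\<Sum>w\<in>{1..M}. C (W(i W := 0)) (W(i W := w))) = (\<Sum>V\<in>(\<lambda>w. W(i W := w)) ` {1..M}. C (W(i W := 0)) V)"
      by (subst sum.reindex) (auto simp: inj_on_def fun_upd_eqD)
    also have "\<dots> \<le> 1" using upd_B[OF W] BT by (intro sum_C_le) blast
    finally show "(\<Sum>w\<in>{1..M}. C (W(i W := 0)) (W(i W := w))) \<le> 1" .
  qed (simp add: tuple_prob_nonneg)
  finally have S: "real M * S \<le> P1" by (simp add: P1_def)
  have "ln (real M) * (P1 - \<epsilon>) \<le> ln (real M) * (\<Sum>W\<in>B. p W * C W W)"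
    using sum_p_C_ge[OF BT] M by (intro mult_left_mono) (auto simp: P1_def)
  also have "\<dots> = (\<Sum>W\<in>B. p W * (ln (real M) * C W W))"
    by (simp add: sum_distrib_left mult.left_commute)
  also have "\<dots> \<le> (\<Sum>W\<in>B. p W * (real M * C (W(i W := 0)) W + E / N0))"
  proof (intro sum_mono mult_left_mono)
    fix W assume W: "W \<in> B"
    have "(\<Sum>j<n. (signal l f W j - signal l f (W(i W := 0)) j)\<^sup>2) = (\<Sum>j<n. (f (i W) (W (i W)) j)\<^sup>2)"
      using i(1)[OF W] by (intro sum.cong refl) (simp add: signal_deactivate)
    also have "\<dots> \<le> E" using i[OF W] by (intro energy) auto
    finally have "(\<Sum>j<n. (signal l f W j - signal l f (W(i W := 0)) j)\<^sup>2) / N0 \<le> E / N0"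
      using N0 by (intro divide_right_mono) auto
    then show "ln (real M) * C W W \<le> real M * C (W(i W := 0)) W + E / N0"
      using C_shift[of W "ln (real M)" "W(i W := 0)"] W BT M by auto
  qed (simp add: tuple_prob_nonneg)
  also have "\<dots> = real M * S + P1 * (E / N0)"
    unfolding S_def P1_def distrib_left sum.distrib sum_distrib_left sum_distrib_right
    by (simp only: mult.left_commute)
  also have "\<dots> \<le> P1 * (1 + E / N0)" using S by (simp add: algebra_simps)
  finally have "ln (real M) * (P1 - \<epsilon>) \<le> P1 * (1 + E / N0)" .
  moreover have "ln (real M) * (P1 - \<epsilon>) = P1 * (ln (real M) * (1 - \<epsilon> / P1))"
    using P P1 by (simp add: right_diff_distrib)
  ultimately have "ln (real M) * (1 - \<epsilon> / P1) \<le> 1 + E / N0"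
    using P P1 by (simp add: mult_le_cancel_left_pos)
  \<comment> \<open>Only a lower bound P on \<open>P1\<close> is known, and replacing
    \<open>P1\<close> by it decreases the left-hand side.\<close>
  moreover have "ln (real M) * (1 - \<epsilon> / P) \<le> ln (real M) * (1 - \<epsilon> / P1)"
    using M P P1 eps by (intro mult_left_mono diff_left_mono divide_left_mono) auto
  ultimately show ?thesis by linarith
qed

text \<open>The number of active users is an integer, so being at least a positive number makes it
  at least 1.\<close>

lemma prob_busy_1_ge:
  assumes "\<alpha> * real l > 0"
  shows "(\<Sum>W\<in>busy 1. p W) \<ge> \<alpha> * real l / (\<alpha> * real l + 4)"
proof -
  have "busy (\<alpha> * real l / 2) \<subseteq> busy 1"
  proof
    fix W assume "W \<in> busy (\<alpha> * real l / 2)"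
    then have "W \<in> T" "real (card (active l W)) > 0" using assms by (simp_all add: busy_def)
    then show "W \<in> busy 1" by (simp add: busy_def)
  qed
  then have "(\<Sum>W\<in>busy (\<alpha> * real l / 2). p W) \<le> (\<Sum>W\<in>busy 1. p W)"
    using tuple_prob_nonneg by (intro sum_mono2 finite_busy) auto
  then show ?thesis using prob_busy_ge by linarith
qed

end

section \<open>Upper bounds on achievable rates\<close>

lemma rate_gt_iff:
  assumes "b > 1" "E > 0"
  shows "log b x / E > r \<longleftrightarrow> ln x > r * ln b * E"
proof -
  have "log b x / E > r \<longleftrightarrow> ln x / ln b > r * E"
    unfolding log_def by (rule pos_less_divide_eq[OF assms(2)])
  also have "\<dots> \<longleftrightarrow> ln x > r * E * ln b"
    using assms by (simp add: pos_less_divide_eq)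
  finally show ?thesis by (simp only: mult_ac)
qed

lemma ge_2_if_ln_pos: "ln (real M) > 0 \<Longrightarrow> M \<ge> 2"
  by (cases "M = 0 \<or> M = 1") auto

lemma bigomega_1_D:
  assumes "k \<in> \<Omega>(\<lambda>n::nat. 1 :: real)" and "\<And>n. k n \<ge> 0"
  obtains c :: real where "c > 0" "eventually (\<lambda>n. k n \<ge> c) sequentially"
proof -
  obtain c where c: "c > 0" "eventually (\<lambda>n. norm (1 :: real) * c \<le> norm (k n)) sequentially"
    using landau_omega.bigE[OF assms(1)] by (metis mult.commute)
  then show ?thesis using assms(2) by (intro that[of c]) auto
qed

lemma frac_add_4_mono: "0 < c \<Longrightarrow> c \<le> k \<Longrightarrow> c / (c + 4) \<le> k / (k + 4 :: real)"
  by (simp add: field_simps)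

text \<open>One code of sufficiently small error refutes a rate above \<open>1 / N0\<close> nats.
  The two intermediate rates \<open>\<rho> > \<rho>'\<close> above \<open>1 / N0\<close> leave room
  for the two losses of \<open>single_user_bound\<close>: the factor
  \<open>1 - \<epsilon> / P\<close> and the additive 1.\<close>

lemma achievable_le:
  fixes b N0 R :: real and \<alpha> k :: "nat \<Rightarrow> real" and l :: "nat \<Rightarrow> nat"
  assumes b: "b > 1" and N0: "N0 > 0" and probs: "\<And>n. 0 \<le> \<alpha> n \<and> \<alpha> n \<le> 1"
    and k: "\<And>n. k n = \<alpha> n * real (l n)" and k1: "k \<in> \<Omega>(\<lambda>n. 1)"
    and R: "achievable b N0 \<alpha> l R"
  shows "R \<le> log b (exp 1) / N0"
proof (rule ccontr)
  assume contra: "\<not> R \<le> log b (exp 1) / N0"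
  have lnb: "ln b > 0" using b by simp
  define \<rho> where "\<rho> = (R * ln b + 1 / N0) / 2"
  define \<rho>' where "\<rho>' = (\<rho> + 1 / N0) / 2"
  have "1 / N0 / ln b < R" using contra by (simp add: log_def mult.commute)
  then have "R * ln b > 1 / N0" by (subst (asm) pos_divide_less_eq[OF lnb])
  then have \<rho>: "\<rho> > 1 / N0" "\<rho> < R * ln b" by (auto simp: \<rho>_def)
  then have \<rho>': "1 / N0 < \<rho>'" "\<rho>' < \<rho>" by (auto simp: \<rho>'_def)
  have iN0: "1 / N0 > 0" using N0 by simp
  have \<rho>pos: "\<rho> > 0" "\<rho>' > 0" using \<rho> \<rho>' iN0 by linarith+
  obtain c where c: "c > 0" "eventually (\<lambda>n. k n \<ge> c) sequentially"
    using bigomega_1_D[OF k1] probs k by (metis mult_nonneg_nonneg of_nat_0_le_iff)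
  define P where "P = c / (c + 4)"
  have P: "0 < P" "P < 1" using c by (auto simp: P_def)
  \<comment> \<open>From this energy on, \<open>E * (\<rho>' - 1 / N0)\<close> reaches the additive
    1 of the single-user bound.\<close>
  define E0 where "E0 = 1 / (\<rho>' - 1 / N0)"
  define X where "X = (2 / P) * (1 + 4 * E0 / N0)"
  \<comment> \<open>The three terms in turn admit \<open>energy_lower_bound\<close>, limit the loss
    by \<open>1 - \<epsilon> / P\<close> to the step from \<rho> to \<open>\<rho>'\<close>, and
    force \<open>E \<ge> E0\<close>.\<close>
  define \<epsilon> where "\<epsilon> = min (P / 2) (min ((1 - \<rho>' / \<rho>) * P) (exp (- X)))"
  have "(1 - \<rho>' / \<rho>) * P > 0" using \<rho>' \<rho>pos P by simp
  then have \<epsilon>: "0 < \<epsilon>" "\<epsilon> \<le> P / 2" "\<epsilon> \<le> (1 - \<rho>' / \<rho>) * P" "\<epsilon> \<le> exp (- X)"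
    using P unfolding \<epsilon>_def by (simp_all only: min.cobounded1 min.coboundedI2 min.cobounded2 min_less_iff_conj) simp_all
  have \<epsilon>1: "\<epsilon> < 1" using \<epsilon>(2) P by linarith
  \<comment> \<open>Makes the guaranteed rate \<open>R - \<delta>\<close> equal to \<rho>
    nats.\<close>
  define \<delta> where "\<delta> = R - \<rho> / ln b"
  have \<delta>: "\<delta> > 0" using \<rho>(2) lnb by (simp add: \<delta>_def pos_divide_less_eq)
  obtain n0 where n0: "\<forall>n\<ge>n0. \<exists>M E f g. is_code N0 (\<alpha> n) (l n) n M E \<epsilon> f g \<and> E > 0 \<and> log b (real M) / E > R - \<delta>"
    using R \<epsilon>(1) \<epsilon>1 \<delta> unfolding achievable_def eps_achievable_def by blast
  obtain n where n: "n \<ge> n0" "k n \<ge> c"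
    using c(2) unfolding eventually_sequentially by (meson le_cases)
  obtain M E f g where cd: "is_code N0 (\<alpha> n) (l n) n M E \<epsilon> f g" and E: "E > 0" and rate: "log b (real M) / E > \<rho> / ln b"
    using n0 n(1) by (auto simp: \<delta>_def)
  interpret gaussian_code N0 "\<alpha> n" "l n" n M E \<epsilon> f g
    using N0 probs cd by unfold_locales auto
  have lnM: "ln (real M) > \<rho> * E" using rate rate_gt_iff[OF b E] lnb by simp
  have "ln (real M) > 0" using mult_pos_pos[OF \<rho>pos(1) E] lnM by linarith
  then have lnM0: "ln (real M) \<ge> 0" and M2: "M \<ge> 2" by (auto intro: ge_2_if_ln_pos)
  have kpos: "\<alpha> n * real (l n) \<ge> c" using n(2) k by simp
  have Pk: "P \<le> \<alpha> n * real (l n) / (\<alpha> n * real (l n) + 4)"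
    unfolding P_def using frac_add_4_mono[OF c(1) kpos] .
  have l: "real (l n) \<ge> 1" using kpos c by (cases "l n = 0") auto
  \<comment> \<open>Only \<open>l \<ge> 1\<close> is available here, so the energy has to be forced
    by \<epsilon> alone.\<close>
  have "X \<le> ln (1 / \<epsilon>)"
    using \<epsilon> by (simp add: ln_div) (metis ln_exp ln_le_cancel_iff exp_gt_zero minus_le_iff minus_minus)
  also have "\<dots> \<le> ln (real (l n) / \<epsilon>)"
    using \<epsilon> l by (subst ln_le_cancel_iff) (auto intro: divide_right_mono)
  also have "\<dots> \<le> (2 / P) * (1 + 4 * E / N0)"
    using energy_lower_bound[OF M2 _ Pk P(1) \<epsilon>(1,2)] kpos c by simp
  finally have "1 + 4 * E0 / N0 \<le> 1 + 4 * E / N0"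
    unfolding X_def by (subst (asm) mult_le_cancel_left_pos) (use P in simp_all)
  then have Elow: "E0 \<le> E" using N0 by (simp add: divide_le_cancel)
  have "\<rho>' = \<rho> * (1 - (1 - \<rho>' / \<rho>) * P / P)" using \<rho>pos P by simp
  also have "\<dots> \<le> \<rho> * (1 - \<epsilon> / P)"
    using \<epsilon>(3) P \<rho>pos by (intro mult_left_mono diff_left_mono divide_right_mono) auto
  finally have "E * \<rho>' \<le> E * (\<rho> * (1 - \<epsilon> / P))" using E by (intro mult_left_mono) auto
  also have "\<dots> = (\<rho> * E) * (1 - \<epsilon> / P)" by simp
  also have "\<dots> < ln (real M) * (1 - \<epsilon> / P)"
    using lnM \<epsilon>(2) P by (intro mult_strict_right_mono) (auto simp: field_simps)
  also have "\<dots> \<le> 1 + E / N0"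
    using single_user_bound[of P] prob_busy_1_ge Pk kpos c P by linarith
  finally have "E * (\<rho>' - 1 / N0) < 1" by (simp add: algebra_simps)
  moreover have "1 \<le> E * (\<rho>' - 1 / N0)" using Elow \<rho>' by (simp add: E0_def pos_divide_le_eq)
  ultimately show False by simp
qed

text \<open>Tangent line of the logarithm at \<open>s\<close>. Its slope \<open>1 / s\<close> can be
  made as small as desired, so a linear term can absorb the logarithm.\<close>

lemma ln_one_plus_le:
  fixes s y :: real
  assumes "s > 0" "y \<ge> 0"
  shows "ln (1 + y) \<le> (1 + y) / s - 1 + ln s"
proof -
  have "ln ((1 + y) / s) \<le> (1 + y) / s - 1"
    using assms by (intro ln_le_minus_one) auto
  then show ?thesis using assms by (simp add: ln_div)
qed

text \<open>At a positive rate \<open>ln M\<close> is at least proportional to \<open>E\<close>, so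
  the sum-rate bound sets a linear term in \<open>x = k n * E / n\<close> against a logarithmic one
  and bounds \<open>x\<close>. Since \<open>E\<close> dominates \<open>ln l\<close> up to constants,
  \<open>k n * ln l / n\<close> is bounded too, against the hypothesis.\<close>

lemma achievable_le_0:
  fixes b N0 R :: real and \<alpha> k :: "nat \<Rightarrow> real" and l :: "nat \<Rightarrow> nat"
  assumes b: "b > 1" and N0: "N0 > 0" and probs: "\<And>n. 0 \<le> \<alpha> n \<and> \<alpha> n \<le> 1"
    and k: "\<And>n. k n = \<alpha> n * real (l n)" and k1: "k \<in> \<Omega>(\<lambda>n. 1)"
    and fast: "(\<lambda>n. k n * log b (real (l n))) \<in> \<omega>(\<lambda>n. real n)"
    and R: "achievable b N0 \<alpha> l R"
  shows "R \<le> 0"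
proof (rule ccontr)
  assume "\<not> R \<le> 0"
  then have Rpos: "R > 0" by simp
  have lnb: "ln b > 0" using b by simp
  define \<rho> where "\<rho> = R * ln b / 2"
  have \<rho>: "\<rho> > 0" using Rpos lnb by (simp add: \<rho>_def)
  obtain c where c: "c > 0" "eventually (\<lambda>n. k n \<ge> c) sequentially"
    using bigomega_1_D[OF k1] probs k by (metis mult_nonneg_nonneg of_nat_0_le_iff)
  define P where "P = c / (c + 4)"
  have P: "0 < P" "P < 1" using c by (auto simp: P_def)
  define \<epsilon> where "\<epsilon> = P / 2"
  have \<epsilon>: "0 < \<epsilon>" "\<epsilon> \<le> P / 2" "\<epsilon> < 1" using P by (auto simp: \<epsilon>_def)
  \<comment> \<open>The tangent point for which
    \<open>2 * x / (N0 * s) = \<rho> * P * x / 4\<close>. After the factor 1/2 in front of the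
    logarithm, half of the linear term on the left survives; \<open>X\<close> is the resulting bound
    on \<open>x\<close>.\<close>
  define s where "s = 8 / (N0 * \<rho> * P)"
  have s: "s > 0" using N0 \<rho> P by (simp add: s_def)
  define X where "X = (8 / (\<rho> * P)) * (1 / 2 + 1 / (2 * s) + ln s / 2)"
  \<comment> \<open>The maximum covers the cases of large and of bounded \<open>l\<close>, the
    division by \<open>ln b\<close> changes the base, and the summand 1 makes the final
    contradiction strict.\<close>
  define K where "K = max (16 / P * X / N0) ((4 / P) * exp (4 / P)) / ln b + 1"
  have ev: "eventually (\<lambda>n. norm (real n) * K \<le> norm (k n * log b (real (l n)))) sequentially"
  proof -
    have "K > 0" using P lnb by (auto simp: K_def intro!: add_nonneg_pos divide_nonneg_pos simp: le_max_iff_disj)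
    then show ?thesis using landau_omega.smallD[OF fast] by (simp add: mult.commute)
  qed
  obtain n0 where n0: "\<forall>n\<ge>n0. \<exists>M E f g. is_code N0 (\<alpha> n) (l n) n M E \<epsilon> f g \<and> E > 0 \<and> log b (real M) / E > R - R / 2"
    using R \<epsilon> Rpos unfolding achievable_def eps_achievable_def by (meson half_gt_zero)
  have "eventually (\<lambda>n. k n \<ge> c \<and> real n * K \<le> \<bar>k n * log b (real (l n))\<bar> \<and> n \<ge> n0 \<and> n \<ge> 1) sequentially"
    using ev c(2) eventually_ge_at_top[of n0] eventually_ge_at_top[of 1] by eventually_elim simp
  then obtain n where n: "k n \<ge> c" "real n * K \<le> \<bar>k n * log b (real (l n))\<bar>" "n \<ge> n0" "n \<ge> 1"
    by (auto simp: eventually_sequentially)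
  obtain M E f g where cd: "is_code N0 (\<alpha> n) (l n) n M E \<epsilon> f g" and E: "E > 0" and rate: "log b (real M) / E > R / 2"
    using n0 n(3) by auto
  interpret gaussian_code N0 "\<alpha> n" "l n" n M E \<epsilon> f g
    using N0 probs cd by unfold_locales auto
  have lnM: "ln (real M) > \<rho> * E" using rate rate_gt_iff[OF b E] by (simp add: \<rho>_def)
  have "ln (real M) > 0" using mult_pos_pos[OF \<rho> E] lnM by linarith
  then have lnM0: "ln (real M) \<ge> 0" and M2: "M \<ge> 2" by (auto intro: ge_2_if_ln_pos)
  have kpos: "\<alpha> n * real (l n) \<ge> c" using n(1) k by simp
  have Pk: "P \<le> \<alpha> n * real (l n) / (\<alpha> n * real (l n) + 4)"
    unfolding P_def using frac_add_4_mono[OF c(1) kpos] .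
  have l: "real (l n) \<ge> 1" using kpos c by (cases "l n = 0") auto
  have kl: "k n \<le> real (l n)" using k probs[of n] by (simp add: mult_left_le_one_le)
  have lnl: "ln (real (l n)) \<ge> 0" using l by simp
  have "ln (real (l n)) \<le> ln (real (l n) / \<epsilon>)"
    using \<epsilon> l by (subst ln_le_cancel_iff) (auto simp: field_simps)
  also have "\<dots> \<le> (2 / P) * (1 + 4 * E / N0)"
    using energy_lower_bound[OF M2 _ Pk P(1) \<epsilon>(1,2)] kpos c by simp
  finally have lE: "ln (real (l n)) \<le> (2 / P) * (1 + 4 * E / N0)" .
  define x where "x = k n * E / real n"
  have x: "x \<ge> 0" using n c E by (simp add: x_def)
  \<comment> \<open>Here \<open>P - \<epsilon> = P / 2\<close>, by the choice of \<epsilon>.\<close>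
  have "k n / 2 * (\<rho> * E) * (P / 2) \<le> k n / 2 * ln (real M) * (P - \<epsilon>)"
    using lnM lnM0 n c P \<rho> E by (intro mult_mono) (auto simp: \<epsilon>_def)
  also have "\<dots> \<le> 1 + real n / 2 * ln (1 + 2 * (k n * E) / (real n * N0))"
  proof -
    have "P \<le> (\<Sum>W\<in>busy (k n / 2). p W)" using prob_busy_ge Pk k by simp
    from sum_rate_bound[OF n(4) this] show ?thesis using n c l k by simp
  qed
  also have "2 * (k n * E) / (real n * N0) = 2 * x / N0" by (simp add: x_def)
  also have "ln (1 + 2 * x / N0) \<le> (1 + 2 * x / N0) / s - 1 + ln s"
    using s x N0 by (intro ln_one_plus_le) auto
  finally have "k n / 2 * (\<rho> * E) * (P / 2) \<le> 1 + real n / 2 * ((1 + 2 * x / N0) / s - 1 + ln s)"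
    using n(4) by (simp add: mult_left_mono)
  moreover have "1 \<le> real n" using n(4) by simp
  moreover have "k n / 2 * (\<rho> * E) * (P / 2) = real n * (\<rho> * P * x / 4)"
    using n(4) by (simp add: x_def)
  ultimately have "real n * (\<rho> * P * x / 4) \<le> real n + real n / 2 * ((1 + 2 * x / N0) / s - 1 + ln s)"
    by linarith
  also have "\<dots> = real n * (1 + 1 / 2 * ((1 + 2 * x / N0) / s - 1 + ln s))"
    by (simp add: distrib_left)
  finally have "real n * (\<rho> * P * x / 4) \<le> real n * (1 + 1 / 2 * ((1 + 2 * x / N0) / s - 1 + ln s))" .
  then have "\<rho> * P * x / 4 \<le> 1 + 1 / 2 * ((1 + 2 * x / N0) / s - 1 + ln s)"
    using n(4) by (subst (asm) mult_le_cancel_left_pos) auto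
  also have "(1 + 2 * x / N0) / s = 1 / s + \<rho> * P * x / 4"
    using N0 by (simp add: s_def field_simps)
  finally have "\<rho> * P * x / 8 \<le> 1 / 2 + 1 / (2 * s) + ln s / 2"
    by (simp add: field_simps)
  then have "(8 / (\<rho> * P)) * (\<rho> * P * x / 8) \<le> X"
    unfolding X_def using \<rho> P by (intro mult_left_mono) auto
  then have xX: "x \<le> X" using \<rho> P by simp
  have "k n * ln (real (l n)) \<le> real n * max (16 / P * X / N0) ((4 / P) * exp (4 / P))"
  \<comment> \<open>Above \<open>4 / P\<close> the constant 2 in
    \<open>P * ln l \<le> 2 + 8 * E / N0\<close> is at most half of the left-hand side and can be
    absorbed.\<close>
  proof (cases "ln (real (l n)) \<ge> 4 / P")
    case True
    then have "4 \<le> P * ln (real (l n))" using P by (simp add: field_simps)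
    moreover have "P * ln (real (l n)) \<le> 2 + 8 * (E / N0)" using lE P by (simp add: field_simps)
    ultimately have "P * ln (real (l n)) \<le> 16 * (E / N0)" by linarith
    then have "ln (real (l n)) \<le> 16 / P * E / N0" using N0 P by (simp add: field_simps)
    then have "k n * ln (real (l n)) \<le> k n * (16 / P * E / N0)" using n c by (intro mult_left_mono) auto
    also have "\<dots> = real n * (16 / P * x / N0)" using n(4) by (simp add: x_def)
    also have "\<dots> \<le> real n * (16 / P * X / N0)"
      using xX P N0 by (intro mult_left_mono divide_right_mono) auto
    finally show ?thesis
      by (rule order_trans) (intro mult_left_mono, auto)
  next
    case False
    \<comment> \<open>Here the energy is not involved: \<open>k n \<le> l n\<close> and
      \<open>l n\<close> itself is bounded.\<close>
    then have "real (l n) \<le> exp (4 / P)" using l by (metis exp_le_cancel_iff exp_ln less_eq_real_def not_le of_nat_0_less_iff order_less_le_trans zero_less_one)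
    then have "k n * ln (real (l n)) \<le> exp (4 / P) * (4 / P)"
      using False kl n c lnl by (intro mult_mono) auto
    also have "\<dots> = (4 / P) * exp (4 / P)" by (rule mult.commute)
    also have "\<dots> \<le> 1 * max (16 / P * X / N0) ((4 / P) * exp (4 / P))"
      unfolding mult_1_left by (rule max.cobounded2)
    also have "\<dots> \<le> real n * max (16 / P * X / N0) ((4 / P) * exp (4 / P))"
      using n(4) P by (intro mult_right_mono) (auto simp: le_max_iff_disj)
    finally show ?thesis .
  qed
  then have "k n * ln (real (l n)) / ln b \<le> real n * max (16 / P * X / N0) ((4 / P) * exp (4 / P)) / ln b"
    using lnb by (intro divide_right_mono) auto
  also have "\<dots> < real n * K"
    using n(4) by (simp add: K_def distrib_left)
  also have "\<dots> \<le> k n * ln (real (l n)) / ln b"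
    using n lnb lnl c by (simp add: log_def abs_of_nonneg)
  finally show False by simp
qed

section \<open>Constructing codes\<close>

text \<open>Shifting the mean by \<open>t * \<sigma>\<^sup>2 * a\<close> multiplies the density by
  the exponential of \<open>t\<close> times the linear statistic, up to a constant. On the
  half-space this factor is at least \<open>exp \<kappa>\<close>, while the shifted measure has mass
  at most 1.\<close>

lemma gauss_chernoff:
  assumes \<sigma>: "\<sigma> > 0" and t: "t \<ge> 0"
  shows "measure (gauss n \<sigma> x) {y \<in> {..<n} \<rightarrow>\<^sub>E UNIV. s \<le> (\<Sum>j<n. a j * y j)}
    \<le> exp (t * (\<Sum>j<n. a j * x j) - t * s + t\<^sup>2 * \<sigma>\<^sup>2 / 2 * (\<Sum>j<n. (a j)\<^sup>2))"
proof -
  let ?P = "gauss n \<sigma> x"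
  define D where "D = {y \<in> {..<n} \<rightarrow>\<^sub>E UNIV. s \<le> (\<Sum>j<n. a j * y j)}"
  define m where "m j = x j + t * \<sigma>\<^sup>2 * a j" for j
  define \<kappa> where "\<kappa> = t * s - t * (\<Sum>j<n. a j * x j) - t\<^sup>2 * \<sigma>\<^sup>2 / 2 * (\<Sum>j<n. (a j)\<^sup>2)"
  interpret P: prob_space ?P by (rule prob_space_gauss[OF \<sigma>])
  interpret Q: prob_space "gauss n \<sigma> m" by (rule prob_space_gauss[OF \<sigma>])
  have D: "D \<in> sets (\<Pi>\<^sub>M j\<in>{..<n}. borel)"
  proof -
    have "{y \<in> space (\<Pi>\<^sub>M j\<in>{..<n}. borel). s \<le> (\<Sum>j<n. a j * y j)} \<in> sets (\<Pi>\<^sub>M j\<in>{..<n}. borel)"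
      by measurable
    then show ?thesis by (simp only: D_def space_PiM space_borel)
  qed
  have llr: "- gauss_llr n \<sigma> x \<sigma> m y = t * (\<Sum>j<n. a j * y j) - t * (\<Sum>j<n. a j * x j) - t\<^sup>2 * \<sigma>\<^sup>2 / 2 * (\<Sum>j<n. (a j)\<^sup>2)" for y
  proof -
    have "- normal_llr (x j) \<sigma> (m j) \<sigma> (y j) = t * (a j * y j) - t * (a j * x j) - t\<^sup>2 * \<sigma>\<^sup>2 / 2 * (a j)\<^sup>2" for j
    proof -
      have "(y j - m j)\<^sup>2 - (y j - x j)\<^sup>2 = (2 * \<sigma>\<^sup>2) * (t * (a j * x j) + t\<^sup>2 * \<sigma>\<^sup>2 / 2 * (a j)\<^sup>2 - t * (a j * y j))"
        by (simp add: m_def power2_eq_square algebra_simps)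
      then have "((y j - m j)\<^sup>2 - (y j - x j)\<^sup>2) / (2 * \<sigma>\<^sup>2) = t * (a j * x j) + t\<^sup>2 * \<sigma>\<^sup>2 / 2 * (a j)\<^sup>2 - t * (a j * y j)"
        using \<sigma> by simp
      then show ?thesis using \<sigma> by (simp add: normal_llr_def diff_divide_distrib)
    qed
    then show ?thesis
      by (simp add: gauss_llr_def sum_subtractf sum_distrib_left flip: sum_negf)
  qed
  have "ennreal (exp \<kappa>) * emeasure ?P D = (\<integral>\<^sup>+y. ennreal (exp \<kappa>) * indicator D y \<partial>?P)"
    using D by (simp add: nn_integral_cmult_indicator)
  also have "\<dots> \<le> (\<integral>\<^sup>+y. ennreal (exp (- gauss_llr n \<sigma> x \<sigma> m y)) * indicator D y \<partial>?P)"
  proof (intro nn_integral_mono)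
    fix y
    show "ennreal (exp \<kappa>) * indicator D y \<le> ennreal (exp (- gauss_llr n \<sigma> x \<sigma> m y)) * indicator D y"
      using t unfolding llr by (auto simp: D_def \<kappa>_def indicator_def intro!: ennreal_leI mult_left_mono)
  qed
  also have "\<dots> = emeasure (gauss n \<sigma> m) D"
    using D by (subst gauss_change_of_measure[OF \<sigma> \<sigma>, symmetric]) (simp add: emeasure_density)
  also have "\<dots> \<le> ennreal 1" using Q.emeasure_le_1 by simp
  finally have "exp \<kappa> * measure ?P D \<le> 1"
    by (simp add: P.emeasure_eq_measure flip: ennreal_mult'')
  then have "measure ?P D \<le> exp (- \<kappa>)"
    by (simp add: exp_minus field_simps)
  then show ?thesis by (simp add: D_def \<kappa>_def algebra_simps)
qed

text \<open>Outputs outside all regions are decoded as the all-silent tuple \<open>W0\<close>. Its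
  preimage is the complement of the other regions, which are finitely many, so the decoder is
  measurable.\<close>

lemma decoder_exists:
  fixes B :: "(nat \<Rightarrow> nat) \<Rightarrow> (nat \<Rightarrow> real) set"
  assumes B: "\<And>W. W \<in> tuples l M \<Longrightarrow> B W \<in> sets (\<Pi>\<^sub>M j\<in>{..<n}. borel)"
    and disj: "disjoint_family_on B (tuples l M)"
  obtains g where "g \<in> (\<Pi>\<^sub>M j\<in>{..<n}. borel) \<rightarrow>\<^sub>M count_space (tuples l M)"
    and "\<And>W. W \<in> tuples l M \<Longrightarrow> B W \<subseteq> decoding_region n g W"
proof -
  let ?T = "tuples l M" and ?S = "\<Pi>\<^sub>M j\<in>{..<n}. (borel :: real measure)"
  define W0 where "W0 = (\<lambda>i\<in>{..<l}. 0 :: nat)"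
  have W0: "W0 \<in> ?T" by (simp add: W0_def)
  define g where "g y = (if \<exists>W\<in>?T. y \<in> B W then THE W. W \<in> ?T \<and> y \<in> B W else W0)" for y
  have gB: "g y = W" if "W \<in> ?T" "y \<in> B W" for y W
  proof -
    have "V = W" if "V \<in> ?T" "y \<in> B V" for V
      using disjoint_family_onD[OF disj that(1) \<open>W \<in> ?T\<close>] that(2) \<open>y \<in> B W\<close> by blast
    then have "(THE W. W \<in> ?T \<and> y \<in> B W) = W"
      using that by (intro the_equality) blast+
    then show ?thesis using that unfolding g_def by (metis (no_types))
  qed
  have g_else: "g y = W0" if "\<not> (\<exists>W\<in>?T. y \<in> B W)" for y
    using that by (simp only: g_def if_False)
  show ?thesis
  proof
    show "g \<in> ?S \<rightarrow>\<^sub>M count_space ?T"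
    proof (subst measurable_count_space_eq2[OF finite_tuples], intro conjI ballI)
      show "g \<in> space ?S \<rightarrow> ?T"
      proof
        fix y show "g y \<in> ?T"
          using gB[of _ y] g_else[of y] W0 by (cases "\<exists>W\<in>?T. y \<in> B W") auto
      qed
      fix W assume W: "W \<in> ?T"
      show "g -` {W} \<inter> space ?S \<in> sets ?S"
      proof (cases "W = W0")
        case False
        have "g -` {W} \<inter> space ?S = B W"
        proof (intro set_eqI iffI)
          fix y assume "y \<in> g -` {W} \<inter> space ?S"
          then have "g y = W" by simp
          then obtain V where "V \<in> ?T" "y \<in> B V" using g_else[of y] False by auto
          then show "y \<in> B W" using gB[of V y] \<open>g y = W\<close> by simp
        next
          fix y assume "y \<in> B W"
          then show "y \<in> g -` {W} \<inter> space ?S" using gB[OF W] sets.sets_into_space[OF B[OF W]] by auto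
        qed
        then show ?thesis using B[OF W] by simp
      next
        case True
        have "g -` {W} \<inter> space ?S = space ?S - (\<Union>V\<in>?T - {W0}. B V)"
        proof (intro set_eqI iffI)
          fix y assume "y \<in> g -` {W} \<inter> space ?S"
          then show "y \<in> space ?S - (\<Union>V\<in>?T - {W0}. B V)" using gB[of _ y] True by auto
        next
          fix y assume y: "y \<in> space ?S - (\<Union>V\<in>?T - {W0}. B V)"
          then have "g y = W0" using gB[of W0 y] W0 g_else[of y] by auto
          then show "y \<in> g -` {W} \<inter> space ?S" using y True by auto
        qed
        also have "\<dots> \<in> sets ?S"
          using finite_tuples[of l M] B by (intro sets.Diff sets.top sets.finite_UN) auto
        finally show ?thesis .
      qed
    qed
    fix W assume W: "W \<in> ?T"
    show "B W \<subseteq> decoding_region n g W"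
      using gB[OF W] sets.sets_into_space[OF B[OF W]] by (auto simp: decoding_region_def space_PiM)
  qed
qed

text \<open>The regions need not cover the space: the decoder only enlarges them, which cannot
  increase the error.\<close>

lemma code_exists:
  fixes B :: "(nat \<Rightarrow> nat) \<Rightarrow> (nat \<Rightarrow> real) set"
  assumes N0: "N0 > 0" and \<alpha>: "0 \<le> \<alpha>" "\<alpha> \<le> 1" and M: "M \<ge> 1" and \<epsilon>: "0 \<le> \<epsilon>" "\<epsilon> < 1"
    and zero: "\<And>i j. i < l \<Longrightarrow> j < n \<Longrightarrow> f i 0 j = 0"
    and energy: "\<And>i w. i < l \<Longrightarrow> w \<le> M \<Longrightarrow> (\<Sum>j<n. (f i w j)\<^sup>2) \<le> E"
    and B: "\<And>W. W \<in> tuples l M \<Longrightarrow> B W \<in> sets (\<Pi>\<^sub>M j\<in>{..<n}. borel)"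
    and disj: "disjoint_family_on B (tuples l M)"
    and err: "(\<Sum>W\<in>tuples l M. tuple_prob (pmf (message_pmf \<alpha> M)) l W *
        (1 - measure (gauss n (sqrt (N0 / 2)) (signal l f W)) (B W))) \<le> \<epsilon>"
  shows "\<exists>g. is_code N0 \<alpha> l n M E \<epsilon> f g"
proof -
  let ?p = "tuple_prob (pmf (message_pmf \<alpha> M)) l" and ?G = "\<lambda>W. gauss n (sqrt (N0 / 2)) (signal l f W)"
  obtain g where g: "g \<in> (\<Pi>\<^sub>M j\<in>{..<n}. borel) \<rightarrow>\<^sub>M count_space (tuples l M)"
    and Bg: "\<And>W. W \<in> tuples l M \<Longrightarrow> B W \<subseteq> decoding_region n g W"
    using decoder_exists[OF B disj] by blast
  have "error_prob N0 \<alpha> l n M f g = (\<Sum>W\<in>tuples l M. ?p W * (1 - measure (?G W) (decoding_region n g W)))"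
    using error_prob_eq[OF N0 \<alpha> M g, of f] sum_tuple_prob[OF sum_pmf_message[OF \<alpha> M], of l]
    by (simp add: right_diff_distrib sum_subtractf)
  also have "\<dots> \<le> (\<Sum>W\<in>tuples l M. ?p W * (1 - measure (?G W) (B W)))"
  proof (intro sum_mono mult_left_mono diff_left_mono)
    fix W assume W: "W \<in> tuples l M"
    interpret prob_space "?G W" using N0 by (intro prob_space_gauss) simp
    show "measure (?G W) (B W) \<le> measure (?G W) (decoding_region n g W)"
      using Bg[OF W] decoding_region_sets[OF g W] by (intro finite_measure_mono) auto
  qed (simp add: tuple_prob_nonneg)
  also note err
  finally show ?thesis
    using M \<epsilon> zero energy g by (auto simp: is_code_def)
qed

text \<open>All users signal in one coordinate, with amplitudes proportional to distinct powers of 2.\<close>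

lemma zero_rate_code:
  assumes N0: "N0 > 0" and \<alpha>: "0 \<le> \<alpha>" "\<alpha> \<le> 1" and \<epsilon>: "0 < \<epsilon>" "\<epsilon> < 1" and n: "n \<ge> 1"
  shows "\<exists>E f g. is_code N0 \<alpha> l n 1 E \<epsilon> f g \<and> E > 0"
proof -
  define \<sigma> where "\<sigma> = sqrt (N0 / 2)"
  have \<sigma>: "\<sigma> > 0" using N0 by (simp add: \<sigma>_def)
  \<comment> \<open>With tilting parameter 1, each of the two tails at distance \<open>A / 2\<close>
    is at most \<open>exp (\<sigma>\<^sup>2 / 2 - A / 2) = \<epsilon> / 2\<close>.\<close>
  define A where "A = \<sigma>\<^sup>2 + 2 * ln (2 / \<epsilon>)"
  have A: "A > 0" using \<epsilon> \<sigma> by (simp add: A_def add_pos_pos)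
  define f where "f i w j = (if w = 1 \<and> j = 0 then A * 2 ^ i else 0)" for i w j :: nat
  define E where "E = A\<^sup>2 * 4 ^ l"
  \<comment> \<open>The integer whose binary digits mark the active users. For \<open>M = 1\<close>
    it determines the tuple, and different integers give amplitudes at least \<open>A\<close>
    apart.\<close>
  define s where "s W = set_encode (active l W)" for W
  define B where "B W = {y \<in> {..<n} \<rightarrow>\<^sub>E (UNIV :: real set). \<bar>y 0 - A * real (s W)\<bar> < A / 2}" for W
  have sum0: "(\<Sum>j<n. h j * of_bool (j = 0)) = h 0" for h :: "nat \<Rightarrow> real"
    using n by (subst sum.remove[of _ 0]) auto
  have signal0: "signal l f W 0 = A * real (s W)" if "W \<in> tuples l 1" for W
  proof -
    have "signal l f W 0 = (\<Sum>i\<in>active l W. A * 2 ^ i)"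
      unfolding signal_def
    proof (rule sum.mono_neutral_cong_right)
      fix i assume "i \<in> active l W"
      then have "W i \<in> {0..1}" "W i \<noteq> 0" using that by (auto simp: active_def PiE_iff)
      then have "W i = 1" by simp
      then show "f i (W i) 0 = A * 2 ^ i" by (simp add: f_def)
    next
      show "\<forall>i\<in>{..<l} - active l W. f i (W i) 0 = 0" by (auto simp: active_def f_def)
    qed (auto simp: active_def)
    then show ?thesis by (simp add: s_def set_encode_def sum_distrib_left)
  qed
  have "\<exists>g. is_code N0 \<alpha> l n 1 E \<epsilon> f g"
  proof (rule code_exists[where B = B, OF N0 \<alpha>])
    show "f i 0 j = 0" for i j by (simp add: f_def)
    show "(\<Sum>j<n. (f i w j)\<^sup>2) \<le> E" if "i < l" "w \<le> 1" for i w
    proof -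
      have "(\<Sum>j<n. (f i w j)\<^sup>2) \<le> (\<Sum>j<n. A\<^sup>2 * 4 ^ i * of_bool (j = 0))"
      proof (rule sum_mono)
        fix j
        have "(2 ^ i)\<^sup>2 = (4 ^ i :: real)" by (simp add: power2_eq_square flip: power_mult_distrib)
        then show "(f i w j)\<^sup>2 \<le> A\<^sup>2 * 4 ^ i * of_bool (j = 0)" by (simp add: f_def power_mult_distrib)
      qed
      also have "\<dots> = A\<^sup>2 * 4 ^ i" by (rule sum0)
      also have "\<dots> \<le> E" unfolding E_def using that by (intro mult_left_mono power_increasing) auto
      finally show ?thesis .
    qed
    show "B W \<in> sets (\<Pi>\<^sub>M j\<in>{..<n}. borel)" for W
    proof -
      have [measurable]: "(\<lambda>y. y 0) \<in> borel_measurable (\<Pi>\<^sub>M j\<in>{..<n}. (borel :: real measure))"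
        by (rule measurable_component_singleton) (use n in auto)
      have "{y \<in> space (\<Pi>\<^sub>M j\<in>{..<n}. borel). \<bar>y 0 - A * real (s W)\<bar> < A / 2} \<in> sets (\<Pi>\<^sub>M j\<in>{..<n}. borel)"
        by measurable
      then show ?thesis by (simp only: B_def space_PiM space_borel)
    qed
    show "disjoint_family_on B (tuples l 1)"
      unfolding disjoint_family_on_def
    proof (intro ballI impI, rule ccontr)
      fix V W assume VW: "V \<in> tuples l 1" "W \<in> tuples l 1" "V \<noteq> W" and "B V \<inter> B W \<noteq> {}"
      then obtain y where "\<bar>y 0 - A * real (s V)\<bar> < A / 2" "\<bar>y 0 - A * real (s W)\<bar> < A / 2"
        by (auto simp: B_def)
      then have "\<bar>A * real (s V) - A * real (s W)\<bar> < A" by linarith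
      then have "A * \<bar>real (s V) - real (s W)\<bar> < A * 1"
        using A by (simp add: abs_mult flip: right_diff_distrib)
      then have "\<bar>real (s V) - real (s W)\<bar> < 1" using A by (subst (asm) mult_less_cancel_left_pos) auto
      then have "s V = s W" by linarith
      then have act: "active l V = active l W"
        unfolding s_def using set_encode_eq[of "active l V" "active l W"] by simp
      have "V i = W i" if "i < l" for i
      proof -
        have "V i \<le> 1" "W i \<le> 1" using VW that by (auto simp: PiE_iff)
        moreover have "V i \<noteq> 0 \<longleftrightarrow> W i \<noteq> 0" using act that by (auto simp: active_def)
        ultimately show ?thesis by linarith
      qed
      then show False using VW by (metis PiE_ext lessThan_iff)
    qed
    have bad: "1 - measure (gauss n \<sigma> (signal l f W)) (B W) \<le> \<epsilon>" if W: "W \<in> tuples l 1" for W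
    proof -
      let ?G = "gauss n \<sigma> (signal l f W)"
      interpret prob_space ?G by (rule prob_space_gauss[OF \<sigma>])
      let ?D = "\<lambda>c. {y \<in> {..<n} \<rightarrow>\<^sub>E UNIV. c * (A * real (s W)) + A / 2 \<le> (\<Sum>j<n. (c * of_bool (j = 0)) * y j)}"
      have sumc: "(\<Sum>j<n. (c * of_bool (j = 0)) * h j) = c * h 0" for c and h :: "nat \<Rightarrow> real"
        using sum0[of "\<lambda>j. c * h j"] by (simp add: mult_ac)
      have D: "measure ?G (?D c) \<le> \<epsilon> / 2" if c: "c * c = 1" for c
      proof -
        have "measure ?G (?D c) \<le> exp (1 * (\<Sum>j<n. (c * of_bool (j = 0)) * signal l f W j) - 1 * (c * (A * real (s W)) + A / 2)
          + 1\<^sup>2 * \<sigma>\<^sup>2 / 2 * (\<Sum>j<n. (c * of_bool (j = 0))\<^sup>2))"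
          by (rule gauss_chernoff[OF \<sigma>]) simp
        also have "(\<Sum>j<n. (c * of_bool (j = 0))\<^sup>2) = 1"
        proof -
          have "(c * of_bool (j = 0))\<^sup>2 = 1 * of_bool (j = 0)" for j :: nat
            using c by (cases "j = 0") (simp_all add: power2_eq_square)
          then show ?thesis using sum0[of "\<lambda>_. 1"] by simp
        qed
        also have "(\<Sum>j<n. (c * of_bool (j = 0)) * signal l f W j) = c * (A * real (s W))"
          unfolding sumc signal0[OF W] ..
        also have "exp (1 * (c * (A * real (s W))) - 1 * (c * (A * real (s W)) + A / 2) + 1\<^sup>2 * \<sigma>\<^sup>2 / 2 * 1) = exp (- ln (2 / \<epsilon>))"
          by (simp add: A_def add_divide_distrib)
        also have "\<dots> = \<epsilon> / 2" using \<epsilon> by (simp add: exp_minus)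
        finally show ?thesis .
      qed
      have Ds: "?D c \<in> sets ?G" for c
      proof -
        have "{y \<in> space (\<Pi>\<^sub>M j\<in>{..<n}. borel). c * (A * real (s W)) + A / 2 \<le> (\<Sum>j<n. (c * of_bool (j = 0)) * y j)}
            \<in> sets (\<Pi>\<^sub>M j\<in>{..<n}. borel)"
          by measurable
        then show ?thesis by (simp only: sets_gauss space_PiM space_borel)
      qed
      have Bs: "B W \<in> sets ?G" using \<open>\<And>W. B W \<in> sets (\<Pi>\<^sub>M j\<in>{..<n}. borel)\<close> by simp
      have sub: "space ?G - B W \<subseteq> ?D 1 \<union> ?D (-1)"
      proof
        fix y assume "y \<in> space ?G - B W"
        then have y: "y \<in> {..<n} \<rightarrow>\<^sub>E UNIV" and "\<not> \<bar>y 0 - A * real (s W)\<bar> < A / 2"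
          by (simp_all add: B_def)
        then have "1 * (A * real (s W)) + A / 2 \<le> 1 * y 0 \<or> -1 * (A * real (s W)) + A / 2 \<le> -1 * y 0"
          unfolding abs_less_iff by linarith
        then show "y \<in> ?D 1 \<union> ?D (-1)" using y unfolding Un_iff mem_Collect_eq sumc by blast
      qed
      have "1 - measure ?G (B W) = measure ?G (space ?G - B W)" using prob_compl[OF Bs] by simp
      also have "\<dots> \<le> measure ?G (?D 1 \<union> ?D (-1))"
        by (rule finite_measure_mono[OF sub sets.Un[OF Ds Ds]])
      also have "\<dots> \<le> measure ?G (?D 1) + measure ?G (?D (-1))"
        by (rule measure_Un_le[OF Ds Ds])
      also have "\<dots> \<le> \<epsilon> / 2 + \<epsilon> / 2" by (intro add_mono D) simp_all
      also have "\<dots> = \<epsilon>" by simp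
      finally show ?thesis .
    qed
    have "(\<Sum>W\<in>tuples l 1. tuple_prob (pmf (message_pmf \<alpha> 1)) l W * (1 - measure (gauss n \<sigma> (signal l f W)) (B W)))
      \<le> (\<Sum>W\<in>tuples l 1. tuple_prob (pmf (message_pmf \<alpha> 1)) l W * \<epsilon>)"
      using \<alpha> bad by (intro sum_mono mult_left_mono) auto
    also have "\<dots> = \<epsilon>"
      unfolding sum_distrib_right[symmetric] using sum_tuple_prob[OF sum_pmf_message[OF \<alpha>], of 1 l] by simp
    finally show "(\<Sum>W\<in>tuples l 1. tuple_prob (pmf (message_pmf \<alpha> 1)) l W * (1 - measure (gauss n (sqrt (N0 / 2)) (signal l f W)) (B W))) \<le> \<epsilon>"
      by (simp add: \<sigma>_def)
  qed (use \<epsilon> in auto)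
  moreover have "E > 0" using A by (simp add: E_def)
  ultimately show ?thesis by blast
qed

text \<open>The sub-Gaussian bound for a fair sign. The Taylor series are compared term by term,
  using \<open>2 ^ k * fact k \<le> fact (2 * k)\<close>.\<close>

lemma cosh_le_exp_square: "cosh (s :: real) \<le> exp (s\<^sup>2 / 2)"
proof -
  let ?c = "\<lambda>n. if even n then s ^ n / fact n else 0"
  have "(\<lambda>n. if even n then s ^ n /\<^sub>R fact n else 0) = ?c"
    by (rule ext) (simp add: divide_inverse_commute)
  then have c0: "?c sums cosh s"
    using cosh_converges[of s] by simp
  have sm: "strict_mono (\<lambda>k::nat. 2 * k)" by (auto simp: strict_mono_def)
  have z: "?c n = 0" if "n \<notin> range (\<lambda>k. 2 * k)" for n
  proof -
    have "odd n" using that by (auto elim!: evenE)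
    then show ?thesis by simp
  qed
  have c: "(\<lambda>k. ?c (2 * k)) sums cosh s"
    by (rule iffD2[OF sums_mono_reindex[OF sm, where f = ?c], OF z c0])
  have e: "(\<lambda>k. (s\<^sup>2 / 2) ^ k / fact k) sums exp (s\<^sup>2 / 2)"
    using exp_converges[of "s\<^sup>2 / 2"] by (simp only: real_scaleR_def divide_inverse_commute)
  have fact: "(2 ^ k * fact k :: real) \<le> fact (2 * k)" for k
  proof (induction k)
    case (Suc k)
    have "(2 ^ Suc k * fact (Suc k) :: real) = (2 * (1 + real k)) * (2 ^ k * fact k)" by simp
    also have "\<dots> \<le> (2 * (1 + real k)) * fact (2 * k)" using Suc by (intro mult_left_mono) auto
    also have "\<dots> \<le> (2 * (1 + real k)) * ((1 + 2 * real k) * fact (2 * k))"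
      by (intro mult_left_mono) (simp_all add: mult_ge1_I fact_ge_zero algebra_simps)
    also have "\<dots> = fact (2 * Suc k)" by (simp add: algebra_simps)
    finally show ?case .
  qed simp
  show ?thesis
  proof (rule sums_le[OF _ c e])
    fix k
    have "?c (2 * k) = (s\<^sup>2) ^ k / fact (2 * k)" by (simp only: power_mult even_mult_iff even_numeral simp_thms if_True)
    also have "\<dots> \<le> (s\<^sup>2) ^ k / (2 ^ k * fact k)"
      by (intro divide_left_mono fact) auto
    also have "\<dots> = (s\<^sup>2 / 2) ^ k / fact k" by (simp only: power_divide divide_divide_eq_left)
    finally show "?c (2 * k) \<le> (s\<^sup>2 / 2) ^ k / fact k" .
  qed
qed

section \<open>Random signs and matched filters\<close>

text \<open>Multiplying the rows in \<open>U\<close> by the row \<open>u\<close> is an involution of the sign matrices that makes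
  all the products independent signs.\<close>

lemma rademacher_mgf:
  fixes I :: "'a set" and s :: real and n :: nat
  assumes I: "finite I" and u: "u \<in> I" and U: "U \<subseteq> I - {u}"
  defines "\<Omega> \<equiv> (I \<times> {..<n}) \<rightarrow>\<^sub>E {- 1, 1 :: real}"
  shows "(\<Sum>X\<in>\<Omega>. exp (s * (\<Sum>v\<in>U. \<Sum>j<n. X (v, j) * X (u, j))))
    \<le> real (card \<Omega>) * exp (s\<^sup>2 * (real n * real (card U)) / 2)"
proof -
  let ?Z = "I \<times> {..<n}"
  have fU: "finite U" "U \<subseteq> I" "u \<notin> U" using I U finite_subset by auto
  have Xsq: "X z * X z = 1" if "X \<in> \<Omega>" "z \<in> ?Z" for X z
  proof -
    have "X z \<in> {- 1, 1}" using that unfolding \<Omega>_def by (rule PiE_mem)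
    then show ?thesis by auto
  qed
  define \<phi> :: "('a \<times> nat \<Rightarrow> real) \<Rightarrow> 'a \<times> nat \<Rightarrow> real"
    where "\<phi> X = (\<lambda>z\<in>?Z. if fst z \<in> U then X z * X (u, snd z) else X z)" for X
  have \<phi>: "\<phi> X \<in> \<Omega>" if "X \<in> \<Omega>" for X
    unfolding \<Omega>_def
  proof (rule PiE_I)
    fix z assume z: "z \<in> ?Z"
    then have "(u, snd z) \<in> ?Z" using u by auto
    then have "X z \<in> {- 1, 1}" "X (u, snd z) \<in> {- 1, 1}" using that z unfolding \<Omega>_def by (blast dest: PiE_mem)+
    then show "\<phi> X z \<in> {- 1, 1}" using z by (auto simp: \<phi>_def)
  qed (simp add: \<phi>_def)
  have \<phi>\<phi>: "\<phi> (\<phi> X) = X" if "X \<in> \<Omega>" for X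
  proof
    fix z show "\<phi> (\<phi> X) z = X z"
    proof (cases "z \<in> ?Z")
      case True
      then have uz: "(u, snd z) \<in> ?Z" using u by auto
      have "\<phi> (\<phi> X) (v, j) = X (v, j)" if z: "z = (v, j)" for v j
      proof (cases "v \<in> U")
        case True
        have "\<phi> (\<phi> X) (v, j) = \<phi> X (v, j) * \<phi> X (u, j)"
          using True \<open>z \<in> ?Z\<close> unfolding z \<phi>_def[of "\<phi> X"] by simp
        also have "\<phi> X (u, j) = X (u, j)" using uz fU(3) unfolding z \<phi>_def by simp
        also have "\<phi> X (v, j) = X (v, j) * X (u, j)" using True \<open>z \<in> ?Z\<close> unfolding z \<phi>_def by simp
        also have "X (v, j) * X (u, j) * X (u, j) = X (v, j)"
          using Xsq[OF \<open>X \<in> \<Omega>\<close> uz] unfolding z by (simp add: mult.assoc)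
        finally show ?thesis .
      next
        case False
        then show ?thesis using \<open>z \<in> ?Z\<close> unfolding z \<phi>_def by simp
      qed
      then show ?thesis by (cases z) simp
    next
      case False
      moreover have "X z = undefined" using \<open>X \<in> \<Omega>\<close> False unfolding \<Omega>_def by (rule PiE_arb)
      ultimately show ?thesis unfolding \<phi>_def restrict_apply by (simp only: if_False)
    qed
  qed
  have prod: "exp (s * (\<Sum>v\<in>U. \<Sum>j<n. X (v, j))) = (\<Prod>z\<in>?Z. if fst z \<in> U then exp (s * X z) else 1)" for X :: "'a \<times> nat \<Rightarrow> real"
  proof -
    have "s * (\<Sum>v\<in>U. \<Sum>j<n. X (v, j)) = (\<Sum>z\<in>U \<times> {..<n}. s * X z)"
      by (simp add: sum.cartesian_product sum_distrib_left)
    then have "exp (s * (\<Sum>v\<in>U. \<Sum>j<n. X (v, j))) = (\<Prod>z\<in>U \<times> {..<n}. exp (s * X z))"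
      using fU by (simp add: exp_sum)
    also have "\<dots> = (\<Prod>z\<in>?Z. if fst z \<in> U then exp (s * X z) else 1)"
      using I fU by (intro prod.mono_neutral_cong_left) auto
    finally show ?thesis .
  qed
  have "(\<Sum>X\<in>\<Omega>. exp (s * (\<Sum>v\<in>U. \<Sum>j<n. X (v, j) * X (u, j)))) = (\<Sum>X\<in>\<Omega>. exp (s * (\<Sum>v\<in>U. \<Sum>j<n. X (v, j))))"
  proof (rule sum.reindex_bij_witness[where i = \<phi> and j = \<phi>])
    fix X assume "X \<in> \<Omega>"
    have "\<phi> X (v, j) = X (v, j) * X (u, j)" if "v \<in> U" "j < n" for v j
      using that fU by (auto simp: \<phi>_def)
    then show "exp (s * (\<Sum>v\<in>U. \<Sum>j<n. \<phi> X (v, j))) = exp (s * (\<Sum>v\<in>U. \<Sum>j<n. X (v, j) * X (u, j)))"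
      by simp
  qed (simp_all add: \<phi> \<phi>\<phi>)
  \<comment> \<open>The exponent is now linear in the signs, so the sum over sign matrices factors;
    each entry in \<open>U\<close> contributes \<open>2 * cosh s\<close>.\<close>
  also have "\<dots> = (\<Prod>z\<in>?Z. \<Sum>a\<in>{- 1, 1}. if fst z \<in> U then exp (s * a) else 1)"
    unfolding prod \<Omega>_def using I by (subst prod_sum_PiE) auto
  also have "\<dots> \<le> (\<Prod>z\<in>?Z. 2 * (if fst z \<in> U then exp (s\<^sup>2 / 2) else 1))"
    using cosh_le_exp_square[of s] by (intro prod_mono) (auto simp: cosh_def)
  also have "\<dots> = 2 ^ card ?Z * (\<Prod>z\<in>U \<times> {..<n}. exp (s\<^sup>2 / 2))"
  proof -
    have "(\<Prod>z\<in>U \<times> {..<n}. exp (s\<^sup>2 / 2)) = (\<Prod>z\<in>?Z. if fst z \<in> U then exp (s\<^sup>2 / 2) else 1)"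
      using I fU by (intro prod.mono_neutral_cong_left) auto
    then show ?thesis by (simp add: prod.distrib)
  qed
  also have "(\<Prod>z\<in>U \<times> {..<n}. exp (s\<^sup>2 / 2)) = exp (s\<^sup>2 * (real n * real (card U)) / 2)"
    by (simp add: card_cartesian_product exp_of_nat_mult[symmetric] mult_ac)
  also have "2 ^ card ?Z = real (card \<Omega>)"
    unfolding \<Omega>_def using I by (subst card_PiE) (auto simp: card_insert_if)
  finally show ?thesis .
qed

text \<open>With sign coordinates every nonzero message has energy exactly \<open>E\<close>,
  whatever the draw, so no codeword has to be discarded for violating the energy constraint.\<close>

definition sign_code :: "nat \<Rightarrow> nat \<Rightarrow> real \<Rightarrow> ((nat \<times> nat) \<times> nat \<Rightarrow> real) \<Rightarrow> nat \<Rightarrow> nat \<Rightarrow> nat \<Rightarrow> real" where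
  "sign_code n M E X i w j = (if w \<in> {1..M} then sqrt (E / real n) * X ((i, w), j) else 0)"

definition signs :: "nat \<Rightarrow> nat \<Rightarrow> nat \<Rightarrow> ((nat \<times> nat) \<times> nat \<Rightarrow> real) set" where
  "signs l M n = (({..<l} \<times> {1..M}) \<times> {..<n}) \<rightarrow>\<^sub>E {- 1, 1}"

text \<open>Only the codeword under test is removed. If user \<open>i\<close> sends a message other
  than \<open>w\<close>, its own codeword interferes with the test of \<open>w\<close>.\<close>

definition interferers :: "nat \<Rightarrow> (nat \<Rightarrow> nat) \<Rightarrow> nat \<Rightarrow> nat \<Rightarrow> (nat \<times> nat) set" where
  "interferers l W i w = (\<lambda>i. (i, W i)) ` active l W - {(i, w)}"

lemma card_interferers: "card (interferers l W i w) \<le> card (active l W)"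
  unfolding interferers_def by (rule order_trans[OF card_Diff1_le card_image_le]) simp

lemma signs_square:
  assumes "X \<in> signs l M n" "i < l" "w \<in> {1..M}" "j < n"
  shows "X ((i, w), j) * X ((i, w), j) = 1"
proof -
  have "X ((i, w), j) \<in> {- 1, 1}"
    using assms unfolding signs_def by (intro PiE_mem[of X]) auto
  then show ?thesis by auto
qed

lemma sign_code_energy:
  assumes "X \<in> signs l M n" "i < l" "w \<in> {1..M}" "E \<ge> 0" "n \<ge> 1"
  shows "(\<Sum>j<n. (sign_code n M E X i w j)\<^sup>2) = E"
proof -
  have "(\<Sum>j<n. (sign_code n M E X i w j)\<^sup>2) = (\<Sum>j<n. E / real n)"
  proof (rule sum.cong[OF refl])
    fix j assume "j \<in> {..<n}"
    then have "(X ((i, w), j))\<^sup>2 = 1" using signs_square[OF assms(1-3), of j] by (simp add: power2_eq_square)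
    then show "(sign_code n M E X i w j)\<^sup>2 = E / real n"
      using assms by (simp add: sign_code_def power_mult_distrib)
  qed
  then show ?thesis using assms by simp
qed

text \<open>The codeword under test contributes exactly \<open>E\<close>, because signs square to 1.
  What remains are products with other rows, the form treated by
  \<open>rademacher_mgf\<close>.\<close>

lemma sign_code_inner:
  assumes X: "X \<in> signs l M n" and W: "W \<in> tuples l M" and i: "i < l" "w \<in> {1..M}" and E: "E \<ge> 0" and n: "n \<ge> 1"
  shows "(\<Sum>j<n. sign_code n M E X i w j * signal l (sign_code n M E X) W j) =
    (if W i = w then E else 0) + E / real n * (\<Sum>v\<in>interferers l W i w. \<Sum>j<n. X (v, j) * X ((i, w), j))"
proof -
  define S where "S = (\<lambda>i. (i, W i)) ` active l W"
  have S: "finite S" by (simp add: S_def)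
  define c where "c = sqrt (E / real n)"
  have cc: "c * c = E / real n" using E by (simp add: c_def)
  have sgn: "signal l (sign_code n M E X) W j = c * (\<Sum>v\<in>S. X (v, j))" for j
  proof -
    have "signal l (sign_code n M E X) W j = (\<Sum>i\<in>active l W. c * X ((i, W i), j))"
      unfolding signal_def using W
      by (intro sum.mono_neutral_cong_right) (auto simp: active_def sign_code_def c_def PiE_iff Suc_le_eq)
    also have "\<dots> = c * (\<Sum>v\<in>S. X (v, j))"
      unfolding S_def by (subst sum.reindex) (auto simp: inj_on_def sum_distrib_left)
    finally show ?thesis .
  qed
  have "(\<Sum>j<n. sign_code n M E X i w j * signal l (sign_code n M E X) W j) =
      (\<Sum>j<n. c * c * (\<Sum>v\<in>S. X (v, j) * X ((i, w), j)))"
  proof (intro sum.cong refl)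
    fix j
    have "sign_code n M E X i w j = c * X ((i, w), j)" using i by (simp add: sign_code_def c_def)
    then have "sign_code n M E X i w j * signal l (sign_code n M E X) W j = c * c * ((\<Sum>v\<in>S. X (v, j)) * X ((i, w), j))"
      unfolding sgn by (simp only: mult_ac)
    then show "sign_code n M E X i w j * signal l (sign_code n M E X) W j = c * c * (\<Sum>v\<in>S. X (v, j) * X ((i, w), j))"
      by (simp only: sum_distrib_right)
  qed
  also have "\<dots> = E / real n * (\<Sum>v\<in>S. \<Sum>j<n. X (v, j) * X ((i, w), j))"
    unfolding cc sum_distrib_left[symmetric] by (subst sum.swap) (rule refl)
  also have "\<dots> = (if W i = w then E else 0) + E / real n * (\<Sum>v\<in>interferers l W i w. \<Sum>j<n. X (v, j) * X ((i, w), j))"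
  proof (cases "W i = w")
    case True
    then have "(i, w) \<in> S" using i by (auto simp: S_def active_def)
    then have "(\<Sum>v\<in>S. \<Sum>j<n. X (v, j) * X ((i, w), j)) =
        (\<Sum>j<n. X ((i, w), j) * X ((i, w), j)) + (\<Sum>v\<in>interferers l W i w. \<Sum>j<n. X (v, j) * X ((i, w), j))"
      unfolding interferers_def S_def[symmetric] by (rule sum.remove[OF S])
    also have "(\<Sum>j<n. X ((i, w), j) * X ((i, w), j)) = real n"
      using signs_square[OF X i] by simp
    finally show ?thesis using True n by (simp add: distrib_left)
  next
    case False
    then have "(i, w) \<notin> S" by (auto simp: S_def)
    then show ?thesis using False by (simp add: interferers_def flip: S_def)
  qed
  finally show ?thesis .
qed

text \<open>Separate tests make the error a union over \<open>l * M\<close> pairs of user and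
  message instead of over all alternative tuples.\<close>

definition filter_region :: "nat \<Rightarrow> nat \<Rightarrow> nat \<Rightarrow> (nat \<Rightarrow> nat \<Rightarrow> nat \<Rightarrow> real) \<Rightarrow> real \<Rightarrow> (nat \<Rightarrow> nat) \<Rightarrow> (nat \<Rightarrow> real) set" where
  "filter_region l M n f \<theta> W = {y \<in> {..<n} \<rightarrow>\<^sub>E UNIV.
     \<forall>i\<in>{..<l}. \<forall>w\<in>{1..M}. (\<Sum>j<n. f i w j * y j) > \<theta> \<longleftrightarrow> W i = w}"

lemma filter_region_sets: "filter_region l M n f \<theta> W \<in> sets (\<Pi>\<^sub>M j\<in>{..<n}. borel)"
proof -
  have "{y \<in> space (\<Pi>\<^sub>M j\<in>{..<n}. borel). \<forall>i\<in>{..<l}. \<forall>w\<in>{1..M}. (\<Sum>j<n. f i w j * y j) > \<theta> \<longleftrightarrow> W i = w}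
      \<in> sets (\<Pi>\<^sub>M j\<in>{..<n}. borel)"
    by measurable
  then show ?thesis by (simp only: filter_region_def space_PiM space_borel)
qed

lemma disjoint_filter_region: "disjoint_family_on (filter_region l M n f \<theta>) (tuples l M)"
  unfolding disjoint_family_on_def
proof (intro ballI impI, rule ccontr)
  fix V W assume VW: "V \<in> tuples l M" "W \<in> tuples l M" "V \<noteq> W"
    and "filter_region l M n f \<theta> V \<inter> filter_region l M n f \<theta> W \<noteq> {}"
  then obtain y where y: "y \<in> filter_region l M n f \<theta> V" "y \<in> filter_region l M n f \<theta> W" by blast
  have "V i = W i" if "i < l" for i
  proof -
    have eq: "V i = w \<longleftrightarrow> W i = w" if "w \<in> {1..M}" for w
      using y \<open>i < l\<close> that unfolding filter_region_def by blast
    have "V i \<le> M" "W i \<le> M" using VW that by (auto simp: PiE_iff)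
    then show ?thesis
      using eq[of "V i"] eq[of "W i"] by (cases "V i = 0"; cases "W i = 0") auto
  qed
  then show False using VW by (metis PiE_ext lessThan_iff)
qed

text \<open>Union bound over all tests. Misses and false alarms lie at different distances from the
  threshold, hence the two tilting parameters \<open>s\<close> and \<open>t\<close>.\<close>

lemma filter_region_miss:
  assumes \<sigma>: "\<sigma> > 0" and st: "s \<ge> 0" "t \<ge> 0"
    and E: "\<And>i w. i < l \<Longrightarrow> w \<in> {1..M} \<Longrightarrow> (\<Sum>j<n. (f i w j)\<^sup>2) = E"
  shows "1 - measure (gauss n \<sigma> x) (filter_region l M n f \<theta> W) \<le>
    (\<Sum>(i, w)\<in>{..<l} \<times> {1..M}. if W i = w then exp (s * (\<theta> - (\<Sum>j<n. f i w j * x j)) + s\<^sup>2 * \<sigma>\<^sup>2 / 2 * E)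
       else exp (t * ((\<Sum>j<n. f i w j * x j) - \<theta>) + t\<^sup>2 * \<sigma>\<^sup>2 / 2 * E))"
proof -
  let ?G = "gauss n \<sigma> x" and ?B = "filter_region l M n f \<theta> W"
  interpret prob_space ?G by (rule prob_space_gauss[OF \<sigma>])
  define D where "D i w = (if W i = w then {y \<in> {..<n} \<rightarrow>\<^sub>E (UNIV :: real set). - \<theta> \<le> (\<Sum>j<n. (- f i w j) * y j)}
     else {y \<in> {..<n} \<rightarrow>\<^sub>E UNIV. \<theta> \<le> (\<Sum>j<n. f i w j * y j)})" for i w
  have D_sets: "D i w \<in> sets ?G" for i w
  proof -
    have "{y \<in> space (\<Pi>\<^sub>M j\<in>{..<n}. borel). c \<le> (\<Sum>j<n. a j * y j)} \<in> sets (\<Pi>\<^sub>M j\<in>{..<n}. borel)" for c and a :: "nat \<Rightarrow> real"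
      by measurable
    then show ?thesis unfolding D_def sets_gauss
      by (cases "W i = w") (simp_all only: if_True if_False simp_thms space_PiM space_borel)
  qed
  have D_bound: "measure ?G (D i w) \<le> (if W i = w then exp (s * (\<theta> - (\<Sum>j<n. f i w j * x j)) + s\<^sup>2 * \<sigma>\<^sup>2 / 2 * E)
       else exp (t * ((\<Sum>j<n. f i w j * x j) - \<theta>) + t\<^sup>2 * \<sigma>\<^sup>2 / 2 * E))" if "i < l" "w \<in> {1..M}" for i w
  proof (cases "W i = w")
    case True
    then show ?thesis
      using gauss_chernoff[OF \<sigma> st(1), of n x "- \<theta>" "\<lambda>j. - f i w j"] E[OF that]
      by (simp add: D_def sum_negf algebra_simps)
  next
    case False
    then show ?thesis
      using gauss_chernoff[OF \<sigma> st(2), of n x \<theta> "f i w"] E[OF that]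
      by (simp add: D_def algebra_simps)
  qed
  have sub: "space ?G - ?B \<subseteq> (\<Union>(i, w)\<in>{..<l} \<times> {1..M}. D i w)"
  proof
    fix y assume y: "y \<in> space ?G - ?B"
    then have "\<not> (\<forall>i\<in>{..<l}. \<forall>w\<in>{1..M}. (\<Sum>j<n. f i w j * y j) > \<theta> \<longleftrightarrow> W i = w)"
      by (simp add: filter_region_def)
    then obtain i w where iw: "i \<in> {..<l}" "w \<in> {1..M}" "\<not> ((\<Sum>j<n. f i w j * y j) > \<theta> \<longleftrightarrow> W i = w)"
      by blast
    then have "y \<in> D i w" using y by (cases "W i = w") (auto simp: D_def sum_negf)
    then show "y \<in> (\<Union>(i, w)\<in>{..<l} \<times> {1..M}. D i w)" using iw by blast
  qed
  have "1 - measure ?G ?B = measure ?G (space ?G - ?B)"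
    using filter_region_sets by (intro prob_compl[symmetric]) simp
  also have "\<dots> \<le> measure ?G (\<Union>(i, w)\<in>{..<l} \<times> {1..M}. D i w)"
    using D_sets by (intro finite_measure_mono[OF sub] sets.finite_UN) auto
  also have "\<dots> \<le> (\<Sum>(i, w)\<in>{..<l} \<times> {1..M}. measure ?G (D i w))"
    using measure_UNION_le[of "{..<l} \<times> {1..M}" "\<lambda>(i, w). D i w" ?G] D_sets by (simp add: case_prod_unfold)
  also have "\<dots> \<le> (\<Sum>(i, w)\<in>{..<l} \<times> {1..M}. if W i = w then exp (s * (\<theta> - (\<Sum>j<n. f i w j * x j)) + s\<^sup>2 * \<sigma>\<^sup>2 / 2 * E)
       else exp (t * ((\<Sum>j<n. f i w j * x j) - \<theta>) + t\<^sup>2 * \<sigma>\<^sup>2 / 2 * E))"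
    using D_bound by (intro sum_mono) auto
  finally show ?thesis .
qed

text \<open>On average over the signs, the interference of at most \<open>a\<close> active users
  obeys the same exponential bound as extra Gaussian noise of variance \<open>a * E / n\<close> per
  coordinate.\<close>

lemma sum_signs_exp_le:
  assumes W: "W \<in> tuples l M" and act: "real (card (active l W)) \<le> a" and i: "i < l" "w \<in> {1..M}" and n: "n \<ge> 1"
  shows "(\<Sum>X\<in>signs l M n. exp (c * (E / real n * (\<Sum>v\<in>interferers l W i w. \<Sum>j<n. X (v, j) * X ((i, w), j)))))
    \<le> real (card (signs l M n)) * exp (c\<^sup>2 / 2 * (E * (a * E / real n)))"
proof -
  let ?I = "{..<l} \<times> {1..M}" and ?U = "interferers l W i w"
  have U: "?U \<subseteq> ?I - {(i, w)}"
    using W by (auto simp: interferers_def active_def PiE_iff Suc_le_eq)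
  have "(\<Sum>X\<in>signs l M n. exp (c * E / real n * (\<Sum>v\<in>?U. \<Sum>j<n. X (v, j) * X ((i, w), j))))
     \<le> real (card (signs l M n)) * exp ((c * E / real n)\<^sup>2 * (real n * real (card ?U)) / 2)"
    unfolding signs_def by (rule rademacher_mgf[OF _ _ U]) (use i in auto)
  also have "\<dots> \<le> real (card (signs l M n)) * exp (c\<^sup>2 / 2 * (E * (a * E / real n)))"
  proof -
    have "real (card ?U) \<le> a" using card_interferers[of l W i w] act by linarith
    then have "(c * E)\<^sup>2 / real n / 2 * real (card ?U) \<le> (c * E)\<^sup>2 / real n / 2 * a"
      by (intro mult_left_mono) auto
    moreover have "(c * E / real n)\<^sup>2 * (real n * real (card ?U)) / 2 = (c * E)\<^sup>2 / real n / 2 * real (card ?U)"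
      using n by (simp add: power2_eq_square)
    moreover have "(c * E)\<^sup>2 / real n / 2 * a = c\<^sup>2 / 2 * (E * (a * E / real n))"
      by (simp add: power2_eq_square mult_ac)
    ultimately show ?thesis by (intro mult_left_mono) auto
  qed
  finally show ?thesis by (simp add: mult.assoc)
qed

lemma chernoff_exponent:
  fixes d v :: real
  assumes "v > 0"
  shows "- (d / v * d) + (d / v)\<^sup>2 / 2 * v = - d\<^sup>2 / (2 * v)"
  using assms by (simp add: power2_eq_square)

text \<open>Some sign matrix is no worse than the average over all of them. \<open>v\<close> is the
  variance of the noise in a correlation plus that of the simulated interference noise; tuples with
  more than \<open>a\<close> active users are written off as errors.\<close>

lemma random_code_exists:
  assumes N0: "N0 > 0" and \<alpha>: "0 \<le> \<alpha>" "\<alpha> \<le> 1" and M: "M \<ge> 1" and \<epsilon>: "0 \<le> \<epsilon>" "\<epsilon> < 1"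
    and n: "n \<ge> 1" and E: "E > 0" and a: "a \<ge> 0" and \<theta>: "0 < \<theta>" "\<theta> < E"
  defines "v \<equiv> E * (N0 / 2 + a * E / real n)"
  assumes budget: "(\<Sum>W | W \<in> tuples l M \<and> real (card (active l W)) > a. tuple_prob (pmf (message_pmf \<alpha> M)) l W)
     + (real l * real M * exp (- \<theta>\<^sup>2 / (2 * v)) + real l * exp (- (E - \<theta>)\<^sup>2 / (2 * v))) \<le> \<epsilon>"
  shows "\<exists>f g. is_code N0 \<alpha> l n M E \<epsilon> f g"
proof -
  let ?T = "tuples l M" and ?p = "tuple_prob (pmf (message_pmf \<alpha> M)) l" and ?\<Omega> = "signs l M n"
  define \<sigma> where "\<sigma> = sqrt (N0 / 2)"
  have \<sigma>: "\<sigma> > 0" "\<sigma>\<^sup>2 = N0 / 2" using N0 by (simp_all add: \<sigma>_def)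
  have v: "v > 0" unfolding v_def using N0 E a n by (intro mult_pos_pos add_pos_nonneg) auto
  \<comment> \<open>\<open>s\<close> and \<open>t\<close> minimise the Chernoff exponents: distance
    to the threshold over variance.\<close>
  define s where "s = (E - \<theta>) / v"
  define t where "t = \<theta> / v"
  have st: "s \<ge> 0" "t \<ge> 0" using \<theta> v by (simp_all add: s_def t_def)
  define \<beta>1 where "\<beta>1 = exp (- (E - \<theta>)\<^sup>2 / (2 * v))"
  define \<beta>2 where "\<beta>2 = exp (- \<theta>\<^sup>2 / (2 * v))"
  define Bad where "Bad = {W. W \<in> ?T \<and> real (card (active l W)) > a}"
  have Bad: "Bad \<subseteq> ?T" by (auto simp: Bad_def)
  define \<beta> where "\<beta> = real l * real M * \<beta>2 + real l * \<beta>1"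
  have \<Omega>: "finite ?\<Omega>" unfolding signs_def by (intro finite_PiE) auto
  have \<Omega>_card: "card ?\<Omega> > 0" unfolding signs_def by (subst card_PiE) (auto intro!: prod_pos)
  define r where "r X W i w = (\<Sum>j<n. sign_code n M E X i w j * signal l (sign_code n M E X) W j)" for X W i w
  define h where "h X W = (\<lambda>(i, w). if W i = w then exp (s * (\<theta> - r X W i w) + s\<^sup>2 * \<sigma>\<^sup>2 / 2 * E)
       else exp (t * (r X W i w - \<theta>) + t\<^sup>2 * \<sigma>\<^sup>2 / 2 * E))" for X W
  define err where "err X W = 1 - measure (gauss n \<sigma> (signal l (sign_code n M E X) W)) (filter_region l M n (sign_code n M E X) \<theta> W)" for X W
  have err_le: "err X W \<le> (\<Sum>x\<in>{..<l} \<times> {1..M}. h X W x)" if "X \<in> ?\<Omega>" for X W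
    unfolding err_def h_def r_def
    by (rule filter_region_miss[OF \<sigma>(1) st sign_code_energy[OF that _ _ _ n]]) (use E in auto)
  have err_le_1: "err X W \<le> 1" for X W by (simp add: err_def)
  have mean_h: "(\<Sum>X\<in>?\<Omega>. h X W (i, w)) \<le> real (card ?\<Omega>) * (if W i = w then \<beta>1 else \<beta>2)"
    if W: "W \<in> ?T - Bad" and iw: "i < l" "w \<in> {1..M}" for W i w
  proof -
    have WT: "W \<in> ?T" using W by (rule DiffD1)
    have act: "real (card (active l W)) \<le> a"
    proof (rule ccontr)
      assume "\<not> real (card (active l W)) \<le> a"
      then have "W \<in> Bad" using WT unfolding Bad_def by simp
      then show False using W by blast
    qed
    define R where "R X = E / real n * (\<Sum>u\<in>interferers l W i w. \<Sum>j<n. X (u, j) * X ((i, w), j))" for X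
    have r: "r X W i w = (if W i = w then E else 0) + R X" if "X \<in> ?\<Omega>" for X
      unfolding r_def R_def by (rule sign_code_inner[OF that WT iw _ n]) (use E in auto)
    have R: "(\<Sum>X\<in>?\<Omega>. exp (c * R X)) \<le> real (card ?\<Omega>) * exp (c\<^sup>2 / 2 * (E * (a * E / real n)))" for c
      unfolding R_def by (rule sum_signs_exp_le[OF WT act iw n])
    have vs: "c\<^sup>2 * \<sigma>\<^sup>2 / 2 * E + c\<^sup>2 / 2 * (E * (a * E / real n)) = c\<^sup>2 / 2 * v" for c
      by (simp add: v_def \<sigma>(2) algebra_simps)
    show ?thesis
    proof (cases "W i = w")
      case True
      have "(\<Sum>X\<in>?\<Omega>. h X W (i, w)) = (\<Sum>X\<in>?\<Omega>. exp (- (s * (E - \<theta>)) + s\<^sup>2 * \<sigma>\<^sup>2 / 2 * E) * exp ((- s) * R X))"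
      proof (rule sum.cong[OF refl])
        fix X assume X: "X \<in> ?\<Omega>"
        have eq: "s * (\<theta> - (E + R X)) + s\<^sup>2 * \<sigma>\<^sup>2 / 2 * E = (- (s * (E - \<theta>)) + s\<^sup>2 * \<sigma>\<^sup>2 / 2 * E) + (- s) * R X"
          by (simp add: algebra_simps)
        have "h X W (i, w) = exp (s * (\<theta> - (E + R X)) + s\<^sup>2 * \<sigma>\<^sup>2 / 2 * E)"
          using True by (simp add: h_def r[OF X])
        then show "h X W (i, w) = exp (- (s * (E - \<theta>)) + s\<^sup>2 * \<sigma>\<^sup>2 / 2 * E) * exp ((- s) * R X)"
          by (simp only: eq exp_add)
      qed
      also have "\<dots> \<le> exp (- (s * (E - \<theta>)) + s\<^sup>2 * \<sigma>\<^sup>2 / 2 * E) * (real (card ?\<Omega>) * exp ((- s)\<^sup>2 / 2 * (E * (a * E / real n))))"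
        unfolding sum_distrib_left[symmetric] by (intro mult_left_mono R) simp
      also have "\<dots> = real (card ?\<Omega>) * exp (- (s * (E - \<theta>)) + s\<^sup>2 / 2 * v)"
        by (simp only: power2_minus vs[symmetric] exp_add) (simp only: mult_ac)
      also have "- (s * (E - \<theta>)) + s\<^sup>2 / 2 * v = - (E - \<theta>)\<^sup>2 / (2 * v)"
        unfolding s_def by (rule chernoff_exponent[OF v])
      finally show ?thesis using True by (simp add: \<beta>1_def)
    next
      case False
      have "(\<Sum>X\<in>?\<Omega>. h X W (i, w)) = (\<Sum>X\<in>?\<Omega>. exp (- (t * \<theta>) + t\<^sup>2 * \<sigma>\<^sup>2 / 2 * E) * exp (t * R X))"
      proof (rule sum.cong[OF refl])
        fix X assume X: "X \<in> ?\<Omega>"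
        have eq: "t * (0 + R X - \<theta>) + t\<^sup>2 * \<sigma>\<^sup>2 / 2 * E = (- (t * \<theta>) + t\<^sup>2 * \<sigma>\<^sup>2 / 2 * E) + t * R X"
          by (simp add: algebra_simps)
        have "h X W (i, w) = exp (t * (0 + R X - \<theta>) + t\<^sup>2 * \<sigma>\<^sup>2 / 2 * E)"
          using False by (simp add: h_def r[OF X])
        then show "h X W (i, w) = exp (- (t * \<theta>) + t\<^sup>2 * \<sigma>\<^sup>2 / 2 * E) * exp (t * R X)"
          by (simp only: eq exp_add)
      qed
      also have "\<dots> \<le> exp (- (t * \<theta>) + t\<^sup>2 * \<sigma>\<^sup>2 / 2 * E) * (real (card ?\<Omega>) * exp (t\<^sup>2 / 2 * (E * (a * E / real n))))"
        unfolding sum_distrib_left[symmetric] by (intro mult_left_mono R) simp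
      also have "\<dots> = real (card ?\<Omega>) * exp (- (t * \<theta>) + t\<^sup>2 / 2 * v)"
        by (simp only: power2_minus vs[symmetric] exp_add) (simp only: mult_ac)
      also have "- (t * \<theta>) + t\<^sup>2 / 2 * v = - \<theta>\<^sup>2 / (2 * v)"
        unfolding t_def by (rule chernoff_exponent[OF v])
      finally show ?thesis using False by (simp add: \<beta>2_def)
    qed
  qed
  \<comment> \<open>Each user has at most one true message, so misses are counted \<open>l\<close>
    times only, and false alarms at most \<open>l * M\<close> times.\<close>
  have count: "(\<Sum>(i, w)\<in>{..<l} \<times> {1..M}. if W i = w then \<beta>1 else \<beta>2) \<le> \<beta>" for W
  proof -
    have "(\<Sum>(i, w)\<in>{..<l} \<times> {1..M}. if W i = w then \<beta>1 else \<beta>2) \<le> (\<Sum>(i, w)\<in>{..<l} \<times> {1..M}. \<beta>2 + (if W i = w then \<beta>1 else 0))"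
      by (intro sum_mono) (auto simp: \<beta>1_def \<beta>2_def)
    also have "\<dots> = (\<Sum>i<l. \<Sum>w\<in>{1..M}. \<beta>2 + (if W i = w then \<beta>1 else 0))"
      by (rule sum.cartesian_product[symmetric])
    also have "\<dots> = real l * real M * \<beta>2 + (\<Sum>i<l. \<Sum>w\<in>{1..M}. if W i = w then \<beta>1 else 0)"
      by (simp only: sum.distrib) simp
    also have "(\<Sum>i<l. \<Sum>w\<in>{1..M}. if W i = w then \<beta>1 else 0) \<le> (\<Sum>i<l. \<beta>1)"
      by (intro sum_mono) (simp add: \<beta>1_def)
    finally show ?thesis by (simp add: \<beta>_def)
  qed
  have mean_err: "(\<Sum>X\<in>?\<Omega>. err X W) \<le> real (card ?\<Omega>) * \<beta>" if W: "W \<in> ?T - Bad" for W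
  proof -
    have "(\<Sum>X\<in>?\<Omega>. err X W) \<le> (\<Sum>X\<in>?\<Omega>. \<Sum>x\<in>{..<l} \<times> {1..M}. h X W x)"
      by (intro sum_mono err_le)
    also have "\<dots> = (\<Sum>x\<in>{..<l} \<times> {1..M}. \<Sum>X\<in>?\<Omega>. h X W x)" by (rule sum.swap)
    also have "\<dots> \<le> (\<Sum>(i, w)\<in>{..<l} \<times> {1..M}. real (card ?\<Omega>) * (if W i = w then \<beta>1 else \<beta>2))"
      using mean_h[OF W] by (intro sum_mono) auto
    also have "\<dots> = real (card ?\<Omega>) * (\<Sum>(i, w)\<in>{..<l} \<times> {1..M}. if W i = w then \<beta>1 else \<beta>2)"
      by (simp only: sum_distrib_left case_prod_unfold)
    also have "\<dots> \<le> real (card ?\<Omega>) * \<beta>" by (intro mult_left_mono count) simp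
    finally show ?thesis .
  qed
  have pn: "?p W \<ge> 0" for W by (rule tuple_prob_nonneg)
  have \<beta>0: "\<beta> \<ge> 0" by (simp add: \<beta>_def \<beta>1_def \<beta>2_def)
  have psum: "(\<Sum>W\<in>?T. ?p W) = 1" by (rule sum_tuple_prob[OF sum_pmf_message[OF \<alpha> M]])
  have "(\<Sum>X\<in>?\<Omega>. \<Sum>W\<in>?T. ?p W * err X W) = (\<Sum>W\<in>?T. ?p W * (\<Sum>X\<in>?\<Omega>. err X W))"
    unfolding sum_distrib_left by (rule sum.swap)
  \<comment> \<open>On \<open>Bad\<close> the trivial bound \<open>err \<le> 1\<close> is used, as
    the interference is not controlled there.\<close>
  also have "\<dots> = (\<Sum>W\<in>?T - Bad. ?p W * (\<Sum>X\<in>?\<Omega>. err X W)) + (\<Sum>W\<in>Bad. ?p W * (\<Sum>X\<in>?\<Omega>. err X W))"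
    by (rule sum.subset_diff[OF Bad finite_tuples])
  also have "\<dots> \<le> (\<Sum>W\<in>?T - Bad. ?p W * (real (card ?\<Omega>) * \<beta>)) + (\<Sum>W\<in>Bad. ?p W * (\<Sum>X\<in>?\<Omega>. 1))"
    by (intro add_mono sum_mono mult_left_mono mean_err err_le_1 pn) auto
  also have "\<dots> \<le> (\<Sum>W\<in>?T. ?p W * (real (card ?\<Omega>) * \<beta>)) + (\<Sum>W\<in>Bad. ?p W * (\<Sum>X\<in>?\<Omega>. 1))"
    using pn \<beta>0 finite_subset[OF Bad finite_tuples]
    by (intro add_mono sum_mono2 finite_tuples) auto
  also have "\<dots> = real (card ?\<Omega>) * (\<beta> + (\<Sum>W\<in>Bad. ?p W))"
    unfolding sum_distrib_right[symmetric] psum by (simp add: algebra_simps)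
  also have "\<dots> \<le> real (card ?\<Omega>) * \<epsilon>"
    using budget by (intro mult_left_mono) (simp_all add: \<beta>_def \<beta>1_def \<beta>2_def Bad_def)
  finally have total: "(\<Sum>X\<in>?\<Omega>. \<Sum>W\<in>?T. ?p W * err X W) \<le> real (card ?\<Omega>) * \<epsilon>" .
  have "\<exists>X\<in>?\<Omega>. (\<Sum>W\<in>?T. ?p W * err X W) \<le> \<epsilon>"
  proof (rule ccontr)
    assume "\<not> ?thesis"
    then have gt: "\<epsilon> < (\<Sum>W\<in>?T. ?p W * err X W)" if "X \<in> ?\<Omega>" for X
      using that by (auto simp: not_le)
    have "(\<Sum>X\<in>?\<Omega>. \<epsilon>) < (\<Sum>X\<in>?\<Omega>. \<Sum>W\<in>?T. ?p W * err X W)"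
      using \<Omega> \<Omega>_card gt by (intro sum_strict_mono) auto
    then show False using total by simp
  qed
  then obtain X where X: "X \<in> ?\<Omega>" and X_err: "(\<Sum>W\<in>?T. ?p W * err X W) \<le> \<epsilon>" by blast
  have "\<exists>g. is_code N0 \<alpha> l n M E \<epsilon> (sign_code n M E X) g"
  proof (rule code_exists[where B = "filter_region l M n (sign_code n M E X) \<theta>", OF N0 \<alpha> M \<epsilon>])
    show "(\<Sum>j<n. (sign_code n M E X i w j)\<^sup>2) \<le> E" if "i < l" "w \<le> M" for i w
    proof (cases "w \<in> {1..M}")
      case True
      then show ?thesis using sign_code_energy[OF X that(1) True _ n] E by simp
    next
      case False
      then have "sign_code n M E X i w j = 0" for j by (simp only: sign_code_def if_False)
      then show ?thesis using E by simp
    qed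
    show "(\<Sum>W\<in>?T. ?p W * (1 - measure (gauss n (sqrt (N0 / 2)) (signal l (sign_code n M E X) W))
        (filter_region l M n (sign_code n M E X) \<theta> W))) \<le> \<epsilon>"
      using X_err by (simp only: err_def \<sigma>_def)
  qed (simp_all add: sign_code_def filter_region_sets disjoint_filter_region)
  then show ?thesis by blast
qed

section \<open>Capacity\<close>

lemma prob_too_many_active:
  assumes \<alpha>: "0 \<le> \<alpha>" "\<alpha> \<le> 1" and M: "M \<ge> 1" and a: "a > 0"
  shows "(\<Sum>W | W \<in> tuples l M \<and> real (card (active l W)) > a. tuple_prob (pmf (message_pmf \<alpha> M)) l W) \<le> \<alpha> * real l / a"
proof -
  let ?p = "tuple_prob (pmf (message_pmf \<alpha> M)) l" and ?A = "\<lambda>W. real (card (active l W))"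
  define Bad where "Bad = {W. W \<in> tuples l M \<and> ?A W > a}"
  have Bad: "Bad \<subseteq> tuples l M" by (auto simp: Bad_def)
  have "a * (\<Sum>W\<in>Bad. ?p W) \<le> (\<Sum>W\<in>Bad. ?p W * ?A W)"
    unfolding sum_distrib_left
  proof (rule sum_mono)
    fix W assume "W \<in> Bad"
    then have "a \<le> ?A W" unfolding Bad_def by simp
    from mult_right_mono[OF this tuple_prob_nonneg] show "a * ?p W \<le> ?p W * ?A W"
      by (simp only: mult.commute)
  qed
  also have "\<dots> \<le> (\<Sum>W\<in>tuples l M. ?p W * ?A W)"
    using tuple_prob_nonneg by (intro sum_mono2 finite_tuples Bad) auto
  also have "\<dots> = \<alpha> * real l" by (rule expected_active[OF \<alpha> M])
  finally show ?thesis using a by (simp add: Bad_def pos_le_divide_eq mult.commute)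
qed

text \<open>The maximum with 1 costs nothing asymptotically. For \<open>l n \<ge> 2\<close> it is at
  most \<open>ln (l n) / ln 2\<close>; otherwise the hypothesis is empty, but
  \<open>k n \<le> 1\<close>.\<close>

lemma active_times_max_ln_small:
  fixes b \<xi> :: real and \<alpha> k :: "nat \<Rightarrow> real" and l :: "nat \<Rightarrow> nat"
  assumes b: "b > 1" and probs: "\<And>n. 0 \<le> \<alpha> n \<and> \<alpha> n \<le> 1" and k: "\<And>n. k n = \<alpha> n * real (l n)"
    and slow: "(\<lambda>n. k n * log b (real (l n))) \<in> o(\<lambda>n. real n)" and \<xi>: "\<xi> > 0"
  shows "eventually (\<lambda>n. k n * max 1 (ln (real (l n))) \<le> \<xi> * real n) sequentially"
proof -
  have lnb: "ln b > 0" using b by simp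
  \<comment> \<open>The factor \<open>ln b\<close> changes the base and \<open>ln 2\<close> pays for
    the maximum with 1.\<close>
  define \<zeta> where "\<zeta> = \<xi> * ln 2 / (2 * ln b)"
  have \<zeta>: "\<zeta> > 0" using \<xi> lnb by (simp add: \<zeta>_def)
  have "eventually (\<lambda>n. real n \<ge> 2 / \<xi>) sequentially"
    using filterlim_real_sequentially by (simp add: filterlim_at_top)
  moreover have "eventually (\<lambda>n. norm (k n * log b (real (l n))) \<le> \<zeta> * norm (real n)) sequentially"
    using landau_o.smallD[OF slow \<zeta>] .
  ultimately show ?thesis
  proof eventually_elim
    case (elim n)
    have kn: "0 \<le> k n" "k n \<le> real (l n)" using k probs[of n] by (simp_all add: mult_left_le_one_le)
    have ln2: "0 < ln (2 :: real)" "ln (2 :: real) \<le> 1" using ln_2_less_1 by simp_all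
    show "k n * max 1 (ln (real (l n))) \<le> \<xi> * real n"
    proof (cases "l n \<ge> 2")
      case True
      then have lnl: "ln 2 \<le> ln (real (l n))" by simp
      have "ln (real (l n)) * ln 2 \<le> ln (real (l n))"
        using ln2 lnl by (intro mult_left_le) linarith+
      then have "ln (real (l n)) \<le> ln (real (l n)) / ln 2"
        by (subst pos_le_divide_eq[OF ln2(1)])
      moreover have "1 \<le> ln (real (l n)) / ln 2"
        using lnl by (subst pos_le_divide_eq[OF ln2(1)]) simp
      ultimately have m: "max 1 (ln (real (l n))) \<le> ln (real (l n)) / ln 2"
        by (rule max.boundedI[rotated])
      have "k n * ln (real (l n)) / ln b \<le> \<zeta> * real n"
        using order_trans[OF abs_ge_self elim(2)[unfolded real_norm_def]] by (simp add: log_def)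
      then have "k n * ln (real (l n)) \<le> \<zeta> * real n * ln b" using lnb by (simp add: pos_divide_le_eq)
      then have "k n * ln (real (l n)) / ln 2 \<le> \<xi> * real n / 2"
        using lnb ln2 by (simp add: \<zeta>_def pos_divide_le_eq mult_ac)
      moreover have "k n * max 1 (ln (real (l n))) \<le> k n * (ln (real (l n)) / ln 2)"
        using m kn by (intro mult_left_mono) auto
      moreover have "\<xi> * real n / 2 \<le> \<xi> * real n" using \<xi> by simp
      ultimately show ?thesis unfolding times_divide_eq_right by linarith
    next
      case False
      then have "l n = 0 \<or> l n = 1" by auto
      then have "k n * max 1 (ln (real (l n))) \<le> 1" using kn by auto
      also have "1 \<le> \<xi> * real n" using elim(1) \<xi> by (simp add: pos_divide_le_eq mult.commute)
      finally show ?thesis .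
    qed
  qed
qed

text \<open>Since \<xi> depends only on \<open>N0\<close>, \<rho> and \<epsilon>, a single value
  serves all blocklengths. The error budget is split into thirds: too many active users, false
  alarms, misses.\<close>

lemma rate_code_exists:
  fixes N0 \<rho> \<epsilon> \<alpha> :: real and l n :: nat
  assumes N0: "N0 > 0" and \<rho>: "0 < \<rho>" "\<rho> < 1 / N0" and \<epsilon>: "0 < \<epsilon>" "\<epsilon> < 1"
  obtains \<xi> where "\<xi> > 0"
    and "\<And>\<alpha> l n. 0 \<le> \<alpha> \<Longrightarrow> \<alpha> \<le> 1 \<Longrightarrow> \<alpha> * real l > 0 \<Longrightarrow> n \<ge> 1 \<Longrightarrow>
      \<alpha> * real l * max 1 (ln (real l)) \<le> \<xi> * real n \<Longrightarrow>
      \<exists>M E f g. is_code N0 \<alpha> l n M E \<epsilon> f g \<and> E > 0 \<and> ln (real M) > \<rho> * E"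
proof -
  define r where "r = \<rho> * N0"
  have r: "0 < r" "r < 1" using \<rho> N0 by (simp_all add: r_def pos_less_divide_eq)
  \<comment> \<open>Gives \<open>(1 + r) / 2 = 1 - 3 * \<eta>\<close>, and
    \<open>(1 - 3 * \<eta>) * (1 + \<eta>) \<le> (1 - \<eta>)\<^sup>2\<close>. The false-alarm
    exponent \<gamma> then stays strictly above \<rho>, although the threshold is lowered and the
    variance raised by \<eta>.\<close>
  define \<eta> where "\<eta> = (1 - r) / 6"
  have \<eta>: "0 < \<eta>" "\<eta> < 1" using r by (simp_all add: \<eta>_def)
  define \<gamma> where "\<gamma> = (1 - \<eta>)\<^sup>2 / ((1 + \<eta>) * N0)"
  \<comment> \<open>Exponent of a miss per unit of energy.\<close>
  define \<kappa> where "\<kappa> = \<eta>\<^sup>2 / ((1 + \<eta>) * N0)"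
  have \<kappa>: "\<kappa> > 0" using \<eta> N0 by (simp add: \<kappa>_def)
  have "(1 + r) / 2 * (1 + \<eta>) \<le> (1 - \<eta>)\<^sup>2"
  proof -
    have e: "(1 + r) / 2 = 1 - 3 * \<eta>" by (simp add: \<eta>_def field_simps)
    show ?thesis unfolding e by (simp add: power2_eq_square algebra_simps)
  qed
  then have "(1 + r) / 2 \<le> (1 - \<eta>)\<^sup>2 / (1 + \<eta>)"
    using \<eta> by (subst pos_le_divide_eq) auto
  then have "(1 + r) / 2 / N0 \<le> \<gamma>"
    unfolding \<gamma>_def divide_divide_eq_left[symmetric] using N0 by (intro divide_right_mono) auto
  moreover have "\<rho> < (1 + r) / 2 / N0"
    using r N0 by (simp add: r_def field_simps)
  ultimately have \<gamma>: "\<gamma> - \<rho> > 0" by simp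
  \<comment> \<open>The 9 is the number of thirds times the factor 3 in the upper bound on
    \<open>M\<close>. The summand 1 absorbs \<open>l \<le> exp m\<close>.\<close>
  define L where "L = 1 + ln (9 / \<epsilon>)"
  have L: "L > 1" using \<epsilon> by (simp add: L_def)
  define K where "K = L / min (\<gamma> - \<rho>) \<kappa>"
  have K: "K > 0" using L \<gamma> \<kappa> by (simp add: K_def)
  have "min (\<gamma> - \<rho>) \<kappa> * K = L" using \<gamma> \<kappa> by (simp add: K_def)
  then have KL: "L \<le> (\<gamma> - \<rho>) * K" "L \<le> \<kappa> * K"
    using mult_right_mono[of "min (\<gamma> - \<rho>) \<kappa>" "\<gamma> - \<rho>" K] mult_right_mono[of "min (\<gamma> - \<rho>) \<kappa>" \<kappa> K] K by auto
  \<comment> \<open>Solves \<open>3 * K / \<epsilon> * \<xi> = \<eta> * (N0 / 2)\<close>, so the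
    interference adds at most a fraction \<eta> to the noise variance.\<close>
  define \<xi> where "\<xi> = \<eta> * \<epsilon> * N0 / (6 * K)"
  have \<xi>: "\<xi> > 0" using \<eta> \<epsilon> N0 K by (simp add: \<xi>_def)
  show ?thesis
  proof (rule that[OF \<xi>])
    fix \<alpha> :: real and l n :: nat
    assume \<alpha>: "0 \<le> \<alpha>" "\<alpha> \<le> 1" and kpos: "\<alpha> * real l > 0" and n: "n \<ge> 1"
      and small: "\<alpha> * real l * max 1 (ln (real l)) \<le> \<xi> * real n"
    define m where "m = max 1 (ln (real l))"
    have m: "m \<ge> 1" by (simp add: m_def)
    have l: "l > 0" using kpos by (cases "l = 0") auto
    have lm: "real l \<le> exp m"
      using l by (metis exp_ln_iff exp_le_cancel_iff m_def max.cobounded2 of_nat_0_less_iff)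
    define E where "E = K * m"
    have E: "E > 0" using K m by (simp add: E_def)
    \<comment> \<open>Adding 1 to the ceiling makes the rate bound strict; as the exponential is at
      least 1, \<open>M\<close> is still at most three times it.\<close>
    define M where "M = nat \<lceil>exp (\<rho> * E)\<rceil> + 1"
    have M: "M \<ge> 1" by (simp add: M_def)
    have Mreal: "real M = of_int \<lceil>exp (\<rho> * E)\<rceil> + 1"
    proof -
      have "0 \<le> \<lceil>exp (\<rho> * E)\<rceil>" by (simp add: order_less_le_trans[OF _ exp_ge_zero])
      then show ?thesis by (simp add: M_def)
    qed
    have M_lower: "exp (\<rho> * E) < real M"
      unfolding Mreal using le_of_int_ceiling[of "exp (\<rho> * E)"] by linarith
    have "1 \<le> exp (\<rho> * E)" using \<rho> E by simp
    then have M_upper: "real M \<le> 3 * exp (\<rho> * E)"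
      unfolding Mreal using ceiling_correct[of "exp (\<rho> * E)"] by linarith
    \<comment> \<open>By Markov's inequality, more than \<open>a\<close> users are active with
      probability at most \<open>\<epsilon> / 3\<close>.\<close>
    define a where "a = 3 * (\<alpha> * real l) / \<epsilon>"
    have a: "a > 0" using kpos \<epsilon> by (simp add: a_def)
    define v where "v = E * (N0 / 2 + a * E / real n)"
    have v: "v > 0" unfolding v_def using N0 E a n by (intro mult_pos_pos add_pos_nonneg) auto
    have "a * E / real n = 3 * K / \<epsilon> * (\<alpha> * real l * m / real n)" by (simp add: a_def E_def)
    also have "\<dots> \<le> 3 * K / \<epsilon> * \<xi>"
      using small K \<epsilon> n by (intro mult_left_mono) (auto simp: m_def pos_divide_le_eq)
    also have "\<dots> = \<eta> * (N0 / 2)" using K \<epsilon> by (simp add: \<xi>_def)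
    finally have "N0 / 2 + a * E / real n \<le> (1 + \<eta>) * (N0 / 2)" by (simp add: algebra_simps)
    then have v_upper: "2 * v \<le> E * ((1 + \<eta>) * N0)"
    proof -
      have "v \<le> E * ((1 + \<eta>) * (N0 / 2))"
        unfolding v_def using \<open>N0 / 2 + a * E / real n \<le> (1 + \<eta>) * (N0 / 2)\<close> E by (intro mult_left_mono) auto
      then show ?thesis by simp
    qed
    have exponent: "c\<^sup>2 / ((1 + \<eta>) * N0) * E \<le> (c * E)\<^sup>2 / (2 * v)" for c
    proof -
      have "c\<^sup>2 / ((1 + \<eta>) * N0) * E = (c * E)\<^sup>2 / (E * ((1 + \<eta>) * N0))"
        using E by (simp add: power2_eq_square)
      also have "\<dots> \<le> (c * E)\<^sup>2 / (2 * v)"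
        using v_upper v E \<eta> N0 by (intro divide_left_mono mult_pos_pos) auto
      finally show ?thesis .
    qed
    define \<theta> where "\<theta> = (1 - \<eta>) * E"
    have \<theta>: "0 < \<theta>" "\<theta> < E" using \<eta> E by (simp_all add: \<theta>_def)
    \<comment> \<open>The factor \<open>l\<close> is at most \<open>exp m\<close>, and
      \<open>E = K * m\<close> makes the exponent at least \<open>L * m\<close>; the remainder
      \<open>(L - 1) * m\<close> is smallest at \<open>m = 1\<close>.\<close>
    have l_exp: "real l * exp (- (c * E)) \<le> \<epsilon> / 9" if "L \<le> c * K" for c
    proof -
      have "real l * exp (- (c * E)) \<le> exp m * exp (- (c * E))" using lm by (intro mult_right_mono) auto
      also have "\<dots> = exp (m - c * K * m)" by (simp add: E_def flip: exp_add)
      also have "m - c * K * m \<le> - (L - 1)"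
      proof -
        have "L * m \<le> c * K * m" using that m by (intro mult_right_mono) auto
        moreover have "(L - 1) * 1 \<le> (L - 1) * m" using L m by (intro mult_left_mono) auto
        ultimately show ?thesis by (simp add: left_diff_distrib)
      qed
      also have "exp (- (L - 1)) = \<epsilon> / 9" using \<epsilon> by (simp add: L_def exp_minus)
      finally show ?thesis by simp
    qed
    have "exp (- \<theta>\<^sup>2 / (2 * v)) \<le> exp (- (\<gamma> * E))"
      using exponent[of "1 - \<eta>"] by (simp add: \<gamma>_def \<theta>_def)
    then have "real l * real M * exp (- \<theta>\<^sup>2 / (2 * v)) \<le> real l * (3 * exp (\<rho> * E)) * exp (- (\<gamma> * E))"
      using M_upper by (intro mult_mono mult_left_mono) auto
    also have "\<dots> = 3 * (real l * exp (- ((\<gamma> - \<rho>) * E)))"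
    proof -
      have "exp (\<rho> * E) * exp (- (\<gamma> * E)) = exp (- ((\<gamma> - \<rho>) * E))"
        by (simp add: algebra_simps flip: exp_add)
      then show ?thesis by (simp add: mult.assoc mult.left_commute)
    qed
    also have "\<dots> \<le> 3 * (\<epsilon> / 9)" by (intro mult_left_mono l_exp KL) auto
    finally have e1: "real l * real M * exp (- \<theta>\<^sup>2 / (2 * v)) \<le> \<epsilon> / 3" by simp
    have "E - \<theta> = \<eta> * E" by (simp add: \<theta>_def algebra_simps)
    then have "exp (- (E - \<theta>)\<^sup>2 / (2 * v)) \<le> exp (- (\<kappa> * E))"
      using exponent[of \<eta>] by (simp add: \<kappa>_def)
    then have "real l * exp (- (E - \<theta>)\<^sup>2 / (2 * v)) \<le> real l * exp (- (\<kappa> * E))"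
      by (intro mult_left_mono) auto
    also have "\<dots> \<le> \<epsilon> / 9" by (intro l_exp KL)
    also have "\<dots> \<le> \<epsilon> / 3" using \<epsilon> by simp
    finally have e2: "real l * exp (- (E - \<theta>)\<^sup>2 / (2 * v)) \<le> \<epsilon> / 3" .
    have "x / (3 * x / \<epsilon>) = \<epsilon> / 3" if "x > 0" for x using that \<epsilon> by simp
    from this[OF kpos] have e3: "(\<Sum>W | W \<in> tuples l M \<and> real (card (active l W)) > a. tuple_prob (pmf (message_pmf \<alpha> M)) l W) \<le> \<epsilon> / 3"
      using prob_too_many_active[OF \<alpha> M a, of l] by (simp only: a_def)
    have "\<exists>f g. is_code N0 \<alpha> l n M E \<epsilon> f g"
    proof (rule random_code_exists[OF N0 \<alpha> M _ \<epsilon>(2) n E _ \<theta>])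
      show "(\<Sum>W | W \<in> tuples l M \<and> real (card (active l W)) > a. tuple_prob (pmf (message_pmf \<alpha> M)) l W)
        + (real l * real M * exp (- \<theta>\<^sup>2 / (2 * (E * (N0 / 2 + a * E / real n))))
        + real l * exp (- (E - \<theta>)\<^sup>2 / (2 * (E * (N0 / 2 + a * E / real n))))) \<le> \<epsilon>"
        using e1 e2 e3 unfolding v_def by linarith
    qed (use \<epsilon> a in auto)
    moreover have "ln (real M) > \<rho> * E"
      using M_lower M by (metis exp_gt_zero ln_exp ln_less_cancel_iff order_less_trans)
    ultimately show "\<exists>M E f g. is_code N0 \<alpha> l n M E \<epsilon> f g \<and> E > 0 \<and> ln (real M) > \<rho> * E"
      using E by blast
  qed
qed

lemma achievable_wideband_limit:
  fixes b N0 :: real and \<alpha> k :: "nat \<Rightarrow> real" and l :: "nat \<Rightarrow> nat"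
  assumes b: "b > 1" and N0: "N0 > 0" and probs: "\<And>n. 0 \<le> \<alpha> n \<and> \<alpha> n \<le> 1"
    and k: "\<And>n. k n = \<alpha> n * real (l n)" and k1: "k \<in> \<Omega>(\<lambda>n. 1)"
    and slow: "(\<lambda>n. k n * log b (real (l n))) \<in> o(\<lambda>n. real n)"
  shows "achievable b N0 \<alpha> l (log b (exp 1) / N0)"
  unfolding achievable_def eps_achievable_def
proof (intro allI impI)
  fix \<epsilon> \<delta> :: real assume \<epsilon>: "0 < \<epsilon> \<and> \<epsilon> < 1" and \<delta>: "0 < \<delta>"
  have lnb: "ln b > 0" using b by simp
  \<comment> \<open>The second entry keeps \<rho> positive when \<delta> is large.\<close>
  define \<rho> where "\<rho> = max (1 / N0 - \<delta> * ln b) (1 / (2 * N0))"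
  have \<rho>: "0 < \<rho>" "\<rho> < 1 / N0"
    using N0 \<delta> lnb by (auto simp: \<rho>_def less_max_iff_disj divide_strict_left_mono)
  obtain c where c: "c > 0" "eventually (\<lambda>n. k n \<ge> c) sequentially"
    using bigomega_1_D[OF k1] probs k by (metis mult_nonneg_nonneg of_nat_0_le_iff)
  obtain \<xi> where \<xi>: "\<xi> > 0"
    and codes: "\<And>\<alpha> l n. 0 \<le> \<alpha> \<Longrightarrow> \<alpha> \<le> 1 \<Longrightarrow> \<alpha> * real l > 0 \<Longrightarrow> n \<ge> 1 \<Longrightarrow>
      \<alpha> * real l * max 1 (ln (real l)) \<le> \<xi> * real n \<Longrightarrow>
      \<exists>M E f g. is_code N0 \<alpha> l n M E \<epsilon> f g \<and> E > 0 \<and> ln (real M) > \<rho> * E"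
    using rate_code_exists[OF N0 \<rho>, of \<epsilon>] \<epsilon> by metis
  have "eventually (\<lambda>n. \<exists>M E f g. is_code N0 (\<alpha> n) (l n) n M E \<epsilon> f g \<and> E > 0 \<and>
      log b (real M) / E > log b (exp 1) / N0 - \<delta>) sequentially"
    using active_times_max_ln_small[OF b probs k slow \<xi>] c(2) eventually_ge_at_top[of 1]
  proof eventually_elim
    case (elim n)
    have "\<alpha> n * real (l n) > 0" using elim(2) c(1) k[of n] by linarith
    moreover have "\<alpha> n * real (l n) * max 1 (ln (real (l n))) \<le> \<xi> * real n" using elim(1) k by simp
    ultimately obtain M E f g where cd: "is_code N0 (\<alpha> n) (l n) n M E \<epsilon> f g" and E: "E > 0" and M: "ln (real M) > \<rho> * E"
      using codes[of "\<alpha> n" "l n" n] probs[of n] elim(3) by blast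
    have "(log b (exp 1) / N0 - \<delta>) * ln b = 1 / N0 - \<delta> * ln b"
      using lnb by (simp add: log_def left_diff_distrib)
    also have "\<dots> \<le> \<rho>" by (simp add: \<rho>_def)
    finally have "(log b (exp 1) / N0 - \<delta>) * ln b * E \<le> \<rho> * E" using E by (intro mult_right_mono) auto
    then have "log b (real M) / E > log b (exp 1) / N0 - \<delta>"
      unfolding rate_gt_iff[OF b E] using M by linarith
    then show ?case using cd E by blast
  qed
  then show "\<exists>n0. \<forall>n\<ge>n0. \<exists>M E f g. is_code N0 (\<alpha> n) (l n) n M E \<epsilon> f g \<and> E > 0 \<and>
      log b (real M) / E > log b (exp 1) / N0 - \<delta>"
    unfolding eventually_sequentially .
qed

text \<open>With one message per user the rate is 0 at any energy, so only reliable detection of the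
  active set is required. It shows that the supremum is attained in the second regime.\<close>

lemma achievable_0:
  assumes N0: "N0 > 0" and probs: "\<And>n. 0 \<le> \<alpha> n \<and> \<alpha> n \<le> 1"
  shows "achievable b N0 \<alpha> l 0"
  unfolding achievable_def eps_achievable_def
proof (intro allI impI)
  fix \<epsilon> \<delta> :: real assume \<epsilon>: "0 < \<epsilon> \<and> \<epsilon> < 1" and \<delta>: "0 < \<delta>"
  have "\<exists>M E f g. is_code N0 (\<alpha> n) (l n) n M E \<epsilon> f g \<and> E > 0 \<and> log b (real M) / E > 0 - \<delta>" if n: "n \<ge> 1" for n
  proof -
    obtain E f g where "is_code N0 (\<alpha> n) (l n) n 1 E \<epsilon> f g" "E > 0"
      using zero_rate_code[OF N0 _ _ _ _ n, of "\<alpha> n" \<epsilon> "l n"] probs[of n] \<epsilon> by blast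
    then show ?thesis
      using \<delta> by (intro exI[of _ 1] exI[of _ E] exI[of _ f] exI[of _ g]) simp
  qed
  then show "\<exists>n0. \<forall>n\<ge>n0. \<exists>M E f g. is_code N0 (\<alpha> n) (l n) n M E \<epsilon> f g \<and> E > 0 \<and> log b (real M) / E > 0 - \<delta>"
    by blast
qed

lemma capacity_eqI:
  assumes "achievable b N0 \<alpha> l C" "\<And>R. achievable b N0 \<alpha> l R \<Longrightarrow> R \<le> C"
  shows "capacity_per_unit_energy b N0 \<alpha> l = ereal C"
  unfolding capacity_per_unit_energy_def using assms
  by (intro antisym Sup_least Sup_upper) auto

theorem theorem1:
  fixes b N0 \<alpha>_lim :: real and \<alpha> :: "nat \<Rightarrow> real" and l :: "nat \<Rightarrow> nat" and k :: "nat \<Rightarrow> real"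
  assumes "b > 1" and "N0 > 0"
    and "\<And>n. 0 \<le> \<alpha> n \<and> \<alpha> n \<le> 1"
    and "0 \<le> \<alpha>_lim" and "\<alpha>_lim \<le> 1" and "\<alpha> \<longlonglongrightarrow> \<alpha>_lim"
    and "\<And>n. k n = \<alpha> n * real (l n)"
    and "k \<in> \<Omega>(\<lambda>n. 1)"
  shows "((\<lambda>n. k n * log b (real (l n))) \<in> o(\<lambda>n. real n) \<longrightarrow>
            capacity_per_unit_energy b N0 \<alpha> l = ereal (log b (exp 1) / N0)) \<and>
         ((\<lambda>n. k n * log b (real (l n))) \<in> \<omega>(\<lambda>n. real n) \<longrightarrow>
            capacity_per_unit_energy b N0 \<alpha> l = 0)"
proof (intro conjI impI)
  assume slow: "(\<lambda>n. k n * log b (real (l n))) \<in> o(\<lambda>n. real n)"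
  show "capacity_per_unit_energy b N0 \<alpha> l = ereal (log b (exp 1) / N0)"
    by (rule capacity_eqI[OF achievable_wideband_limit[OF assms(1,2,3,7,8) slow] achievable_le[OF assms(1,2,3,7,8)]])
next
  assume fast: "(\<lambda>n. k n * log b (real (l n))) \<in> \<omega>(\<lambda>n. real n)"
  show "capacity_per_unit_energy b N0 \<alpha> l = 0"
    using capacity_eqI[OF achievable_0[OF assms(2,3)] achievable_le_0[OF assms(1,2,3,7,8) fast]]
    by (simp add: zero_ereal_def)
qed

end
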